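(* Let $\mathcal{U}\subset\mathbb{R}^2$ be an open set with $(0,0)\in\mathcal{U}$ and let $F:\mathcal{U}\to\mathbb{R}^2$ be a $\mathcal{C}^2(\mathcal{U})$ map such that $F(0,0)=(0,0)$ and $DF(0,0)$ is diagonalizable (over $\mathbb{C}$), with eigenvalues $\lambda$ and $\mu$. Assume that $F$ has a meromorphic first integral $H$ in $\mathcal{U}$. (i) If $\lambda,\mu\in\mathbb{R}$ and $\lambda\mu\neq0$, then there exists $(0,0)\neq(p,q)\in\mathbb{Z}^2$ such that $\lambda^p\mu^q=1$. (ii) If $0\neq\lambda\in\mathbb{C}\setminus\mathbb{R}$ (hence $\mu=\bar\lambda$), then either $|\lambda|=1$, or $\lambda=|\lambda|e^{i\theta}$ and there exists $0\neq n\in\mathbb{N}$ such that $(e^{i\theta})^{2n}=1$. (iii) If $\lambda\neq0$ and $\mu=0$, then there exists $n\in\mathbb{N}^+$ such that $\lambda^n=1$.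
   Context: Two (real) analytic functions $P,Q:\mathcal{U}\subset\mathbb{R}^2\to\mathbb{R}$ are coprime if the points of $\{(x,y)\in\mathcal{U}:P(x,y)=Q(x,y)=0\}$ are isolated. A meromorphic function is $H=P/Q$ with $P,Q$ coprime (and $Q\not\equiv0$). A meromorphic first integral of $F$ in $\mathcal{U}$ is a meromorphic function $H=P/Q$, not constant on any neighborhood of the origin, such that $P(F(x,y))\,Q(x,y)=P(x,y)\,Q(F(x,y))$ for all $(x,y)\in\mathcal{U}$ (for which both sides are defined). $\mathbb{N}^+$ denotes the positive integers. *)

theory Defs
  imports "HOL-Analysis.Analysis" "HOL-Computational_Algebra.Polynomial"
begin

section \<open>Maps of class C2\<close>

text \<open>Second-order continuous Frechet differentiability. On an open set, only the values of
  the map on that set matter.\<close>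

definition C2_on :: "('a::real_normed_vector \<Rightarrow> 'b::real_normed_vector) \<Rightarrow> 'a set \<Rightarrow> bool" where
  "C2_on F U \<longleftrightarrow>
    (\<exists>(F' :: 'a \<Rightarrow> 'a \<Rightarrow>\<^sub>L 'b) (F'' :: 'a \<Rightarrow> 'a \<Rightarrow>\<^sub>L ('a \<Rightarrow>\<^sub>L 'b)).
      (\<forall>z\<in>U. (F has_derivative blinfun_apply (F' z)) (at z)) \<and>
      (\<forall>z\<in>U. (F' has_derivative blinfun_apply (F'' z)) (at z)) \<and>
      continuous_on U F'')"

section \<open>Diagonalizability and eigenvalues\<close>

definition complex_matrix :: "real^'n^'m \<Rightarrow> complex^'n^'m" where
  "complex_matrix A = (\<chi> i j. complex_of_real (A $ i $ j))"

definition diagonalizable :: "('a::field)^'n^'n \<Rightarrow> bool" where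
  "diagonalizable A \<longleftrightarrow>
    (\<exists>S D :: 'a^'n^'n. invertible S \<and> (\<forall>i j. i \<noteq> j \<longrightarrow> D $ i $ j = 0) \<and> A = S ** D ** matrix_inv S)"

definition charpoly :: "('a::comm_ring_1)^'n^'n \<Rightarrow> 'a poly" where
  "charpoly A = det (\<chi> i j. (if i = j then [:0, 1:] else 0) - [:A $ i $ j:])"

text \<open>The eigenvalues of a 2 by 2 matrix are counted with algebraic multiplicity.\<close>

definition eigenvalues2 :: "('a::field)^2^2 \<Rightarrow> 'a \<Rightarrow> 'a \<Rightarrow> bool" where
  "eigenvalues2 A l m \<longleftrightarrow> charpoly A = [:-l, 1:] * [:-m, 1:]"

section \<open>Analytic functions of two real variables and meromorphic first integrals\<close>

text \<open>Since the set is meant to be open, it is irrelevant whether the disc of convergence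
  is required to lie in it.\<close>

definition real_analytic2_on :: "(real^2 \<Rightarrow> real) \<Rightarrow> (real^2) set \<Rightarrow> bool" where
  "real_analytic2_on f U \<longleftrightarrow>
    (\<forall>a\<in>U. \<exists>(c :: nat \<Rightarrow> nat \<Rightarrow> real) r. r > 0 \<and>
      (\<forall>z\<in>ball a r.
        ((\<lambda>(i, j). c i j * (z $ 1 - a $ 1) ^ i * (z $ 2 - a $ 2) ^ j) has_sum f z) UNIV))"

definition coprime_on :: "(real^2) set \<Rightarrow> (real^2 \<Rightarrow> real) \<Rightarrow> (real^2 \<Rightarrow> real) \<Rightarrow> bool" where
  "coprime_on U P Q \<longleftrightarrow> discrete {z\<in>U. P z = 0 \<and> Q z = 0}"

text \<open>A meromorphic function is represented by its numerator and denominator.\<close>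

definition meromorphic2_on :: "(real^2) set \<Rightarrow> (real^2 \<Rightarrow> real) \<Rightarrow> (real^2 \<Rightarrow> real) \<Rightarrow> bool" where
  "meromorphic2_on U P Q \<longleftrightarrow>
    real_analytic2_on P U \<and> real_analytic2_on Q U \<and> coprime_on U P Q \<and> (\<exists>z\<in>U. Q z \<noteq> 0)"

text \<open>The quotient is a function only where the denominator is nonzero, so non-constancy
  refers to these points; in particular the denominator does not vanish identically near the
  origin. The invariance equation is required at the points of the domain whose image
  lies in the domain again.\<close>

definition meromorphic_first_integral ::
  "(real^2) set \<Rightarrow> (real^2 \<Rightarrow> real^2) \<Rightarrow> (real^2 \<Rightarrow> real) \<Rightarrow> (real^2 \<Rightarrow> real) \<Rightarrow> bool" where
  "meromorphic_first_integral U F P Q \<longleftrightarrow>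
    meromorphic2_on U P Q \<and>
    (\<forall>V. open V \<and> 0 \<in> V \<and> V \<subseteq> U \<longrightarrow>
      \<not> (\<lambda>z. P z / Q z) constant_on {z\<in>V. Q z \<noteq> 0}) \<and>
    (\<forall>z\<in>U. F z \<in> U \<longrightarrow> P (F z) * Q z = P z * Q (F z))"

end

theory Submission
  imports Defs "HOL-Complex_Analysis.Complex_Analysis"
begin

text \<open>
  Write \<open>P\<close> and \<open>Q\<close> near the origin as convergent power series, and consider their leading homogeneous
  forms. Replacing \<open>P\<close> by \<open>P - k Q\<close> changes neither the invariance relation nor the nonconstancy of the
  quotient, so the two forms can be taken to be not proportional. Blowing up the relation
  \<open>P(F z) Q(z) = P(z) Q(F z)\<close> at the origin shows that the quotient of the forms is invariant
  under the linear part \<open>L\<close> of \<open>F\<close>. In complex eigencoordinates \<open>L\<close> multiplies every monomial by a product of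
  powers of the eigenvalues \<open>l\<close> and \<open>m\<close>; comparing two suitable monomials yields \<open>l^p m^q = 1\<close> with
  \<open>(p, q) \<noteq> (0, 0)\<close>, provided \<open>l m \<noteq> 0\<close>. This is \<open>linear_resonance\<close>. It covers real eigenvalues directly, and
  conjugate ones after separating absolute value and argument.

  For \<open>m = 0\<close> the relation between the leading forms may be empty, and the reason is dynamical. The
  eigenvalue \<open>l\<close> is real; suppose that it is not \<open>1\<close> or \<open>-1\<close>. Since the derivative of \<open>F\<close> in the direction
  of the kernel vanishes at the origin, two orbits that are vertically above each other after \<open>n\<close> steps have
  a distance of the order of a product of \<open>n\<close> terms of a geometric sequence, which is much smaller than any
  power of their distance to the origin. If \<open>|l| < 1\<close>, all orbits in a wedge around the other eigendirection
  converge to the origin. Orbits with different values of \<open>P / Q\<close> would come so close that \<open>P\<close> and \<open>Q\<close> are flat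
  (smaller than every power of the distance to the origin) along an orbit. This is impossible
  by \<open>flat_on_zero_set\<close>: on the zero set of one analytic function, another one cannot be flat and
  nonzero, since it satisfies there an algebraic equation with coefficients holomorphic in one of the variables.
  It follows that \<open>P / Q\<close> has one and the same value on the wedge (\<open>contracting_case\<close>). If \<open>|l| > 1\<close>, one
  follows the orbits until they leave a neighbourhood of the origin, where they have almost the limit value of
  \<open>P / Q\<close> along a line; a combination of \<open>P\<close> and \<open>Q\<close> is then flat at the origin itself (\<open>expanding_case\<close>).
  In both cases a combination of \<open>P\<close> and \<open>Q\<close> has a vanishing power series, so that \<open>P / Q\<close> is constant.
\<close>

(* The symbol is to denote the components of vectors only. *)
no_notation fps_nth (infixl "$" 75)

section \<open>Double power series summed by homogeneous forms\<close>

text \<open>The form of degree \<open>n\<close> of a double power series. Summing a double series by its forms turns it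
  into a one-parameter power series along every ray through the origin, and this is how most
  of the arguments below see it.\<close>

definition hform :: "(nat \<Rightarrow> nat \<Rightarrow> 'a::comm_ring_1) \<Rightarrow> nat \<Rightarrow> 'a \<Rightarrow> 'a \<Rightarrow> 'a" where
  "hform c n x y = (\<Sum>i\<le>n. c i (n - i) * x ^ i * y ^ (n - i))"

definition dseries :: "(nat \<Rightarrow> nat \<Rightarrow> 'a::{real_normed_field,banach}) \<Rightarrow> 'a \<Rightarrow> 'a \<Rightarrow> 'a" where
  "dseries c x y = (\<Sum>n. hform c n x y)"

text \<open>Cauchy's estimate for the coefficients on the bidisc of radius \<open>r\<close>, which is stable under all
  the operations needed: combination, complexification, shift and (on smaller bidiscs)
  differentiation.\<close>

definition geo_bounded :: "(nat \<Rightarrow> nat \<Rightarrow> 'a::real_normed_field) \<Rightarrow> real \<Rightarrow> real \<Rightarrow> bool" where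
  "geo_bounded c S r \<longleftrightarrow> r > 0 \<and> (\<forall>i j. norm (c i j) * r ^ (i + j) \<le> S)"

lemma hform_scale: "hform c n (t * x) (t * y) = t ^ n * hform c n x y"
  unfolding hform_def sum_distrib_left
proof (rule sum.cong)
  fix i assume "i \<in> {..n}"
  then have "t ^ n = t ^ i * t ^ (n - i)" by (simp flip: power_add)
  then show "c i (n - i) * (t * x) ^ i * (t * y) ^ (n - i) = t ^ n * (c i (n - i) * x ^ i * y ^ (n - i))"
    by (simp only: power_mult_distrib mult_ac)
qed simp

lemma hform_lincomb:
  "hform (\<lambda>i j. a * c i j + b * d i j) n x y = a * hform c n x y + b * hform d n x y"
  unfolding hform_def sum_distrib_left sum.distrib[symmetric]
  by (intro sum.cong) (auto simp: algebra_simps)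

lemma hform_swap: "hform (\<lambda>i j. c j i) n y x = hform c n x y"
  unfolding hform_def
  by (rule sum.reindex_bij_witness[of _ "\<lambda>i. n - i" "\<lambda>i. n - i"]) (auto simp: algebra_simps)

lemma hform_of_real:
  "hform (\<lambda>i j. of_real (c i j)) n (of_real x) (of_real y)
    = (of_real (hform c n x y) :: 'a::{real_algebra_1,comm_ring_1})"
  unfolding hform_def by simp

lemma geo_bounded_nonneg: "geo_bounded c S r \<Longrightarrow> S \<ge> 0"
  unfolding geo_bounded_def
  by (metis less_eq_real_def mult_nonneg_nonneg norm_ge_zero order_trans zero_le_power)

lemma geo_bounded_swap: "geo_bounded c S r \<Longrightarrow> geo_bounded (\<lambda>i j. c j i) S r"
  unfolding geo_bounded_def by (metis add.commute)

lemma geo_bounded_of_real: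
  "geo_bounded c S r \<Longrightarrow> geo_bounded (\<lambda>i j. of_real (c i j) :: 'a::real_normed_field) S r"
  unfolding geo_bounded_def by auto

lemma geo_bounded_shift:
  assumes "geo_bounded c S r"
  shows "geo_bounded (\<lambda>i j. c (i + k) j) (S / r ^ k) r"
  unfolding geo_bounded_def
proof (intro conjI allI)
  show "r > 0" using assms by (simp add: geo_bounded_def)
  fix i j
  have "norm (c (i + k) j) * r ^ (i + k + j) \<le> S"
    using assms by (simp add: geo_bounded_def)
  moreover have "r ^ (i + k + j) = r ^ (i + j) * r ^ k" by (simp add: power_add)
  ultimately show "norm (c (i + k) j) * r ^ (i + j) \<le> S / r ^ k"
    using \<open>r > 0\<close> by (simp add: field_simps)
qed

lemma geo_bounded_smaller:
  assumes "geo_bounded c S r" "0 < r'" "r' \<le> r"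
  shows "geo_bounded c S r'"
  unfolding geo_bounded_def
proof (intro conjI allI)
  fix i j
  have "norm (c i j) * r' ^ (i + j) \<le> norm (c i j) * r ^ (i + j)"
    using assms by (intro mult_left_mono power_mono) auto
  also have "\<dots> \<le> S" using assms by (simp add: geo_bounded_def)
  finally show "norm (c i j) * r' ^ (i + j) \<le> S" .
qed (use assms in auto)

lemma geo_bounded_lincomb:
  assumes "geo_bounded c S r" "geo_bounded d S' r"
  shows "geo_bounded (\<lambda>i j. a * c i j + b * d i j) (norm a * S + norm b * S') r"
  unfolding geo_bounded_def
proof (intro conjI allI)
  show r: "r > 0" using assms by (simp add: geo_bounded_def)
  fix i j
  have "norm (a * c i j + b * d i j) \<le> norm a * norm (c i j) + norm b * norm (d i j)"
    by (metis norm_mult norm_triangle_ineq)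
  then have "norm (a * c i j + b * d i j) * r ^ (i + j)
    \<le> norm a * (norm (c i j) * r ^ (i + j)) + norm b * (norm (d i j) * r ^ (i + j))"
    using r by (smt (verit) mult_right_mono zero_le_power distrib_right mult.assoc)
  also have "\<dots> \<le> norm a * S + norm b * S'"
    using assms by (intro add_mono mult_left_mono) (auto simp: geo_bounded_def)
  finally show "norm (a * c i j + b * d i j) * r ^ (i + j) \<le> norm a * S + norm b * S'" .
qed

lemma norm_hform_le:
  assumes "geo_bounded c S r" "norm x \<le> m" "norm y \<le> m"
  shows "norm (hform c n x y) \<le> S * (real (n + 1) * (m / r) ^ n)"
proof -
  have r: "r > 0" using assms by (simp add: geo_bounded_def)
  have m: "0 \<le> m" using assms(2) norm_ge_zero order_trans by blast
  have "norm (hform c n x y) \<le> (\<Sum>i\<le>n. S * (m / r) ^ n)"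
    unfolding hform_def
  proof (rule sum_norm_le)
    fix i assume i: "i \<in> {..n}"
    have "norm (c i (n - i)) * r ^ (i + (n - i)) \<le> S" using assms by (simp add: geo_bounded_def)
    then have c: "norm (c i (n - i)) \<le> S / r ^ n" using i r by (simp add: field_simps)
    have "norm (x ^ i * y ^ (n - i)) \<le> m ^ i * m ^ (n - i)"
      using assms m unfolding norm_mult norm_power by (intro mult_mono power_mono) auto
    also have "\<dots> = m ^ n" using i by (simp flip: power_add)
    finally have "norm (x ^ i * y ^ (n - i)) \<le> m ^ n" .
    then have "norm (c i (n - i)) * norm (x ^ i * y ^ (n - i)) \<le> S / r ^ n * m ^ n"
      using c m by (intro mult_mono) (auto intro: order_trans[OF norm_ge_zero])
    then show "norm (c i (n - i) * x ^ i * y ^ (n - i)) \<le> S * (m / r) ^ n"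
      by (simp add: norm_mult power_divide mult.assoc)
  qed
  then show ?thesis by (simp add: algebra_simps)
qed

lemma summable_geo: 
  assumes "0 \<le> q" "q < (1::real)" 
  shows "summable (\<lambda>n. S * (real (n + 1) * q ^ n))"
proof -
  have "summable (\<lambda>n. diffs (\<lambda>n. 1) n * q ^ n)"
    by (rule termdiff_converges[where K = 1]) (use assms in \<open>auto intro: summable_geometric\<close>)
  then show ?thesis by (intro summable_mult) (simp add: diffs_def)
qed

lemma summable_hform:
  fixes x :: "'a::{real_normed_field,banach}"
  assumes "geo_bounded c S r" "norm x < r" "norm y < r"
  shows "summable (\<lambda>n. hform c n x y)"
proof -
  define m where "m = max (norm x) (norm y)"
  have "0 \<le> m / r" "m / r < 1"
    using assms by (auto simp: m_def geo_bounded_def le_max_iff_disj intro!: divide_nonneg_pos)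
  then have "summable (\<lambda>n. S * (real (n + 1) * (m / r) ^ n))" by (rule summable_geo)
  then show ?thesis
  proof (rule summable_comparison_test')
    show "norm (hform c n x y) \<le> S * (real (n + 1) * (m / r) ^ n)" if "n \<ge> 0" for n
      by (rule norm_hform_le[OF assms(1)]) (auto simp: m_def)
  qed
qed

lemma hform_sums_dseries:
  assumes "geo_bounded c S r" "norm x < r" "norm y < r"
  shows "(\<lambda>n. hform c n x y) sums dseries c x y"
  using summable_hform[OF assms] by (simp add: dseries_def summable_sums)

lemma dseries_swap: "dseries (\<lambda>i j. c j i) y x = dseries c x y"
  by (simp add: dseries_def hform_swap[of c])

lemma dseries_of_real:
  assumes "geo_bounded c S r" "norm x < r" "norm y < r"
  shows "dseries (\<lambda>i j. of_real (c i j)) (of_real x) (of_real y)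
    = (of_real (dseries c x y) :: 'a::{real_normed_field,banach})"
  unfolding dseries_def hform_of_real
  using suminf_of_real[OF summable_hform[OF assms]] by (rule sym)

lemma dseries_lincomb:
  assumes "geo_bounded c S r" "geo_bounded d S' r" "norm x < r" "norm y < r"
  shows "dseries (\<lambda>i j. a * c i j + b * d i j) x y = a * dseries c x y + b * dseries d x y"
proof -
  have "(\<lambda>n. hform (\<lambda>i j. a * c i j + b * d i j) n x y) sums (a * dseries c x y + b * dseries d x y)"
    unfolding hform_lincomb
    using hform_sums_dseries[OF assms(1,3,4)] hform_sums_dseries[OF assms(2,3,4)]
    by (intro sums_add sums_mult)
  then show ?thesis by (simp add: dseries_def sums_unique[symmetric])
qed

lemma uniform_limit_hform:
  assumes "geo_bounded c S r" "0 \<le> m" "m < r"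
  shows "uniform_limit (cball 0 m \<times> cball 0 m)
    (\<lambda>n z. \<Sum>k<n. hform c k (fst z) (snd z)) (\<lambda>z. dseries c (fst z) (snd z)) sequentially"
  unfolding dseries_def
proof (rule Weierstrass_m_test)
  show "norm (hform c n (fst z) (snd z)) \<le> S * (real (n + 1) * (m / r) ^ n)"
    if "z \<in> cball 0 m \<times> cball 0 m" for n z
    using that by (intro norm_hform_le[OF assms(1)]) auto
  show "summable (\<lambda>n. S * (real (n + 1) * (m / r) ^ n))"
    using assms by (intro summable_geo) auto
qed

lemma continuous_on_dseries_cball:
  assumes "geo_bounded c S r" "0 \<le> m" "m < r"
  shows "continuous_on (cball 0 m \<times> cball 0 m) (\<lambda>z. dseries c (fst z) (snd z))"
  by (rule uniform_limit_theorem[OF _ uniform_limit_hform[OF assms]])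
    (auto simp: hform_def intro!: always_eventually continuous_intros)

lemma continuous_on_dseries:
  assumes "geo_bounded c S r" "continuous_on A f" "continuous_on A g"
    "\<And>z. z \<in> A \<Longrightarrow> norm (f z) \<le> m" "\<And>z. z \<in> A \<Longrightarrow> norm (g z) \<le> m" "m < r"
  shows "continuous_on A (\<lambda>z. dseries c (f z) (g z))"
proof (cases "A = {}")
  case False
  then have "0 \<le> m" using assms(4) norm_ge_zero order_trans by blast
  have "continuous_on A ((\<lambda>z. dseries c (fst z) (snd z)) \<circ> (\<lambda>z. (f z, g z)))"
    using assms \<open>0 \<le> m\<close>
    by (intro continuous_on_compose continuous_on_Pair
      continuous_on_subset[OF continuous_on_dseries_cball[OF assms(1) \<open>0 \<le> m\<close> assms(6)]]) auto
  then show ?thesis by (simp add: o_def)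
qed auto

text \<open>The coefficients of the partial derivative in the first variable; the other partial derivative is
  reached by exchanging the variables.\<close>

definition dcoeff :: "(nat \<Rightarrow> nat \<Rightarrow> 'a::comm_ring_1) \<Rightarrow> nat \<Rightarrow> nat \<Rightarrow> 'a" where
  "dcoeff c i j = of_nat (Suc i) * c (Suc i) j"

lemma geo_bounded_dcoeff:
  assumes "geo_bounded c S r" "0 < r'" "r' < r"
  obtains S' where "geo_bounded (dcoeff c) S' r'"
proof -
  define q where "q = r' / r"
  have r: "r > 0" using assms by (simp add: geo_bounded_def)
  have q: "0 \<le> q" "q < 1" using assms r by (auto simp: q_def)
  have "summable (\<lambda>n. S / r * (real (n + 1) * q ^ n))" using q by (rule summable_geo)
  then have "Bseq (\<lambda>n. S / r * (real (n + 1) * q ^ n))"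
    by (intro convergent_imp_Bseq) (meson convergentI summable_LIMSEQ_zero)
  then obtain B where B: "\<And>n. norm (S / r * (real (n + 1) * q ^ n)) \<le> B"
    unfolding Bseq_def by blast
  have "geo_bounded (dcoeff c) B r'"
    unfolding geo_bounded_def
  proof (intro conjI allI)
    fix i j
    have c: "norm (c (Suc i) j) * (r * r ^ (i + j)) \<le> S"
      using assms(1) unfolding geo_bounded_def by (metis add_Suc power_Suc)
    have S: "0 \<le> S" using assms(1) by (rule geo_bounded_nonneg)
    have c2: "norm (c (Suc i) j) \<le> S / r * (1 / r ^ (i + j))" using c r by (simp add: field_simps)
    have "norm (dcoeff c i j) * r' ^ (i + j) = real (i + 1) * norm (c (Suc i) j) * r' ^ (i + j)"
      by (simp add: dcoeff_def norm_mult del: of_nat_Suc)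
    also have "\<dots> \<le> real (i + 1) * (S / r * (1 / r ^ (i + j))) * r' ^ (i + j)"
      using c2 assms by (intro mult_right_mono mult_left_mono) auto
    also have "\<dots> = S / r * (real (i + 1) * q ^ (i + j))" by (simp add: q_def power_divide)
    also have "q ^ (i + j) \<le> q ^ i" using q by (simp add: power_decreasing)
    then have "S / r * (real (i + 1) * q ^ (i + j)) \<le> S / r * (real (i + 1) * q ^ i)"
      using r S by (intro mult_left_mono) auto
    also have "\<dots> \<le> B" using B[of i] unfolding real_norm_def by linarith
    finally show "norm (dcoeff c i j) * r' ^ (i + j) \<le> B" .
  qed (use assms in auto)
  then show ?thesis by (rule that)
qed

lemma hform_has_field_derivative:
  "((\<lambda>x. hform c (Suc n) x y) has_field_derivative hform (dcoeff c) n x y) (at x within A)"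
proof -
  have "((\<lambda>x. hform c (Suc n) x y) has_field_derivative
      (\<Sum>i\<le>Suc n. c i (Suc n - i) * (of_nat i * x ^ (i - 1)) * y ^ (Suc n - i))) (at x within A)"
    unfolding hform_def
  proof (rule DERIV_sum)
    show "((\<lambda>x. c i (Suc n - i) * x ^ i * y ^ (Suc n - i)) has_field_derivative
      c i (Suc n - i) * (of_nat i * x ^ (i - 1)) * y ^ (Suc n - i)) (at x within A)" for i
      using DERIV_power[OF DERIV_ident, of i x A]
      by (intro DERIV_cmult_right DERIV_cmult) simp
  qed
  moreover have "(\<Sum>i\<le>Suc n. c i (Suc n - i) * (of_nat i * x ^ (i - 1)) * y ^ (Suc n - i))
      = hform (dcoeff c) n x y"
    unfolding sum.atMost_Suc_shift hform_def dcoeff_def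
    by (auto intro!: sum.cong simp: algebra_simps)
  ultimately show ?thesis by simp
qed

lemma dseries_has_field_derivative:
  assumes "geo_bounded c S r" "norm x < r" "norm y < r"
  shows "((\<lambda>x. dseries c x y) has_field_derivative dseries (dcoeff c) x y) (at x)"
proof -
  obtain m where m: "max (norm x) (norm y) < m" "m < r" using assms dense[of "max (norm x) (norm y)" r] by auto
  then have m0: "0 < m" using norm_ge_zero[of x] by linarith
  obtain r' where r': "m < r'" "r' < r" using m(2) dense by blast
  obtain S' where S': "geo_bounded (dcoeff c) S' r'"
    using geo_bounded_dcoeff[OF assms(1)] r' m0 by (meson less_trans)
  have un: "uniformly_convergent_on (cball 0 m) (\<lambda>n x. \<Sum>k<n. hform (dcoeff c) k x y)"
  proof (rule Weierstrass_m_test')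
    show "norm (hform (dcoeff c) n x y) \<le> S' * (real (n + 1) * (m / r') ^ n)"
      if "x \<in> cball 0 m" for n x
      using that m by (intro norm_hform_le[OF S']) auto
    show "summable (\<lambda>n. S' * (real (n + 1) * (m / r') ^ n))"
      using m0 r' by (intro summable_geo) auto
  qed
  have sm: "summable (\<lambda>n. hform c (Suc n) 0 y)"
    using summable_hform[OF assms(1), of 0 y] assms by (subst summable_Suc_iff) (auto simp: geo_bounded_def)
  have xi: "x \<in> interior (cball 0 m)" using m by simp
  have "((\<lambda>x. \<Sum>n. hform c (Suc n) x y) has_field_derivative dseries (dcoeff c) x y) (at x)"
    unfolding dseries_def
    by (rule has_field_derivative_series'(2)[OF convex_cball hform_has_field_derivative un _ sm xi])
      (use m0 in auto)
  then have D: "((\<lambda>x. hform c 0 x y + (\<Sum>n. hform c (Suc n) x y)) has_field_derivative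
      dseries (dcoeff c) x y) (at x)"
    by (auto intro!: derivative_eq_intros simp: hform_def)
  have eq: "hform c 0 x' y + (\<Sum>n. hform c (Suc n) x' y) = dseries c x' y" if "x' \<in> ball 0 r" for x'
    unfolding dseries_def
    using suminf_split_head[OF summable_hform[OF assms(1), of x' y]] that assms by simp
  show ?thesis
    by (rule has_field_derivative_transform_within_open[OF D open_ball[of 0 r] _ eq]) (use assms in auto)
qed

lemma dseries_has_field_derivative_snd:
  assumes "geo_bounded c S r" "norm x < r" "norm y < r"
  shows "((\<lambda>y. dseries c x y) has_field_derivative
    dseries (\<lambda>i j. dcoeff (\<lambda>i j. c j i) j i) x y) (at y)"
  using dseries_has_field_derivative[OF geo_bounded_swap[OF assms(1)] assms(3,2)]
  by (simp add: dseries_swap[of c] dseries_swap[of "\<lambda>i j. dcoeff (\<lambda>i j. c j i) j i"])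

lemma dseries_holomorphic_snd:
  fixes c :: "nat \<Rightarrow> nat \<Rightarrow> complex"
  assumes "geo_bounded c S r" "norm x < r"
  shows "(\<lambda>y. dseries c x y) holomorphic_on ball 0 r"
  unfolding holomorphic_on_open[OF open_ball]
  using dseries_has_field_derivative_snd[OF assms] by (metis mem_ball_0)

lemma dseries_shift:
  assumes "geo_bounded c S r" "norm x < r" "norm y < r" "\<And>i j. i < k \<Longrightarrow> c i j = 0"
  shows "dseries c x y = x ^ k * dseries (\<lambda>i j. c (i + k) j) x y"
proof -
  have eq: "hform c (n + k) x y = x ^ k * hform (\<lambda>i j. c (i + k) j) n x y" for n
  proof -
    have "hform c (n + k) x y = (\<Sum>i\<in>{k..n+k}. c i (n + k - i) * x ^ i * y ^ (n + k - i))"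
      unfolding hform_def using assms(4) by (intro sum.mono_neutral_right) auto
    also have "\<dots> = (\<Sum>i\<le>n. c (i + k) (n - i) * x ^ (i + k) * y ^ (n - i))"
      by (rule sum.reindex_bij_witness[of _ "\<lambda>i. i + k" "\<lambda>i. i - k"]) auto
    also have "\<dots> = x ^ k * hform (\<lambda>i j. c (i + k) j) n x y"
      unfolding hform_def sum_distrib_left by (intro sum.cong) (auto simp: power_add algebra_simps)
    finally show ?thesis .
  qed
  have "hform c n x y = 0" if "n < k" for n
    unfolding hform_def using that assms(4) by (intro sum.neutral) auto
  then have "(\<lambda>n. hform c (n + k) x y) sums dseries c x y"
    using hform_sums_dseries[OF assms(1-3)] by (subst sums_iff_shift) auto
  moreover have "(\<lambda>n. hform c (n + k) x y) sums (x ^ k * dseries (\<lambda>i j. c (i + k) j) x y)"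
    unfolding eq using hform_sums_dseries[OF geo_bounded_shift[OF assms(1), of k] assms(2,3)]
    by (rule sums_mult)
  ultimately show ?thesis by (rule sums_unique2)
qed

lemma dseries_0_left:
  assumes "geo_bounded c S r" "norm y < r"
  shows "(\<lambda>n. c 0 n * y ^ n) sums dseries c 0 y"
proof -
  have "hform c n 0 y = c 0 n * y ^ n" for n
  proof -
    have "hform c n 0 y = (\<Sum>i\<in>{0}. c i (n - i) * 0 ^ i * y ^ (n - i))"
      unfolding hform_def by (intro sum.mono_neutral_right) auto
    then show ?thesis by simp
  qed
  then show ?thesis using hform_sums_dseries[OF assms(1), of 0 y] assms by (simp add: geo_bounded_def)
qed

section \<open>Power series in one variable near zero\<close>

lemma powser_shift_sums:
  fixes a :: "nat \<Rightarrow> 'a::{real_normed_field,banach}"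
  assumes "(\<lambda>n. a n * x ^ n) sums y" "\<And>n. n < N \<Longrightarrow> a n = 0" "x \<noteq> 0"
  shows "(\<lambda>n. a (n + N) * x ^ n) sums (y / x ^ N)"
proof -
  have "(\<lambda>n. a (n + N) * x ^ (n + N)) sums y"
    using assms by (subst sums_iff_shift) auto
  then have "(\<lambda>n. a (n + N) * x ^ (n + N) / x ^ N) sums (y / x ^ N)" by (rule sums_divide)
  then show ?thesis using assms(3) by (simp add: power_add)
qed

lemma powser_leading_limit:
  fixes a :: "nat \<Rightarrow> 'a::{real_normed_field,banach}"
  assumes "r > 0" "\<And>x. norm x < r \<Longrightarrow> (\<lambda>n. a n * x ^ n) sums f x" "\<And>n. n < N \<Longrightarrow> a n = 0"
  shows "((\<lambda>x. f x / x ^ N) \<longlongrightarrow> a N) (at 0)"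
proof -
  define g where "g = (\<lambda>x. if x = 0 then a N else f x / x ^ N)"
  have "(\<lambda>n. a (n + N) * x ^ n) sums g x" if "norm x < r" for x
    using powser_shift_sums[OF assms(2)[OF that] assms(3)] powser_sums_zero[of "\<lambda>n. a (n + N)"]
    by (auto simp: g_def)
  then have "(g \<longlongrightarrow> a (0 + N)) (at 0)" by (rule powser_limit_0[OF assms(1)])
  then have "(g \<longlongrightarrow> a N) (at 0)" by simp
  moreover have "eventually (\<lambda>x. g x = f x / x ^ N) (at 0)"
    by (auto simp: g_def eventually_at_filter)
  ultimately show ?thesis by (rule Lim_transform_eventually)
qed

text \<open>Near zero a power series is comparable with its first nonzero term.\<close>

lemma powser_lower_bound:
  fixes a :: "nat \<Rightarrow> 'a::{real_normed_field,banach}"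
  assumes "r > 0" "\<And>x. norm x < r \<Longrightarrow> (\<lambda>n. a n * x ^ n) sums f x" "a M \<noteq> 0"
  obtains N e where "e > 0" "eventually (\<lambda>x. norm (f x) \<ge> e * norm x ^ N) (at 0)"
proof -
  define N where "N = (LEAST n. a n \<noteq> 0)"
  have N: "a N \<noteq> 0" unfolding N_def using assms(3) by (rule LeastI)
  have "\<And>n. n < N \<Longrightarrow> a n = 0" unfolding N_def using not_less_Least by blast
  then have "((\<lambda>x. norm (f x / x ^ N)) \<longlongrightarrow> norm (a N)) (at 0)"
    by (intro tendsto_norm powser_leading_limit[OF assms(1,2)])
  then have "eventually (\<lambda>x. norm (f x / x ^ N) > norm (a N) / 2) (at 0)"
    using N by (intro order_tendstoD) auto
  moreover have "eventually (\<lambda>x. x \<noteq> 0) (at (0::'a))" by (simp add: eventually_at_filter)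
  ultimately have "eventually (\<lambda>x. norm (f x) \<ge> norm (a N) / 2 * norm x ^ N) (at 0)"
    by eventually_elim (simp add: norm_divide norm_power field_simps)
  then show ?thesis using N by (intro that[of "norm (a N) / 2" N]) auto
qed

text \<open>A function that is flat along a sequence tending to zero cannot have a nonzero coefficient,
  because the leading term would dominate.\<close>

lemma powser_flat_imp_zero:
  fixes a :: "nat \<Rightarrow> 'a::{real_normed_field,banach}" and x :: "nat \<Rightarrow> 'a"
  assumes "r > 0" "\<And>x. norm x < r \<Longrightarrow> (\<lambda>n. a n * x ^ n) sums f x"
    and "x \<longlonglongrightarrow> 0" "\<And>k. x k \<noteq> 0"
    and flat: "\<And>N. \<exists>C. eventually (\<lambda>k. norm (f (x k)) \<le> C * norm (x k) ^ N) sequentially"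
  shows "a M = 0"
proof (rule ccontr)
  assume "a M \<noteq> 0"
  then obtain N e where e: "e > 0" "eventually (\<lambda>x. norm (f x) \<ge> e * norm x ^ N) (at 0)"
    using powser_lower_bound[OF assms(1,2)] by blast
  have "filterlim x (at 0) sequentially" using assms(3,4) by (auto simp: filterlim_at)
  then have lower: "eventually (\<lambda>k. norm (f (x k)) \<ge> e * norm (x k) ^ N) sequentially"
    by (rule eventually_compose_filterlim[OF e(2)])
  obtain C where C: "eventually (\<lambda>k. norm (f (x k)) \<le> C * norm (x k) ^ Suc N) sequentially"
    using flat by blast
  have "(\<lambda>k. C * norm (x k)) \<longlonglongrightarrow> C * norm (0::'a)"
    using assms(3) by (intro tendsto_intros)
  then have "eventually (\<lambda>k. C * norm (x k) < e) sequentially"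
    using e(1) by (intro order_tendstoD) auto
  with lower C have "eventually (\<lambda>k. False) sequentially"
  proof eventually_elim
    case (elim k)
    have "0 < norm (x k) ^ N" using assms(4) by simp
    then have "C * norm (x k) * norm (x k) ^ N < e * norm (x k) ^ N"
      using elim by (intro mult_strict_right_mono)
    then show ?case using elim by (simp add: mult.assoc)
  qed
  then show False by simp
qed

section \<open>Power sums and elementary symmetric functions\<close>

text \<open>The coefficients of a product of factors \<open>1 - g t\<close> in terms of the power sums
  of the \<open>g\<close>, as given by Newton's identities.\<close>

fun newton_coeff :: "(nat \<Rightarrow> complex) \<Rightarrow> nat \<Rightarrow> complex" where
  "newton_coeff p 0 = 1"
| "newton_coeff p (Suc k) = - (\<Sum>i\<le>k. newton_coeff p i * p (Suc (k - i))) / of_nat (Suc k)"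

text \<open>The logarithmic derivative of \<open>(1 - g t)^m\<close> is minus the generating function of the numbers
  \<open>m g^(k+1)\<close>.\<close>

lemma fps_deriv_power_linear:
  fixes g :: complex
  shows "fps_deriv ((1 - fps_const g * fps_X) ^ m)
    = - ((1 - fps_const g * fps_X) ^ m * Abs_fps (\<lambda>k. of_nat m * g ^ Suc k))"
proof -
  let ?L = "1 - fps_const g * fps_X :: complex fps"
  have geo: "?L * Abs_fps (\<lambda>k. g ^ Suc k) = fps_const g"
  proof (rule fps_ext)
    fix n show "fps_nth (?L * Abs_fps (\<lambda>k. g ^ Suc k)) n = fps_nth (fps_const g) n"
      by (cases n) (simp_all add: left_diff_distrib mult.assoc)
  qed
  have "Abs_fps (\<lambda>k. of_nat m * g ^ Suc k) = of_nat m * Abs_fps (\<lambda>k. g ^ Suc k)"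
    by (rule fps_ext) (simp add: fps_of_nat[symmetric] del: fps_of_nat)
  moreover have "fps_deriv (?L ^ m) = - (of_nat m * fps_const g * ?L ^ (m - 1))"
    by (simp add: fps_deriv_power' fps_const_neg[symmetric] del: fps_const_neg)
  moreover have "of_nat m * fps_const g * ?L ^ (m - 1) = ?L ^ m * (of_nat m * Abs_fps (\<lambda>k. g ^ Suc k))"
  proof (cases m)
    case (Suc l)
    have "?L ^ m * (of_nat m * Abs_fps (\<lambda>k. g ^ Suc k))
      = of_nat m * (?L * Abs_fps (\<lambda>k. g ^ Suc k)) * ?L ^ l"
      unfolding Suc power_Suc by (simp only: mult_ac)
    also have "\<dots> = of_nat m * fps_const g * ?L ^ l" unfolding geo ..
    finally show ?thesis using Suc by (metis diff_Suc_1)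
  qed simp
  ultimately show ?thesis by simp
qed

text \<open>Logarithmic derivatives add up over the factors, so the derivative of the product is minus the
  product times the generating function of the power sums. Comparing coefficients gives
  the recursion.\<close>

lemma newton_coeff_prod:
  fixes g :: "'b \<Rightarrow> complex" and m :: "'b \<Rightarrow> nat"
  assumes "finite Z" "\<And>k. p (Suc k) = (\<Sum>z\<in>Z. of_nat (m z) * g z ^ Suc k)"
  shows "fps_nth (\<Prod>z\<in>Z. (1 - fps_const (g z) * fps_X) ^ m z) k = newton_coeff p k"
proof -
  define E where "E = (\<Prod>z\<in>Z. (1 - fps_const (g z) * fps_X) ^ m z)"
  have "fps_deriv E = - (E * (\<Sum>z\<in>Z. Abs_fps (\<lambda>k. of_nat (m z) * g z ^ Suc k)))"
    unfolding E_def using assms(1)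
  proof (induction Z)
    case (insert z Z)
    let ?L = "(1 - fps_const (g z) * fps_X) ^ m z"
      and ?P = "\<Prod>z\<in>Z. (1 - fps_const (g z) * fps_X) ^ m z"
      and ?A = "Abs_fps (\<lambda>k. of_nat (m z) * g z ^ Suc k)"
      and ?S = "\<Sum>z\<in>Z. Abs_fps (\<lambda>k. of_nat (m z) * g z ^ Suc k)"
    have "fps_deriv (?L * ?P) = ?L * - (?P * ?S) + - (?L * ?A) * ?P"
      unfolding fps_deriv_mult fps_deriv_power_linear insert.IH ..
    also have "\<dots> = - (?L * ?P * (?A + ?S))" 
      by (simp only: mult_minus_left mult_minus_right minus_add_distrib distrib_left distrib_right mult_ac add_ac)
    finally show ?case unfolding prod.insert[OF insert.hyps] sum.insert[OF insert.hyps] .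
  qed simp
  also have "(\<Sum>z\<in>Z. Abs_fps (\<lambda>k. of_nat (m z) * g z ^ Suc k)) = Abs_fps (\<lambda>k. p (Suc k))"
    by (rule fps_ext) (simp add: fps_sum_nth assms(2))
  finally have D: "fps_deriv E = - (E * Abs_fps (\<lambda>k. p (Suc k)))" .
  have rec: "of_nat (Suc k) * fps_nth E (Suc k) = - (\<Sum>i\<le>k. fps_nth E i * p (Suc (k - i)))" for k
    using arg_cong[OF D, of "\<lambda>f. fps_nth f k"] by (simp add: fps_mult_nth atLeast0AtMost)
  have E0: "fps_nth E 0 = 1"
    unfolding E_def using assms(1) by (induction Z) (auto simp: fps_power_zeroth)
  have "fps_nth E k = newton_coeff p k"
  proof (induction k rule: less_induct)
    case (less k)
    show ?case
    proof (cases k)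
      case (Suc l)
      have "of_nat k * fps_nth E k = - (\<Sum>i\<le>l. newton_coeff p i * p (Suc (l - i)))"
        unfolding Suc rec using less Suc by (intro arg_cong[of _ _ uminus] sum.cong) auto
      then show ?thesis unfolding Suc by (simp add: field_simps del: of_nat_Suc)
    qed (simp add: E0)
  qed
  then show ?thesis by (simp add: E_def)
qed

text \<open>Each reciprocal \<open>1 / g w\<close> is a root of the product of the \<open>1 - g z t\<close>, whose degree
  is at most the number of factors.\<close>

lemma newton_coeff_root:
  fixes g :: "'b \<Rightarrow> complex" and m :: "'b \<Rightarrow> nat"
  assumes "finite Z" "\<And>k. p (Suc k) = (\<Sum>z\<in>Z. of_nat (m z) * g z ^ Suc k)"
    and "w \<in> Z" "m w > 0" "g w \<noteq> 0" "(\<Sum>z\<in>Z. m z) \<le> D"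
  shows "(\<Sum>k\<le>D. newton_coeff p k * (1 / g w) ^ k) = 0"
proof -
  define E where "E = (\<Prod>z\<in>Z. [:1, - g z:] ^ m z)"
  have "fps_of_poly E = (\<Prod>z\<in>Z. (1 - fps_const (g z) * fps_X) ^ m z)"
    unfolding E_def fps_of_poly_prod fps_of_poly_power
    by (simp add: fps_of_poly_pCons fps_of_poly_const fps_const_neg[symmetric] del: fps_const_neg)
  then have coeff: "coeff E k = newton_coeff p k" for k
    using newton_coeff_prod[OF assms(1,2), where k = k] by (metis fps_of_poly_nth)
  have "degree E \<le> (\<Sum>z\<in>Z. degree ([:1, - g z:] ^ m z))"
    unfolding E_def using degree_prod_sum_le[OF assms(1)] by (simp add: o_def)
  also have "\<dots> \<le> (\<Sum>z\<in>Z. m z)"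
    by (intro sum_mono order_trans[OF degree_power_le]) auto
  finally have deg: "degree E \<le> D" using assms(6) by simp
  have "poly E (1 / g w) = 0"
    unfolding E_def poly_prod using assms by (auto intro!: prod_zero bexI[of _ w])
  moreover have "poly E t = (\<Sum>k\<le>D. coeff E k * t ^ k)" for t
    unfolding poly_altdef using deg by (intro sum.mono_neutral_left) (auto simp: coeff_eq_0)
  ultimately show ?thesis unfolding coeff by simp
qed

section \<open>An algebraic relation on the zero set of a double power series\<close>

text \<open>Differentiation under the integral sign on a fixed circle.\<close>

lemma holomorphic_circle_integral:
  assumes deriv: "\<And>x y. x \<in> ball 0 \<delta> \<Longrightarrow> y \<in> sphere 0 \<sigma> \<Longrightarrow>
      ((\<lambda>x. F x y) has_field_derivative F' x y) (at x)"
    and cont: "continuous_on (ball 0 \<delta> \<times> sphere 0 \<sigma>) (\<lambda>z. F' (fst z) (snd z))"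
    and contF: "\<And>x. x \<in> ball 0 \<delta> \<Longrightarrow> continuous_on (sphere 0 \<sigma>) (F x)"
    and "\<sigma> > 0"
  shows "(\<lambda>x. contour_integral (circlepath 0 \<sigma>) (F x)) holomorphic_on ball 0 \<delta>"
proof -
  define \<gamma> where "\<gamma> = circlepath 0 \<sigma>"
  define \<gamma>' where "\<gamma>' = (\<lambda>t::real. 2 * pi * \<i> * \<sigma> * exp (2 * of_real pi * \<i> * t))"
  have \<gamma>: "\<gamma> t \<in> sphere 0 \<sigma>" for t
    using \<open>\<sigma> > 0\<close> by (simp add: \<gamma>_def circlepath norm_mult)
  have c\<gamma>: "continuous_on A \<gamma>" for A
    unfolding \<gamma>_def circlepath by (intro continuous_intros)
  have c\<gamma>': "continuous_on A \<gamma>'" for A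
    unfolding \<gamma>'_def by (intro continuous_intros)
  have "(\<lambda>x. integral (cbox 0 1) (\<lambda>t. F x (\<gamma> t) * \<gamma>' t)) holomorphic_on ball 0 \<delta>"
  proof (rule leibniz_rule_holomorphic)
    fix x :: complex and t :: real assume x: "x \<in> ball 0 \<delta>"
    show "((\<lambda>x. F x (\<gamma> t) * \<gamma>' t) has_field_derivative F' x (\<gamma> t) * \<gamma>' t) (at x within ball 0 \<delta>)"
      by (rule DERIV_cmult_right[OF has_field_derivative_at_within[OF deriv[OF x \<gamma>]]])
  next
    fix x :: complex assume x: "x \<in> ball 0 \<delta>"
    have "continuous_on (cbox 0 1) (\<lambda>t. F x (\<gamma> t))"
      by (rule continuous_on_compose2[OF contF[OF x] c\<gamma>]) (use \<gamma> in auto)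
    then show "(\<lambda>t. F x (\<gamma> t) * \<gamma>' t) integrable_on cbox 0 1"
      by (intro integrable_continuous continuous_intros c\<gamma>')
  next
    have "continuous_on (ball 0 \<delta> \<times> cbox 0 1) (\<lambda>z. F' (fst (fst z, \<gamma> (snd z))) (snd (fst z, \<gamma> (snd z))))"
      by (rule continuous_on_compose2[OF cont])
        (use \<gamma> in \<open>auto intro!: continuous_intros continuous_on_compose2[OF c\<gamma>]\<close>)
    moreover have "continuous_on (ball 0 \<delta> \<times> cbox 0 1) (\<lambda>z. \<gamma>' (snd z))"
      by (rule continuous_on_compose2[OF c\<gamma>']) (auto intro!: continuous_intros)
    ultimately show "continuous_on (ball 0 \<delta> \<times> cbox 0 1) (\<lambda>(x, t). F' x (\<gamma> t) * \<gamma>' t)"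
      unfolding case_prod_beta by (auto intro!: continuous_intros)
  qed auto
  then show ?thesis
    unfolding contour_integral_integral \<gamma>_def \<gamma>'_def
    by (simp add: vector_derivative_circlepath)
qed

lemma newton_coeff_holomorphic:
  assumes "\<And>k. (\<lambda>x. p x k) holomorphic_on A"
  shows "(\<lambda>x. newton_coeff (p x) k) holomorphic_on A"
proof (induction k rule: less_induct)
  case (less k)
  show ?case
  proof (cases k)
    case (Suc l)
    show ?thesis
      unfolding Suc newton_coeff.simps using Suc less
      by (intro holomorphic_intros assms) (auto simp del: of_nat_Suc)
  qed simp
qed

lemma sum_winding_circle:
  fixes h :: "complex \<Rightarrow> complex"
  assumes "finite A" "0 < \<sigma>" "\<And>z. z \<in> A \<Longrightarrow> norm z \<noteq> \<sigma>"
  shows "(\<Sum>z\<in>A. winding_number (circlepath 0 \<sigma>) z * h z) = (\<Sum>z\<in>{z\<in>A. norm z < \<sigma>}. h z)"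
proof -
  have "(\<Sum>z\<in>A. winding_number (circlepath 0 \<sigma>) z * h z)
      = (\<Sum>z\<in>{z\<in>A. norm z < \<sigma>}. winding_number (circlepath 0 \<sigma>) z * h z)"
  proof (rule sum.mono_neutral_right)
    show "\<forall>z\<in>A - {z \<in> A. norm z < \<sigma>}. winding_number (circlepath 0 \<sigma>) z * h z = 0"
    proof
      fix z assume z: "z \<in> A - {z \<in> A. norm z < \<sigma>}"
      then have "z \<notin> cball 0 \<sigma>" using assms(3) by force
      then have "winding_number (circlepath 0 \<sigma>) z = 0"
        using assms(2)
        by (intro winding_number_zero_outside[of _ "cball 0 \<sigma>"]) (auto simp: sphere_def)
      then show "winding_number (circlepath 0 \<sigma>) z * h z = 0" by simp
    qed
  qed (use assms in auto)
  also have "\<dots> = (\<Sum>z\<in>{z\<in>A. norm z < \<sigma>}. h z)"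
    by (intro sum.cong) (auto simp: winding_number_circlepath)
  finally show ?thesis .
qed

text \<open>The argument principle weighted with \<open>h ^ k\<close>: the residue of \<open>f' h^k / f\<close> at a zero of \<open>f\<close> is the
  multiplicity times the value of \<open>h ^ k\<close> there.\<close>

lemma log_derivative_power_sum:
  assumes f: "f holomorphic_on ball 0 R" and h: "h holomorphic_on ball 0 R"
    and \<sigma>: "0 < \<sigma>" "\<sigma> < R" and nz: "\<And>y. norm y = \<sigma> \<Longrightarrow> f y \<noteq> 0"
  defines "Z \<equiv> {y. norm y < \<sigma> \<and> f y = 0}"
  shows "finite Z"
    and "y \<in> Z \<Longrightarrow> zorder f y > 0"
    and "contour_integral (circlepath 0 \<sigma>) (\<lambda>y. deriv f y * h y ^ k / f y) / (2 * pi * \<i>)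
      = (\<Sum>y\<in>Z. of_nat (nat (zorder f y)) * h y ^ k)"
proof -
  obtain \<tau> where \<tau>: "\<sigma> < \<tau>" "\<tau> < R" using \<sigma> dense by blast
  have b: "complex_of_real \<sigma> \<in> ball 0 R" "f (complex_of_real \<sigma>) \<noteq> 0" using \<sigma> nz by auto
  have fin: "finite {z \<in> cball 0 \<tau>. f z = 0}"
  proof (cases "f constant_on ball 0 R")
    case True
    then have "\<And>z. z \<in> ball 0 R \<Longrightarrow> f z = f (complex_of_real \<sigma>)"
      using b(1) unfolding constant_on_def by metis
    then have "{z \<in> cball 0 \<tau>. f z = 0} = {}" using \<tau> b(2) by force
    then show ?thesis by (metis finite.emptyI)
  next
    case False
    then show ?thesis using \<tau> by (intro holomorphic_compact_finite_zeros[OF f]) auto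
  qed
  show finZ: "finite Z" unfolding Z_def by (rule finite_subset[OF _ fin]) (use \<tau> in auto)
  have zo: "zorder f y > 0" if y0: "norm y < \<tau>" "f y = 0" for y
  proof -
    have y: "y \<in> ball 0 R" using y0 \<tau> by simp
    obtain e where e: "0 < e" "\<And>z. z \<in> ball y e - {y} \<Longrightarrow> f z \<noteq> 0"
      using isolated_zeros[OF f open_ball connected_ball y y0(2) b] by metis
    then have "eventually (\<lambda>z. f z \<noteq> 0) (at y)"
      by (auto simp: eventually_at intro!: exI[of _ e] simp: dist_commute)
    then have "frequently (\<lambda>z. f z \<noteq> 0) (at y)" by (simp add: eventually_frequently)
    then show ?thesis using zorder_pos_iff[OF f open_ball y] y0(2) by simp
  qed
  show "zorder f y > 0" if "y \<in> Z" using that zo \<tau> unfolding Z_def by auto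
  define S where "S = ball (0::complex) \<tau>"
  define pz where "pz = {w \<in> S. f w = 0 \<or> w \<in> {}}"
  have finpz: "finite pz" unfolding pz_def S_def by (rule finite_subset[OF _ fin]) auto
  have SR: "S \<subseteq> ball 0 R" using \<tau> by (auto simp: S_def)
  have "contour_integral (circlepath 0 \<sigma>) (\<lambda>y. deriv f y * h y ^ k / f y)
    = 2 * pi * \<i> * (\<Sum>p\<in>pz. winding_number (circlepath 0 \<sigma>) p * h p ^ k * zorder f p)"
    unfolding pz_def
  proof (rule argument_principle)
    show "f holomorphic_on S - {}" "(\<lambda>y. h y ^ k) holomorphic_on S"
      using SR by (auto intro!: holomorphic_intros holomorphic_on_subset[OF f] holomorphic_on_subset[OF h])
    show "path_image (circlepath 0 \<sigma>) \<subseteq> S - {w \<in> S. f w = 0 \<or> w \<in> {}}"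
      using \<sigma> \<tau> nz by (auto simp: S_def)
    show "\<forall>z. z \<notin> S \<longrightarrow> winding_number (circlepath 0 \<sigma>) z = 0"
    proof (intro allI impI)
      fix z assume "z \<notin> S"
      then have "z \<notin> cball 0 \<sigma>" using \<tau> by (auto simp: S_def)
      then show "winding_number (circlepath 0 \<sigma>) z = 0"
        using \<sigma> by (intro winding_number_zero_outside[of _ "cball 0 \<sigma>"]) (auto simp: sphere_def)
    qed
    show "finite {w \<in> S. f w = 0 \<or> w \<in> {}}" using finpz by (simp add: pz_def)
  qed (auto simp: S_def)
  also have "(\<Sum>p\<in>pz. winding_number (circlepath 0 \<sigma>) p * h p ^ k * zorder f p)
      = (\<Sum>p\<in>pz. winding_number (circlepath 0 \<sigma>) p * (h p ^ k * zorder f p))"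
    by (simp add: mult.assoc)
  also have "\<dots> = (\<Sum>p\<in>{z\<in>pz. norm z < \<sigma>}. h p ^ k * zorder f p)"
    using \<sigma> nz finpz by (intro sum_winding_circle) (auto simp: pz_def)
  also have "{z\<in>pz. norm z < \<sigma>} = Z" using \<tau> by (auto simp: pz_def Z_def S_def)
  also have "(\<Sum>p\<in>Z. h p ^ k * zorder f p) = (\<Sum>p\<in>Z. of_nat (nat (zorder f p)) * h p ^ k)"
  proof (intro sum.cong refl)
    fix p assume "p \<in> Z"
    then have "zorder f p > 0" using zo \<tau> by (auto simp: Z_def)
    then show "h p ^ k * complex_of_int (zorder f p) = complex_of_nat (nat (zorder f p)) * h p ^ k"
      by (simp add: of_nat_nat)
  qed
  finally show "contour_integral (circlepath 0 \<sigma>) (\<lambda>y. deriv f y * h y ^ k / f y) / (2 * pi * \<i>)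
      = (\<Sum>y\<in>Z. of_nat (nat (zorder f y)) * h y ^ k)" by simp
qed

text \<open>The circle is chosen free of zeros of \<open>c\<close>, so the integrand depends holomorphically on the parameter
  \<open>x\<close>. The bound \<open>4 * \<sigma> < r\<close> leaves room for the two shrinkings of the bidisc that come with the mixed
  second derivative.\<close>

lemma log_derivative_integral_holomorphic:
  fixes c d :: "nat \<Rightarrow> nat \<Rightarrow> complex"
  defines "cy \<equiv> \<lambda>i j. dcoeff (\<lambda>i j. c j i) j i"
  assumes c: "geo_bounded c S r" and d: "geo_bounded d T r" and "0 < \<sigma>" "4 * \<sigma> < r" "\<delta> \<le> \<sigma>"
    and nz: "\<And>x y. norm x < \<delta> \<Longrightarrow> norm y = \<sigma> \<Longrightarrow> dseries c x y \<noteq> 0"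
  shows "(\<lambda>x. contour_integral (circlepath 0 \<sigma>)
    (\<lambda>y. dseries cy x y * dseries d x y ^ k / dseries c x y)) holomorphic_on ball 0 \<delta>"
proof -
  have r: "r > 0" using c by (simp add: geo_bounded_def)
  define R where "R = r / 4"
  have R: "0 < R" "\<sigma> < R" "R < r" using r assms(5) by (auto simp: R_def)
  obtain Sx where cx: "geo_bounded (dcoeff c) Sx R" using geo_bounded_dcoeff[OF c] R by blast
  obtain Sy where cy: "geo_bounded cy Sy (r / 2)"
    unfolding cy_def using geo_bounded_dcoeff[OF geo_bounded_swap[OF c]] r
    by (metis geo_bounded_swap field_sum_of_halves half_gt_zero less_add_same_cancel1)
  obtain Syx where cyx: "geo_bounded (dcoeff cy) Syx R" 
    using geo_bounded_dcoeff[OF cy R(1)] r unfolding R_def by (metis divide_strict_left_mono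
      mult_pos_pos numeral_less_iff semiring_norm(76) semiring_norm(78) zero_less_numeral)
  obtain Tx where dx: "geo_bounded (dcoeff d) Tx R" using geo_bounded_dcoeff[OF d] R by blast
  note cR = geo_bounded_smaller[OF c R(1) less_imp_le[OF R(3)]]
  note dR = geo_bounded_smaller[OF d R(1) less_imp_le[OF R(3)]]
  have cyR: "geo_bounded cy Sy R" by (rule geo_bounded_smaller[OF cy R(1)]) (use r in \<open>simp add: R_def\<close>)
  let ?f = "dseries c" and ?g = "dseries d" and ?fx = "dseries (dcoeff c)"
    and ?fy = "dseries cy" and ?fyx = "dseries (dcoeff cy)" and ?gx = "dseries (dcoeff d)"
  define F' where "F' = (\<lambda>x y. ((?fyx x y * ?g x y ^ k + ?fy x y * (of_nat k * (?gx x y * ?g x y ^ (k - 1)))) * ?f x y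
      - ?fy x y * ?g x y ^ k * ?fx x y) / (?f x y * ?f x y))"
  show ?thesis
  proof (rule holomorphic_circle_integral)
    fix x y :: complex assume "x \<in> ball 0 \<delta>" "y \<in> sphere 0 \<sigma>"
    then have xy: "norm x < \<delta>" "norm y = \<sigma>" "norm x < R" "norm y < R" using R assms(6) by auto
    note D = dseries_has_field_derivative[OF _ xy(3,4)]
    show "((\<lambda>x. ?fy x y * ?g x y ^ k / ?f x y) has_field_derivative F' x y) (at x)"
      unfolding F'_def
      by (rule DERIV_cong[OF DERIV_divide[OF DERIV_mult[OF D[OF cyR] DERIV_power[OF D[OF dR]]] D[OF cR] nz[OF xy(1,2)]]])
        (simp add: algebra_simps)
  next
    have cts: "continuous_on (ball 0 \<delta> \<times> sphere 0 \<sigma>) (\<lambda>z. dseries a (fst z) (snd z))"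
      if "geo_bounded a A R" for a A
      by (rule continuous_on_dseries[OF that, where m = \<sigma>])
        (use R assms(6) in \<open>auto intro!: continuous_intros\<close>)
    have "dseries c (fst z) (snd z) \<noteq> 0" if "z \<in> ball 0 \<delta> \<times> sphere 0 \<sigma>" for z
      using that nz by auto
    then show "continuous_on (ball 0 \<delta> \<times> sphere 0 \<sigma>) (\<lambda>z. F' (fst z) (snd z))"
      unfolding F'_def
      by (intro continuous_intros cts[OF cR] cts[OF dR] cts[OF cyR] cts[OF cx] cts[OF dx] cts[OF cyx]
        ballI) simp
  next
    fix x :: complex assume x: "x \<in> ball 0 \<delta>"
    have cts: "continuous_on (sphere 0 \<sigma>) (\<lambda>y. dseries a x y)"
      if "geo_bounded a A R" for a A
      by (rule continuous_on_dseries[OF that, where m = \<sigma>])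
        (use R assms(6) x in \<open>auto intro!: continuous_intros\<close>)
    have "dseries c x y \<noteq> 0" if "y \<in> sphere 0 \<sigma>" for y using that nz x by auto
    then show "continuous_on (sphere 0 \<sigma>) (\<lambda>y. ?fy x y * ?g x y ^ k / ?f x y)"
      by (intro continuous_intros cts[OF cR] cts[OF dR] cts[OF cyR] ballI)
  qed (use assms in auto)
qed

text \<open>For every \<open>x\<close>, the values that \<open>d\<close> takes at the small zeros of \<open>c\<close> on the line over \<open>x\<close> are the
  roots of one polynomial. Its coefficients are holomorphic in \<open>x\<close>, because the power sums
  of the values are integrals over a fixed circle. This replaces the Weierstrass
  preparation theorem.\<close>

lemma algebraic_relation_on_zero_set:
  fixes c d :: "nat \<Rightarrow> nat \<Rightarrow> complex"
  assumes c: "geo_bounded c S r" and d: "geo_bounded d T r" and cj: "c 0 j \<noteq> 0"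
  obtains \<delta> and e :: "nat \<Rightarrow> complex \<Rightarrow> complex" and D :: nat
  where "0 < \<delta>" "\<delta> \<le> r" "\<And>k. e k holomorphic_on ball 0 \<delta>" "\<And>x. e 0 x = 1"
    "\<And>x y. norm x < \<delta> \<Longrightarrow> norm y < \<delta> \<Longrightarrow> dseries c x y = 0 \<Longrightarrow> dseries d x y \<noteq> 0 \<Longrightarrow>
      (\<Sum>k\<le>D. e k x * (1 / dseries d x y) ^ k) = 0"
proof -
  have r: "r > 0" using c by (simp add: geo_bounded_def)
  obtain N \<epsilon> where \<epsilon>: "\<epsilon> > 0" "eventually (\<lambda>y. norm (dseries c 0 y) \<ge> \<epsilon> * norm y ^ N) (at 0)"
    using powser_lower_bound[OF r dseries_0_left[OF c] cj] by blast
  then obtain \<rho> where \<rho>: "\<rho> > 0" "\<And>y. y \<noteq> 0 \<Longrightarrow> norm y < \<rho> \<Longrightarrow> norm (dseries c 0 y) \<ge> \<epsilon> * norm y ^ N"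
    unfolding eventually_at by (auto simp: dist_norm)
  define \<sigma> where "\<sigma> = min (r / 5) (\<rho> / 2)"
  have \<sigma>: "0 < \<sigma>" "4 * \<sigma> < r" "\<sigma> < \<rho>" "\<sigma> < r" using \<rho> r by (auto simp: \<sigma>_def)
  have nz0: "dseries c 0 y \<noteq> 0" if "norm y = \<sigma>" for y
  proof -
    have "\<epsilon> * norm y ^ N > 0" using that \<sigma> \<epsilon> by simp
    then show ?thesis using \<rho>(2)[of y] that \<sigma> by auto
  qed
  have "\<exists>\<delta>>0. \<delta> \<le> \<sigma> \<and> (\<forall>x y. norm x < \<delta> \<longrightarrow> norm y = \<sigma> \<longrightarrow> dseries c x y \<noteq> 0)"
  proof -
    define K where "K = {z \<in> cball 0 \<sigma> \<times> sphere 0 \<sigma>. dseries c (fst z) (snd z) = 0}"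
    have "closed K"
      unfolding K_def using \<sigma>
      by (intro continuous_closed_preimage_constant continuous_on_dseries[OF c, where m = \<sigma>])
        (auto intro!: continuous_intros closed_Times)
    moreover have "bounded (cball (0::complex) \<sigma> \<times> sphere (0::complex) \<sigma>)" 
      by (intro bounded_Times) auto
    then have "bounded K" by (rule bounded_subset) (auto simp: K_def)
    ultimately have "compact K" by (simp add: compact_eq_bounded_closed)
    then have "compact (fst ` K)" by (intro compact_continuous_image continuous_intros)
    then have "open (- fst ` K)" by (simp add: compact_imp_closed open_Compl)
    moreover have "0 \<in> - fst ` K" using nz0 by (auto simp: K_def)
    ultimately obtain \<eta> where \<eta>: "\<eta> > 0" "ball 0 \<eta> \<subseteq> - fst ` K"
      using open_contains_ball by blast
    show ?thesis
    proof (intro exI[of _ "min \<eta> \<sigma>"] conjI allI impI)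
      fix x y :: complex assume xy: "norm x < min \<eta> \<sigma>" "norm y = \<sigma>"
      show "dseries c x y \<noteq> 0"
      proof
        assume "dseries c x y = 0"
        then have "(x, y) \<in> K" using xy by (auto simp: K_def)
        then have "x \<in> fst ` K" by force
        then show False using \<eta>(2) xy by auto
      qed
    qed (use \<eta> \<sigma> in auto)
  qed
  then obtain \<delta> where \<delta>: "\<delta> > 0" "\<delta> \<le> \<sigma>"
    and nz: "\<And>x y. norm x < \<delta> \<Longrightarrow> norm y = \<sigma> \<Longrightarrow> dseries c x y \<noteq> 0" by blast
  define cy where "cy = (\<lambda>i j. dcoeff (\<lambda>i j. c j i) j i)"
  define p where "p = (\<lambda>x k. contour_integral (circlepath 0 \<sigma>)
    (\<lambda>y. dseries cy x y * dseries d x y ^ k / dseries c x y) / (2 * pi * \<i>))"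
  have p_hol: "(\<lambda>x. p x k) holomorphic_on ball 0 \<delta>" for k
    unfolding p_def cy_def
    by (intro holomorphic_intros log_derivative_integral_holomorphic[OF c d] nz \<sigma> \<delta>) auto
  define Z where "Z = (\<lambda>x. {y. norm y < \<sigma> \<and> dseries c x y = 0})"
  define m where "m = (\<lambda>x y. nat (zorder (dseries c x) y))"
  have sums: "finite (Z x)" "\<And>y. y \<in> Z x \<Longrightarrow> m x y > 0"
    "p x k = (\<Sum>y\<in>Z x. of_nat (m x y) * dseries d x y ^ k)" if x: "norm x < \<delta>" for x k
  proof -
    have xr: "norm x < r" using x \<delta> \<sigma> by linarith
    note * = log_derivative_power_sum[OF dseries_holomorphic_snd[OF c xr]
        dseries_holomorphic_snd[OF d xr] \<sigma>(1,4) nz[OF x]]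
    show "finite (Z x)" unfolding Z_def using *(1) .
    show "m x y > 0" if "y \<in> Z x" for y using *(2) that unfolding Z_def m_def by auto
    have "contour_integral (circlepath 0 \<sigma>) (\<lambda>y. dseries cy x y * dseries d x y ^ k / dseries c x y)
        = contour_integral (circlepath 0 \<sigma>) (\<lambda>y. deriv (dseries c x) y * dseries d x y ^ k / dseries c x y)"
    proof (rule contour_integral_cong)
      fix y :: complex assume "y \<in> path_image (circlepath 0 \<sigma>)"
      then have "norm y < r" using \<sigma> by auto
      from DERIV_imp_deriv[OF dseries_has_field_derivative_snd[OF c xr this]]
      show "dseries cy x y * dseries d x y ^ k / dseries c x y
        = deriv (dseries c x) y * dseries d x y ^ k / dseries c x y"
        by (simp add: cy_def)
    qed simp
    then show "p x k = (\<Sum>y\<in>Z x. of_nat (m x y) * dseries d x y ^ k)"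
      unfolding p_def using *(3)[of k] by (simp add: Z_def m_def)
  qed
  \<comment> \<open>The zeroth power sum counts the zeros; it is continuous and hence bounded.\<close>
  have "compact ((\<lambda>x. p x 0) ` cball 0 (\<delta> / 2))"
    using \<delta> by (intro compact_continuous_image holomorphic_on_imp_continuous_on
      holomorphic_on_subset[OF p_hol]) auto
  then obtain B where B: "\<And>x. norm x \<le> \<delta> / 2 \<Longrightarrow> norm (p x 0) \<le> B"
    using compact_imp_bounded[THEN bounded_iff[THEN iffD1]] by (metis imageI mem_cball_0)
  define D where "D = nat \<lceil>B\<rceil>"
  show ?thesis
  proof (rule that[of "\<delta> / 2" "\<lambda>k x. newton_coeff (p x) k" D])
    show "(\<lambda>x. newton_coeff (p x) k) holomorphic_on ball 0 (\<delta> / 2)" for k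
      using \<delta> by (intro newton_coeff_holomorphic holomorphic_on_subset[OF p_hol]) auto
    fix x y :: complex
    assume xy: "norm x < \<delta> / 2" "norm y < \<delta> / 2" and 0: "dseries c x y = 0" "dseries d x y \<noteq> 0"
    have x: "norm x < \<delta>" using xy \<delta> by linarith
    have yZ: "y \<in> Z x" using xy \<delta> 0 by (auto simp: Z_def)
    have "of_nat (\<Sum>y\<in>Z x. m x y) = p x 0" using sums(3)[OF x, of 0] by simp
    then have "real (\<Sum>y\<in>Z x. m x y) \<le> B" using B[of x] xy by (metis less_imp_le norm_of_nat)
    then have D: "(\<Sum>y\<in>Z x. m x y) \<le> D" unfolding D_def by linarith
    show "(\<Sum>k\<le>D. newton_coeff (p x) k * (1 / dseries d x y) ^ k) = 0"
      by (rule newton_coeff_root[OF sums(1)[OF x] sums(3)[OF x] yZ sums(2)[OF x yZ] 0(2) D])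
  qed (use \<delta> \<sigma> in auto)
qed

section \<open>Flat functions on an analytic zero set\<close>

text \<open>If \<open>d\<close> were flat but nonzero along a sequence of zeros of \<open>c\<close>, then the algebraic relation of
  \<open>algebraic_relation_on_zero_set\<close>, solved for its last coefficient that is not identically zero,
  would make that coefficient flat along the \<open>x n\<close>. But near zero a holomorphic function of one variable that
  is not identically zero is comparable with a power.\<close>

lemma flat_on_zero_set_aux:
  fixes c d :: "nat \<Rightarrow> nat \<Rightarrow> real" and x y :: "nat \<Rightarrow> real"
  assumes c: "geo_bounded c S r" and d: "geo_bounded d T r" and cij: "c i j \<noteq> 0"
    and lim: "x \<longlonglongrightarrow> 0" "y \<longlonglongrightarrow> 0" and x0: "\<And>n. x n \<noteq> 0"
    and zero: "\<And>n. dseries c (x n) (y n) = 0" and nonzero: "\<And>n. dseries d (x n) (y n) \<noteq> 0"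
    and flat: "\<And>N. \<exists>C. eventually (\<lambda>n. \<bar>dseries d (x n) (y n)\<bar> \<le> C * \<bar>x n\<bar> ^ N) sequentially"
  shows False
proof -
  have r: "r > 0" using c by (simp add: geo_bounded_def)
  \<comment> \<open>Dividing \<open>c\<close> by the largest power of \<open>x\<close> keeps its zeros off the axis \<open>x = 0\<close> and makes the quotient
    regular in \<open>y\<close>.\<close>
  define k where "k = (LEAST i. \<exists>j. c i j \<noteq> 0)"
  have "\<exists>i j. c i j \<noteq> 0" using cij by blast
  then have "\<exists>j. c k j \<noteq> 0" unfolding k_def by (rule LeastI_ex)
  then obtain j where j: "c k j \<noteq> 0" by blast
  have low: "c i j = 0" if "i < k" for i j using not_less_Least that unfolding k_def by blast
  define c' where "c' = (\<lambda>i j. complex_of_real (c (i + k) j))"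
  define d' where "d' = (\<lambda>i j. complex_of_real (d i j))"
  note sh = geo_bounded_shift[OF c, of k]
  have c': "geo_bounded c' (S / r ^ k) r" unfolding c'_def by (rule geo_bounded_of_real[OF sh])
  have d': "geo_bounded d' T r" unfolding d'_def by (rule geo_bounded_of_real[OF d])
  have c'j: "c' 0 j \<noteq> 0" using j by (simp add: c'_def)
  obtain \<delta> e D where \<delta>: "0 < \<delta>" "\<delta> \<le> r"
    and hol: "\<And>k. e k holomorphic_on ball 0 \<delta>" and e0: "\<And>x. e 0 x = 1"
    and rel: "\<And>x y. norm x < \<delta> \<Longrightarrow> norm y < \<delta> \<Longrightarrow> dseries c' x y = 0 \<Longrightarrow> dseries d' x y \<noteq> 0 \<Longrightarrow>
      (\<Sum>k\<le>D. e k x * (1 / dseries d' x y) ^ k) = 0"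
    by (rule algebraic_relation_on_zero_set[OF c' d' c'j], rule that) blast+
  define I where "I = {k. k \<le> D \<and> (\<exists>x\<in>ball 0 \<delta>. e k x \<noteq> 0)}"
  have I: "finite I" "0 \<in> I" using \<delta> e0 by (auto simp: I_def intro!: exI[of _ "0::complex"])
  define K where "K = Max I"
  have "K \<in> I" unfolding K_def using I by (intro Max_in) auto
  then obtain w where w: "w \<in> ball 0 \<delta>" "e K w \<noteq> 0" and KD: "K \<le> D" by (auto simp: I_def)
  have high: "e k z = 0" if "K < k" "k \<le> D" "z \<in> ball 0 \<delta>" for k z
  proof (rule ccontr)
    assume "e k z \<noteq> 0"
    then have "k \<in> I" using that by (auto simp: I_def)
    then show False using Max_ge[OF I(1), of k] that(1) unfolding K_def by linarith
  qed
  define a where "a = (\<lambda>n. (deriv ^^ n) (e K) 0 / fact n)"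
  have aK: "(\<lambda>n. a n * z ^ n) sums e K z" if "norm z < \<delta>" for z
    using holomorphic_power_series[OF hol, of z] that by (simp add: a_def)
  have "\<exists>M. a M \<noteq> 0"
  proof (rule ccontr)
    assume "\<nexists>M. a M \<noteq> 0"
    then have "(\<lambda>n. 0) sums e K w" using aK[of w] w by simp
    then show False using w(2) sums_unique2[OF sums_zero] by metis
  qed
  then obtain M where M: "a M \<noteq> 0" by blast
  define g where "g = (\<lambda>n. complex_of_real (dseries d (x n) (y n)))"
  define z where "z = (\<lambda>n. complex_of_real (x n))"
  have z0: "z \<longlonglongrightarrow> 0" using tendsto_of_real[OF lim(1)] by (simp add: z_def)
  have ev: "eventually (\<lambda>n. \<bar>x n\<bar> < \<delta> \<and> \<bar>y n\<bar> < \<delta>) sequentially"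
    using \<delta> tendsto_rabs_zero[OF lim(1)] tendsto_rabs_zero[OF lim(2)]
    by (intro eventually_conj) (auto dest: order_tendstoD)
  then have top: "eventually (\<lambda>n. e K (z n) = - (\<Sum>k<K. e k (z n) * g n ^ (K - k))) sequentially"
  proof eventually_elim
    case (elim n)
    have xr: "norm (x n) < r" "norm (y n) < r" using elim \<delta> by auto
    have "dseries (\<lambda>i j. c (i + k) j) (x n) (y n) = 0"
      using dseries_shift[OF c xr low] zero[of n] x0[of n] by auto
    then have "dseries c' (z n) (of_real (y n)) = 0"
      unfolding c'_def z_def dseries_of_real[OF sh xr] by simp
    moreover have gn: "dseries d' (z n) (of_real (y n)) = g n"
      unfolding d'_def z_def dseries_of_real[OF d xr] g_def ..
    moreover have g0: "g n \<noteq> 0" using nonzero by (simp add: g_def)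
    ultimately have "(\<Sum>k\<le>D. e k (z n) * (1 / g n) ^ k) = 0"
      using rel[of "z n" "of_real (y n)"] elim by (simp add: z_def)
    moreover have "(\<Sum>k\<le>D. e k (z n) * (1 / g n) ^ k) = (\<Sum>k\<le>K. e k (z n) * (1 / g n) ^ k)"
      using KD elim high by (intro sum.mono_neutral_right) (auto simp: z_def)
    ultimately have "0 = g n ^ K * (\<Sum>k\<le>K. e k (z n) * (1 / g n) ^ k)" by simp
    also have "\<dots> = (\<Sum>k\<le>K. e k (z n) * g n ^ (K - k))"
      unfolding sum_distrib_left using g0 by (intro sum.cong) (auto simp: power_diff power_divide)
    also have "\<dots> = (\<Sum>k<K. e k (z n) * g n ^ (K - k)) + e K (z n)"
      by (simp flip: lessThan_Suc_atMost)
    finally show ?case by (simp add: eq_neg_iff_add_eq_0 add.commute)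
  qed
  \<comment> \<open>The lower coefficients stay bounded, so the top coefficient is flat like \<open>g\<close>.\<close>
  have "(\<lambda>n. \<Sum>k<K. norm (e k (z n))) \<longlonglongrightarrow> (\<Sum>k<K. norm (e k 0))"
  proof (intro tendsto_sum tendsto_norm)
    fix k show "(\<lambda>n. e k (z n)) \<longlonglongrightarrow> e k 0"
      using holomorphic_on_imp_continuous_on[OF hol] \<delta> z0
      by (intro isCont_tendsto_compose[OF _ z0]) (auto simp: continuous_on_eq_continuous_at)
  qed
  then have bd: "eventually (\<lambda>n. (\<Sum>k<K. norm (e k (z n))) < (\<Sum>k<K. norm (e k 0)) + 1) sequentially"
    by (intro order_tendstoD) auto
  obtain C1 where C1: "eventually (\<lambda>n. \<bar>dseries d (x n) (y n)\<bar> \<le> C1 * \<bar>x n\<bar> ^ 1) sequentially"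
    using flat by blast
  have "(\<lambda>n. C1 * \<bar>x n\<bar>) \<longlonglongrightarrow> C1 * \<bar>0\<bar>" using lim by (intro tendsto_intros)
  then have "eventually (\<lambda>n. C1 * \<bar>x n\<bar> < 1) sequentially" by (intro order_tendstoD) auto
  with C1 have small: "eventually (\<lambda>n. norm (g n) \<le> 1) sequentially"
    by eventually_elim (simp add: g_def)
  define B where "B = (\<Sum>k<K. norm (e k 0)) + 1"
  have B0: "0 \<le> B" unfolding B_def by (simp add: sum_nonneg)
  have est: "eventually (\<lambda>n. norm (e K (z n)) \<le> B * norm (g n)) sequentially"
    using top bd small
  proof eventually_elim
    case (elim n)
    have "norm (e K (z n)) \<le> (\<Sum>k<K. norm (e k (z n)) * norm (g n))"
      unfolding elim(1) norm_minus_cancel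
    proof (rule sum_norm_le)
      fix k assume "k \<in> {..<K}"
      then have "norm (g n) ^ (K - k) \<le> norm (g n) ^ 1"
        using elim(3) by (intro power_decreasing) auto
      then show "norm (e k (z n) * g n ^ (K - k)) \<le> norm (e k (z n)) * norm (g n)"
        by (auto simp: norm_mult norm_power intro!: mult_left_mono)
    qed
    also have "\<dots> = (\<Sum>k<K. norm (e k (z n))) * norm (g n)" by (simp add: sum_distrib_right)
    also have "\<dots> \<le> B * norm (g n)" using elim(2) by (intro mult_right_mono) (auto simp: B_def)
    finally show ?case .
  qed
  have "a M = 0"
  proof (rule powser_flat_imp_zero[OF \<delta>(1) aK z0])
    show "z n \<noteq> 0" for n using x0 by (simp add: z_def)
    fix N
    obtain C where "eventually (\<lambda>n. \<bar>dseries d (x n) (y n)\<bar> \<le> C * \<bar>x n\<bar> ^ N) sequentially"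
      using flat by blast
    with est have "eventually (\<lambda>n. norm (e K (z n)) \<le> B * C * norm (z n) ^ N) sequentially"
    proof eventually_elim
      case (elim n)
      have "B * norm (g n) \<le> B * (C * norm (z n) ^ N)"
        using elim(2) B0 by (intro mult_left_mono) (auto simp: g_def z_def)
      then show ?case using elim(1) by simp
    qed
    then show "\<exists>C. eventually (\<lambda>n. norm (e K (z n)) \<le> C * norm (z n) ^ N) sequentially" by blast
  qed auto
  then show False using M by simp
qed

text \<open>This takes the place of a Lojasiewicz inequality: on the zero set of \<open>c\<close>, a function \<open>d\<close> is bounded
  below by a power of the distance to the origin, unless it vanishes. Every sequence has a
  subsequence on which one of the two coordinates dominates, and the variables can be exchanged.\<close>

lemma flat_on_zero_set:
  fixes c d :: "nat \<Rightarrow> nat \<Rightarrow> real" and x y :: "nat \<Rightarrow> real"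
  assumes c: "geo_bounded c S r" and d: "geo_bounded d T r" and cij: "c i j \<noteq> 0"
    and lim: "x \<longlonglongrightarrow> 0" "y \<longlonglongrightarrow> 0" and xy0: "\<And>n. x n \<noteq> 0 \<or> y n \<noteq> 0"
    and zero: "\<And>n. dseries c (x n) (y n) = 0" and nonzero: "\<And>n. dseries d (x n) (y n) \<noteq> 0"
    and flat: "\<And>N. \<exists>C. \<forall>n. \<bar>dseries d (x n) (y n)\<bar> \<le> C * max \<bar>x n\<bar> \<bar>y n\<bar> ^ N"
  shows False
proof -
  have "infinite {n. \<bar>y n\<bar> \<le> \<bar>x n\<bar>} \<or> infinite {n. \<bar>x n\<bar> \<le> \<bar>y n\<bar>}"
  proof (rule ccontr)
    assume "\<not> ?thesis"
    then have "finite ({n. \<bar>y n\<bar> \<le> \<bar>x n\<bar>} \<union> {n. \<bar>x n\<bar> \<le> \<bar>y n\<bar>})" by simp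
    moreover have "{n. \<bar>y n\<bar> \<le> \<bar>x n\<bar>} \<union> {n. \<bar>x n\<bar> \<le> \<bar>y n\<bar>} = UNIV" by auto
    ultimately show False by simp
  qed
  then show False
  proof
    assume "infinite {n. \<bar>y n\<bar> \<le> \<bar>x n\<bar>}"
    then obtain s :: "nat \<Rightarrow> nat" where s: "strict_mono s" "\<And>n. \<bar>y (s n)\<bar> \<le> \<bar>x (s n)\<bar>"
      using infinite_enumerate[of "{n. \<bar>y n\<bar> \<le> \<bar>x n\<bar>}"] by auto
    show False
    proof (rule flat_on_zero_set_aux[OF c d cij])
      show "(\<lambda>n. x (s n)) \<longlonglongrightarrow> 0" "(\<lambda>n. y (s n)) \<longlonglongrightarrow> 0"
        using LIMSEQ_subseq_LIMSEQ[OF _ s(1)] lim by (auto simp: o_def)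
      show "x (s n) \<noteq> 0" for n using xy0[of "s n"] s(2)[of n] by auto
      show "\<exists>C. eventually (\<lambda>n. \<bar>dseries d (x (s n)) (y (s n))\<bar> \<le> C * \<bar>x (s n)\<bar> ^ N) sequentially" for N
        using flat[of N] s(2) by (metis (no_types, lifting) always_eventually max.absorb1)
    qed (use zero nonzero in auto)
  next
    assume "infinite {n. \<bar>x n\<bar> \<le> \<bar>y n\<bar>}"
    then obtain s :: "nat \<Rightarrow> nat" where s: "strict_mono s" "\<And>n. \<bar>x (s n)\<bar> \<le> \<bar>y (s n)\<bar>"
      using infinite_enumerate[of "{n. \<bar>x n\<bar> \<le> \<bar>y n\<bar>}"] by auto
    show False
    proof (rule flat_on_zero_set_aux[where x = "\<lambda>n. y (s n)" and y = "\<lambda>n. x (s n)",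
          OF geo_bounded_swap[OF c] geo_bounded_swap[OF d], of i j])
      show "(\<lambda>n. x (s n)) \<longlonglongrightarrow> 0" "(\<lambda>n. y (s n)) \<longlonglongrightarrow> 0"
        using LIMSEQ_subseq_LIMSEQ[OF _ s(1)] lim by (auto simp: o_def)
      show "y (s n) \<noteq> 0" for n using xy0[of "s n"] s(2)[of n] by auto
      show "\<exists>C. eventually (\<lambda>n. \<bar>dseries (\<lambda>i j. d j i) (y (s n)) (x (s n))\<bar> \<le> C * \<bar>y (s n)\<bar> ^ N) sequentially" for N
        unfolding dseries_swap[of d]
        using flat[of N] s(2) by (metis (no_types, lifting) always_eventually max.absorb2)
    qed (use zero nonzero cij in \<open>auto simp: dseries_swap[of c] dseries_swap[of d]\<close>)
  qed
qed

section \<open>Maps with one slow and one superfast direction\<close>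

text \<open>The maximum norm suits the dynamics better than the Euclidean norm of the product type, because
  pairs of points are classified by which coordinate of their difference is the larger one.\<close>

definition supnorm :: "real \<times> real \<Rightarrow> real" where
  "supnorm z = max \<bar>fst z\<bar> \<bar>snd z\<bar>"

lemma supnorm_nonneg [simp]: "0 \<le> supnorm z"
  and supnorm_fst: "\<bar>fst z\<bar> \<le> supnorm z"
  and supnorm_snd: "\<bar>snd z\<bar> \<le> supnorm z"
  and supnorm_0 [simp]: "supnorm 0 = 0"
  and supnorm_diff_le: "supnorm (z - w) \<le> supnorm z + supnorm w"
  by (auto simp: supnorm_def max_def)

lemma supnorm_le_norm: "supnorm z \<le> norm z"
  unfolding supnorm_def
  using norm_fst_le[of "fst z" "snd z"] norm_snd_le[of "snd z" "fst z"] by simp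

lemma norm_le_supnorm: "norm z \<le> 2 * supnorm z"
  using norm_Pair_le[of "fst z" "snd z"] supnorm_fst[of z] supnorm_snd[of z] by simp

text \<open>The product is \<open>\<kappa>\<close> to the power \<open>n (n - 1) / 2\<close>, hence smaller than every geometric sequence. This is the
  speed at which orbits are attracted in the direction of the zero eigenvalue.\<close>

lemma prod_powers_flat:
  fixes \<kappa> t :: real
  assumes "0 < \<kappa>" "\<kappa> < 1" "0 < t"
  obtains C where "C > 0" "\<And>n. (\<Prod>k<n. \<kappa> ^ k) \<le> C * t ^ n"
proof -
  have "(\<lambda>k. \<kappa> ^ k) \<longlonglongrightarrow> 0" using assms by (intro LIMSEQ_realpow_zero) auto
  then have "eventually (\<lambda>k. \<kappa> ^ k < t) sequentially" using assms(3) by (rule order_tendstoD)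
  then obtain k0 where k0: "\<And>k. k \<ge> k0 \<Longrightarrow> \<kappa> ^ k < t" by (auto simp: eventually_sequentially)
  define C where "C = (\<Sum>n\<le>k0. (\<Prod>k<n. \<kappa> ^ k) / t ^ n)"
  have pos: "(\<Prod>k<n. \<kappa> ^ k) > 0" for n using assms by (intro prod_pos) auto
  have small: "(\<Prod>k<n. \<kappa> ^ k) \<le> C * t ^ n" if "n \<le> k0" for n
  proof -
    have "(\<Prod>k<n. \<kappa> ^ k) / t ^ n \<le> C"
      unfolding C_def using that pos assms
      by (intro member_le_sum) (auto intro!: divide_nonneg_pos less_imp_le)
    then show ?thesis using assms by (simp add: field_simps)
  qed
  have large: "(\<Prod>k<k0 + j. \<kappa> ^ k) \<le> C * t ^ (k0 + j)" for j
  proof (induction j)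
    case (Suc j)
    have "(\<Prod>k<k0 + j. \<kappa> ^ k) * \<kappa> ^ (k0 + j) \<le> C * t ^ (k0 + j) * t"
      using Suc k0[of "k0 + j"] pos[of "k0 + j"] assms
      by (intro mult_mono) (auto intro: order_trans[OF less_imp_le])
    then show ?case by (simp add: mult_ac)
  qed (use small in auto)
  have all: "(\<Prod>k<n. \<kappa> ^ k) \<le> C * t ^ n" for n
    using small[of n] large[of "n - k0"] by (cases "n \<le> k0") auto
  have "C > 0" using all[of 0] by simp
  then show ?thesis using that all by blast
qed

text \<open>A perturbation of the linear map \<open>(x, y) \<mapsto> (lam x, 0)\<close>. The Lipschitz bound says that the derivative of the
  perturbation is of the order of the distance to the origin, as for a map of class C2; the cut-off
  \<open>min r\<close> keeps the perturbation small on the whole plane, so that all iterates are defined.\<close>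

locale slow_fast_map =
  fixes lam K r :: real and al be :: "real \<times> real \<Rightarrow> real"
  assumes lam: "lam \<noteq> 0" and K: "0 \<le> K" and r: "0 < r"
    and Kr: "4 * (K * r) \<le> \<bar>lam\<bar>" "K * r \<le> 1"
    and zero: "al 0 = 0" "be 0 = 0"
    and lip: "\<bar>al z - al w\<bar> \<le> K * min r (max (supnorm z) (supnorm w)) * supnorm (z - w)"
      "\<bar>be z - be w\<bar> \<le> K * min r (max (supnorm z) (supnorm w)) * supnorm (z - w)"
begin

definition G :: "real \<times> real \<Rightarrow> real \<times> real" where
  "G z = (lam * fst z + al z, be z)"

definition \<epsilon> :: real where "\<epsilon> = K * r"

text \<open>The wedge around the slow direction is mapped into itself; on it the first coordinate measures
  the distance to the origin.\<close>

definition wedge :: "(real \<times> real) set" where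
  "wedge = {z. fst z \<noteq> 0 \<and> 2 * \<bar>snd z\<bar> \<le> \<bar>fst z\<bar>}"

lemma eps: "0 \<le> \<epsilon>" "4 * \<epsilon> \<le> \<bar>lam\<bar>" "\<epsilon> \<le> 1"
  using K r Kr by (auto simp: \<epsilon>_def)

lemma lip_eps:
  "\<bar>al z - al w\<bar> \<le> \<epsilon> * supnorm (z - w)" "\<bar>be z - be w\<bar> \<le> \<epsilon> * supnorm (z - w)"
proof -
  have "K * min r (max (supnorm z) (supnorm w)) * supnorm (z - w) \<le> \<epsilon> * supnorm (z - w)"
    unfolding \<epsilon>_def using K by (intro mult_right_mono mult_left_mono) auto
  then show "\<bar>al z - al w\<bar> \<le> \<epsilon> * supnorm (z - w)" "\<bar>be z - be w\<bar> \<le> \<epsilon> * supnorm (z - w)"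
    using lip[of z w] by linarith+
qed

text \<open>Differences that are rather horizontal are stretched by about \<open>lam\<close> and become even more
  horizontal.\<close>

lemma horizontal_step:
  assumes "\<bar>snd z - snd w\<bar> \<le> \<bar>fst z - fst w\<bar>"
  shows "(\<bar>lam\<bar> - \<epsilon>) * \<bar>fst z - fst w\<bar> \<le> \<bar>fst (G z) - fst (G w)\<bar>"
    and "\<bar>fst (G z) - fst (G w)\<bar> \<le> (\<bar>lam\<bar> + \<epsilon>) * \<bar>fst z - fst w\<bar>"
    and "3 * \<bar>snd (G z) - snd (G w)\<bar> \<le> \<bar>fst (G z) - fst (G w)\<bar>"
proof -
  have s: "supnorm (z - w) = \<bar>fst z - fst w\<bar>" using assms by (simp add: supnorm_def)
  have "4 * \<epsilon> * \<bar>fst z - fst w\<bar> \<le> \<bar>lam\<bar> * \<bar>fst z - fst w\<bar>"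
    using eps by (intro mult_right_mono) auto
  then have snd4: "3 * \<bar>snd (G z) - snd (G w)\<bar> \<le> \<bar>lam\<bar> * \<bar>fst z - fst w\<bar> - \<epsilon> * \<bar>fst z - fst w\<bar>"
    using lip_eps(2)[of z w] unfolding s by (simp add: G_def)
  have "fst (G z) - fst (G w) = lam * (fst z - fst w) + (al z - al w)"
    by (simp add: G_def algebra_simps)
  moreover have "\<bar>lam * (fst z - fst w)\<bar> = \<bar>lam\<bar> * \<bar>fst z - fst w\<bar>" by (rule abs_mult)
  moreover have "\<bar>al z - al w\<bar> \<le> \<epsilon> * \<bar>fst z - fst w\<bar>" "\<bar>snd (G z) - snd (G w)\<bar> \<le> \<epsilon> * \<bar>fst z - fst w\<bar>"
    using lip_eps[of z w] unfolding s by (auto simp: G_def)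
  ultimately show "(\<bar>lam\<bar> - \<epsilon>) * \<bar>fst z - fst w\<bar> \<le> \<bar>fst (G z) - fst (G w)\<bar>"
    and "\<bar>fst (G z) - fst (G w)\<bar> \<le> (\<bar>lam\<bar> + \<epsilon>) * \<bar>fst z - fst w\<bar>"
    unfolding left_diff_distrib distrib_right by linarith+
  then show "3 * \<bar>snd (G z) - snd (G w)\<bar> \<le> \<bar>fst (G z) - fst (G w)\<bar>"
    using snd4 unfolding left_diff_distrib by linarith
qed

text \<open>A difference that is once rather horizontal and nonzero remains so forever, and then its first
  coordinate never vanishes again.\<close>

lemma vertical_pair:
  assumes "fst ((G ^^ n) z) = fst ((G ^^ n) w)" "k \<le> n"
  shows "\<bar>fst ((G ^^ k) z) - fst ((G ^^ k) w)\<bar> \<le> \<bar>snd ((G ^^ k) z) - snd ((G ^^ k) w)\<bar>"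
proof (rule ccontr)
  assume *: "\<not> ?thesis"
  define dx dy where "dx = (\<lambda>j. \<bar>fst ((G ^^ j) z) - fst ((G ^^ j) w)\<bar>)"
    and "dy = (\<lambda>j. \<bar>snd ((G ^^ j) z) - snd ((G ^^ j) w)\<bar>)"
  have "dy (k + j) \<le> dx (k + j) \<and> 0 < dx (k + j)" for j
  proof (induction j)
    case (Suc j)
    have "\<bar>lam\<bar> - \<epsilon> > 0" using eps lam by linarith
    then have "(\<bar>lam\<bar> - \<epsilon>) * dx (k + j) > 0" using Suc by simp
    then show ?case
      using horizontal_step[of "(G ^^ (k + j)) z" "(G ^^ (k + j)) w"] Suc
      unfolding dx_def dy_def by simp linarith
  qed (use * in \<open>auto simp: dx_def dy_def\<close>)
  from this[of "n - k"] show False using assms by (simp add: dx_def)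
qed

text \<open>If the horizontal distance of two orbits vanishes at time \<open>n\<close>, then their difference was
  vertical all the time, so that every step contracted it by a factor of the order of the
  distance to the origin.\<close>

lemma vertical_contraction:
  assumes "fst ((G ^^ n) z) = fst ((G ^^ n) w)" "k \<le> n"
  shows "supnorm ((G ^^ k) z - (G ^^ k) w)
    \<le> (\<Prod>j<k. K * max (supnorm ((G ^^ j) z)) (supnorm ((G ^^ j) w))) * supnorm (z - w)"
  using assms(2)
proof (induction k)
  case (Suc k)
  let ?z = "(G ^^ k) z" and ?w = "(G ^^ k) w"
  have "supnorm (G ?z - G ?w) = \<bar>snd (G ?z) - snd (G ?w)\<bar>"
    using vertical_pair[OF assms(1) Suc.prems] by (simp add: supnorm_def)
  also have "\<dots> \<le> K * min r (max (supnorm ?z) (supnorm ?w)) * supnorm (?z - ?w)"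
    using lip(2)[of ?z ?w] by (simp add: G_def)
  also have "\<dots> \<le> K * max (supnorm ?z) (supnorm ?w) * supnorm (?z - ?w)"
    using K by (intro mult_right_mono mult_left_mono) auto
  also have "\<dots> \<le> K * max (supnorm ?z) (supnorm ?w) *
      ((\<Prod>j<k. K * max (supnorm ((G ^^ j) z)) (supnorm ((G ^^ j) w))) * supnorm (z - w))"
    using K Suc by (intro mult_left_mono) (auto simp: le_max_iff_disj)
  finally show ?case by (simp add: mult_ac)
qed simp

lemma G_0 [simp]: "G 0 = 0"
  by (simp add: G_def zero) (simp add: zero_prod_def)

lemma wedge_step:
  assumes "z \<in> wedge"
  shows "G z \<in> wedge" "(\<bar>lam\<bar> - \<epsilon>) * \<bar>fst z\<bar> \<le> \<bar>fst (G z)\<bar>" "\<bar>fst (G z)\<bar> \<le> (\<bar>lam\<bar> + \<epsilon>) * \<bar>fst z\<bar>"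
proof -
  have "\<bar>snd z - snd 0\<bar> \<le> \<bar>fst z - fst 0\<bar>" using assms unfolding wedge_def by (simp, linarith)
  note h = horizontal_step[OF this]
  show 1: "(\<bar>lam\<bar> - \<epsilon>) * \<bar>fst z\<bar> \<le> \<bar>fst (G z)\<bar>" "\<bar>fst (G z)\<bar> \<le> (\<bar>lam\<bar> + \<epsilon>) * \<bar>fst z\<bar>"
    using h by auto
  have "\<bar>lam\<bar> - \<epsilon> > 0" using eps lam by linarith
  then have "(\<bar>lam\<bar> - \<epsilon>) * \<bar>fst z\<bar> > 0" using assms by (simp add: wedge_def)
  then show "G z \<in> wedge" using h(3) 1 by (auto simp: wedge_def)
qed

lemma wedge_iterate:
  assumes "z \<in> wedge"
  shows "(G ^^ n) z \<in> wedge" "(\<bar>lam\<bar> - \<epsilon>) ^ n * \<bar>fst z\<bar> \<le> \<bar>fst ((G ^^ n) z)\<bar>"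
    "\<bar>fst ((G ^^ n) z)\<bar> \<le> (\<bar>lam\<bar> + \<epsilon>) ^ n * \<bar>fst z\<bar>"
proof -
  have l: "\<bar>lam\<bar> - \<epsilon> \<ge> 0" "\<bar>lam\<bar> + \<epsilon> \<ge> 0" using eps by linarith+
  show c: "(G ^^ n) z \<in> wedge" for n by (induction n) (use assms wedge_step in auto)
  show "(\<bar>lam\<bar> - \<epsilon>) ^ n * \<bar>fst z\<bar> \<le> \<bar>fst ((G ^^ n) z)\<bar>"
  proof (induction n)
    case (Suc n)
    have "(\<bar>lam\<bar> - \<epsilon>) * ((\<bar>lam\<bar> - \<epsilon>) ^ n * \<bar>fst z\<bar>) \<le> (\<bar>lam\<bar> - \<epsilon>) * \<bar>fst ((G ^^ n) z)\<bar>"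
      using Suc l by (intro mult_left_mono) auto
    then show ?case using wedge_step(2)[OF c[of n]] by (simp add: mult.assoc)
  qed simp
  show "\<bar>fst ((G ^^ n) z)\<bar> \<le> (\<bar>lam\<bar> + \<epsilon>) ^ n * \<bar>fst z\<bar>"
  proof (induction n)
    case (Suc n)
    have "(\<bar>lam\<bar> + \<epsilon>) * \<bar>fst ((G ^^ n) z)\<bar> \<le> (\<bar>lam\<bar> + \<epsilon>) * ((\<bar>lam\<bar> + \<epsilon>) ^ n * \<bar>fst z\<bar>)"
      using Suc l by (intro mult_left_mono) auto
    then show ?case using wedge_step(3)[OF c[of n]] by (simp add: mult.assoc)
  qed simp
qed

lemma supnorm_wedge: "z \<in> wedge \<Longrightarrow> supnorm z = \<bar>fst z\<bar>"
  by (auto simp: wedge_def supnorm_def)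

lemma continuous_G: "continuous_on A G"
proof -
  have "continuous_on UNIV f" if "\<And>z w. \<bar>f z - f w\<bar> \<le> \<epsilon> * supnorm (z - w)" for f :: "real \<times> real \<Rightarrow> real"
  proof -
    have "\<epsilon>-lipschitz_on UNIV f"
    proof (rule lipschitz_onI)
      fix z w :: "real \<times> real"
      have "\<epsilon> * supnorm (z - w) \<le> \<epsilon> * norm (z - w)"
        using eps supnorm_le_norm by (intro mult_left_mono)
      then show "dist (f z) (f w) \<le> \<epsilon> * dist z w"
        using that[of z w] by (simp add: dist_norm)
    qed (use eps in auto)
    then show ?thesis by (rule lipschitz_on_continuous_on)
  qed
  then have "continuous_on UNIV al" "continuous_on UNIV be" using lip_eps by blast+
  then have "continuous_on UNIV G"
    unfolding G_def by (intro continuous_intros)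
  then show ?thesis by (rule continuous_on_subset) auto
qed

lemma continuous_iterate: "continuous_on A (G ^^ n)"
proof (induction n)
  case (Suc n)
  then show ?case using continuous_on_compose[OF Suc continuous_G] by simp
qed (simp add: id_def)

text \<open>The \<open>n\<close>-th iterate stretches the axis over the whole range of first coordinates, by the
  intermediate value theorem. Division by \<open>lam ^ n\<close> removes the alternation of signs in case \<open>lam\<close> is
  negative.\<close>

lemma shooting: "\<exists>s. fst ((G ^^ n) (s, 0)) = X"
proof -
  define \<theta> where "\<theta> = 1 - \<epsilon> / \<bar>lam\<bar>"
  have \<theta>: "\<theta> > 0" using eps lam by (simp add: \<theta>_def field_simps)
  define u where "u = (\<lambda>k s. fst ((G ^^ k) (s, 0)) / lam ^ k)"
  have grow: "\<theta> ^ k * s\<^sup>2 \<le> s * u k s" for k s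
  proof (cases "s = 0")
    case False
    then have s: "(s, 0) \<in> wedge" by (simp add: wedge_def)
    show ?thesis
    proof (induction k)
      case (Suc k)
      let ?z = "(G ^^ k) (s, 0)"
      have z: "supnorm ?z = \<bar>fst ?z\<bar>" by (rule supnorm_wedge[OF wedge_iterate(1)[OF s]])
      have "\<bar>al ?z\<bar> \<le> \<epsilon> * \<bar>fst ?z\<bar>" using lip_eps(1)[of ?z 0] by (simp add: zero z)
      then have "\<bar>s\<bar> * \<bar>al ?z\<bar> / \<bar>lam\<bar> ^ Suc k \<le> \<bar>s\<bar> * (\<epsilon> * \<bar>fst ?z\<bar>) / \<bar>lam\<bar> ^ Suc k"
        by (intro divide_right_mono mult_left_mono) auto
      also have "\<dots> = \<epsilon> / \<bar>lam\<bar> * \<bar>s * u k s\<bar>"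
        by (simp add: u_def abs_mult power_abs)
      also have "\<bar>s * u k s\<bar> = s * u k s"
        using Suc order_trans[OF _ Suc, of 0] \<theta> by simp
      finally have al: "\<bar>s * al ?z / lam ^ Suc k\<bar> \<le> \<epsilon> / \<bar>lam\<bar> * (s * u k s)"
        by (simp add: abs_mult power_abs)
      have "s * u (Suc k) s = s * u k s + s * al ?z / lam ^ Suc k"
        using lam by (simp add: u_def G_def field_simps)
      also have "\<dots> \<ge> \<theta> * (s * u k s)"
        using abs_le_D2[OF al] unfolding \<theta>_def left_diff_distrib by simp
      finally have "\<theta> * (s * u k s) \<le> s * u (Suc k) s" .
      moreover have "\<theta> * (\<theta> ^ k * s\<^sup>2) \<le> \<theta> * (s * u k s)"
        using Suc \<theta> by (intro mult_left_mono) auto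
      ultimately show ?case by (simp add: mult.assoc)
    qed (simp add: u_def power2_eq_square)
  qed simp
  define Y where "Y = X / lam ^ n"
  define R where "R = (\<bar>Y\<bar> + 1) / \<theta> ^ n"
  have R: "R > 0" "\<theta> ^ n * R = \<bar>Y\<bar> + 1" using \<theta> by (auto simp: R_def intro!: divide_pos_pos)
  have "R * (\<theta> ^ n * R) \<le> R * u n R" using grow[of n R] by (simp add: power2_eq_square mult_ac)
  from mult_left_le_imp_le[OF this R(1)] have up: "Y \<le> u n R" using R by linarith
  have "R * (\<theta> ^ n * R) \<le> R * - u n (- R)" using grow[of n "- R"] by (simp add: power2_eq_square mult_ac)
  from mult_left_le_imp_le[OF this R(1)] have lo: "u n (- R) \<le> Y" using R by linarith
  have "continuous_on A (\<lambda>s. (G ^^ n) (s, 0))" for A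
    by (rule continuous_on_compose2[OF continuous_iterate[of UNIV]]) (auto intro!: continuous_intros)
  then have "continuous_on {-R..R} (u n)"
    unfolding u_def using lam by (intro continuous_intros) auto
  then obtain s where "u n s = Y" using IVT'[of "u n" "- R" Y R] up lo R by auto
  then show ?thesis using lam by (auto simp: u_def Y_def)
qed

end

section \<open>First integrals of such maps\<close>

text \<open>Values of \<open>P / Q\<close> are handled as points \<open>(P, Q)\<close> of the projective line, which avoids dividing by
  zeros of \<open>Q\<close>.\<close>

lemma proportional_trans:
  fixes a1 a2 b1 b2 c1 c2 :: real
  assumes "a1 * b2 = b1 * a2" "b1 * c2 = c1 * b2" "b1 \<noteq> 0 \<or> b2 \<noteq> 0"
  shows "a1 * c2 = c1 * a2"
proof -
  have "b1 * (a1 * c2) = b1 * (c1 * a2)" "b2 * (a1 * c2) = b2 * (c1 * a2)"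
    using assms(1,2) by algebra+
  then show ?thesis using assms(3) by auto
qed

text \<open>A first integral \<open>P / Q\<close> of the map near the origin. The coefficients \<open>p\<close> and \<open>q\<close> record that the restriction to
  the axis is analytic.\<close>

locale slow_fast_integral = slow_fast_map +
  fixes P Q :: "real \<times> real \<Rightarrow> real" and M :: real and p q :: "nat \<Rightarrow> real"
  assumes inv: "\<And>z. supnorm z \<le> r \<Longrightarrow> supnorm (G z) \<le> r \<Longrightarrow> P (G z) * Q z = P z * Q (G z)"
    and nz: "\<And>z. z \<noteq> 0 \<Longrightarrow> supnorm z \<le> r \<Longrightarrow> P z \<noteq> 0 \<or> Q z \<noteq> 0"
    and lipP: "\<And>z w. supnorm z \<le> r \<Longrightarrow> supnorm w \<le> r \<Longrightarrow> \<bar>P z - P w\<bar> \<le> M * supnorm (z - w)"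
    and lipQ: "\<And>z w. supnorm z \<le> r \<Longrightarrow> supnorm w \<le> r \<Longrightarrow> \<bar>Q z - Q w\<bar> \<le> M * supnorm (z - w)"
    and axisP: "\<And>s. \<bar>s\<bar> \<le> r \<Longrightarrow> (\<lambda>n. p n * s ^ n) sums P (s, 0)"
    and axisQ: "\<And>s. \<bar>s\<bar> \<le> r \<Longrightarrow> (\<lambda>n. q n * s ^ n) sums Q (s, 0)"
begin

text \<open>The only property of analytic functions of two variables that enters the contracting case; it
  will follow from \<open>flat_on_zero_set\<close>.\<close>

definition no_flat_zero_sequence :: bool where
  "no_flat_zero_sequence \<longleftrightarrow> (\<forall>a b \<zeta>. (a \<noteq> 0 \<or> b \<noteq> 0) \<and> \<zeta> \<longlonglongrightarrow> 0 \<and> (\<forall>n. \<zeta> n \<noteq> 0) \<and>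
      (\<forall>n. a * P (\<zeta> n) + b * Q (\<zeta> n) = 0) \<longrightarrow>
    \<not> (\<forall>N. \<exists>C. \<forall>n. \<bar>P (\<zeta> n)\<bar> \<le> C * supnorm (\<zeta> n) ^ N \<and> \<bar>Q (\<zeta> n)\<bar> \<le> C * supnorm (\<zeta> n) ^ N))"

lemma M: "0 \<le> M"
proof -
  have "0 \<le> M * supnorm ((r, 0) - 0)"
    using lipP[of "(r, 0)" 0] r abs_ge_zero order_trans by (auto simp: supnorm_def)
  then show ?thesis using r by (simp add: supnorm_def zero_le_mult_iff)
qed

lemma bounded_PQ:
  obtains B where "B > 0" "\<And>z. supnorm z \<le> r \<Longrightarrow> \<bar>P z\<bar> \<le> B" "\<And>z. supnorm z \<le> r \<Longrightarrow> \<bar>Q z\<bar> \<le> B"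
proof
  let ?B = "\<bar>P 0\<bar> + \<bar>Q 0\<bar> + M * r + 1"
  show "?B > 0" using M r by (smt (verit) mult_nonneg_nonneg)
  fix z assume z: "supnorm z \<le> r"
  have "M * supnorm z \<le> M * r" using z M by (rule mult_left_mono)
  then show "\<bar>P z\<bar> \<le> ?B" "\<bar>Q z\<bar> \<le> ?B" using lipP[OF z, of 0] lipQ[OF z, of 0] r by auto
qed

lemma orbit_invariant:
  assumes "z \<in> wedge" "\<And>k. k \<le> n \<Longrightarrow> supnorm ((G ^^ k) z) \<le> r"
  shows "P ((G ^^ n) z) * Q z = P z * Q ((G ^^ n) z)"
  using assms(2)
proof (induction n)
  case (Suc n)
  let ?z = "(G ^^ n) z"
  have "?z \<noteq> 0" using wedge_iterate(1)[OF assms(1), of n] by (auto simp: wedge_def)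
  moreover have "supnorm ?z \<le> r" "supnorm (G ?z) \<le> r"
    using Suc.prems[of n] Suc.prems[of "Suc n"] by auto
  ultimately have step: "P (G ?z) * Q ?z = P ?z * Q (G ?z)" "P ?z \<noteq> 0 \<or> Q ?z \<noteq> 0"
    using inv nz by auto
  have "P ?z * Q z = P z * Q ?z" using Suc by simp
  from proportional_trans[OF step(1) this step(2)] show ?case by simp
qed simp

lemma continuous_PQ:
  "continuous_on {z. supnorm z \<le> r} P" "continuous_on {z. supnorm z \<le> r} Q"
proof -
  have "M-lipschitz_on {z. supnorm z \<le> r} f"
    if "\<And>z w. supnorm z \<le> r \<Longrightarrow> supnorm w \<le> r \<Longrightarrow> \<bar>f z - f w\<bar> \<le> M * supnorm (z - w)" for f :: "real \<times> real \<Rightarrow> real"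
  proof (rule lipschitz_onI)
    fix z w :: "real \<times> real" assume "z \<in> {z. supnorm z \<le> r}" "w \<in> {z. supnorm z \<le> r}"
    then have "\<bar>f z - f w\<bar> \<le> M * supnorm (z - w)" using that by simp
    also have "\<dots> \<le> M * norm (z - w)" using M supnorm_le_norm by (intro mult_left_mono)
    finally show "dist (f z) (f w) \<le> M * dist z w" by (simp add: dist_norm)
  qed (rule M)
  then show "continuous_on {z. supnorm z \<le> r} P" "continuous_on {z. supnorm z \<le> r} Q"
    using lipP lipQ lipschitz_on_continuous_on by blast+
qed

subsection \<open>The contracting case\<close>

text \<open>For every \<open>n\<close> there is a point \<open>s n\<close> of the axis whose \<open>n\<close>-th iterate lies vertically above or below that
  of \<open>z\<close>, and then these two iterates are extremely close. Let \<open>s\<close> be an accumulation point of the \<open>s n\<close>. If the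
  first integral had different values at \<open>z\<close> and at \<open>s\<close>, then two different level curves would come
  extremely close at the iterates of \<open>z\<close>. This forces \<open>P\<close> and \<open>Q\<close> to be flat along the orbit of \<open>z\<close>, on
  which a combination of them vanishes.\<close>

lemma contracting_axis_point:
  assumes contr: "\<bar>lam\<bar> + \<epsilon> < 1"
    and noflat: no_flat_zero_sequence
    and z: "z \<in> wedge" "supnorm z \<le> r / 2"
  obtains s where "s \<noteq> 0" "\<bar>s\<bar> \<le> 2 * supnorm z" "P z * Q (s, 0) = P (s, 0) * Q z"
proof -
  define \<kappa> where "\<kappa> = \<bar>lam\<bar> + \<epsilon>"
  define \<theta> where "\<theta> = \<bar>lam\<bar> - \<epsilon>"
  have \<kappa>: "0 < \<kappa>" "\<kappa> < 1" and \<theta>: "0 < \<theta>" using contr eps lam unfolding \<kappa>_def \<theta>_def by linarith+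
  define x where "x = \<bar>fst z\<bar>"
  have x: "x > 0" "supnorm z = x" "2 * \<bar>snd z\<bar> \<le> x" using z supnorm_wedge by (auto simp: x_def wedge_def)
  have orbit: "supnorm ((G ^^ n) w) \<le> \<kappa> ^ n * r" "supnorm ((G ^^ n) w) \<le> r"
    if "w \<in> wedge" "supnorm w \<le> r" for w n
  proof -
    have "supnorm ((G ^^ n) w) \<le> \<kappa> ^ n * supnorm w"
      using wedge_iterate[OF that(1), of n] by (simp add: supnorm_wedge that \<kappa>_def)
    also have "\<dots> \<le> \<kappa> ^ n * r" using that \<kappa> by (intro mult_left_mono) auto
    finally show 1: "supnorm ((G ^^ n) w) \<le> \<kappa> ^ n * r" .
    have "\<kappa> ^ n * r \<le> 1 * r" using \<kappa> r by (intro mult_right_mono power_le_one) auto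
    then show "supnorm ((G ^^ n) w) \<le> r" using 1 by linarith
  qed
  have zr: "supnorm z \<le> r" using z(2) r by linarith
  define s where "s = (\<lambda>n. SOME s. fst ((G ^^ n) (s, 0)) = fst ((G ^^ n) z))"
  have s: "fst ((G ^^ n) (s n, 0)) = fst ((G ^^ n) z)" for n
    unfolding s_def by (rule someI_ex[OF shooting])
  have sz: "\<bar>s n - fst z\<bar> \<le> \<bar>snd z\<bar>" for n
    using vertical_pair[OF s, of 0 n] by simp
  have sx: "x / 2 \<le> \<bar>s n\<bar>" "\<bar>s n\<bar> \<le> 3 / 2 * x" for n
    using sz[of n] x by (auto simp: x_def)
  have sw: "(s n, 0) \<in> wedge" "supnorm (s n, 0) \<le> r" for n
    using sx[of n] x z(2) by (auto simp: wedge_def supnorm_def)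
  have "bounded (range s)" using sx(2) unfolding bounded_iff by (metis imageE real_norm_def)
  then obtain l f where f: "strict_mono (f :: nat \<Rightarrow> nat)" "(s \<circ> f) \<longlonglongrightarrow> l"
    using bounded_imp_convergent_subsequence by blast
  have labs: "(\<lambda>n. \<bar>s (f n)\<bar>) \<longlonglongrightarrow> \<bar>l\<bar>" using f(2) by (intro tendsto_rabs) (simp add: o_def)
  have l: "x / 2 \<le> \<bar>l\<bar>" "\<bar>l\<bar> \<le> 3 / 2 * x"
    by (rule LIMSEQ_le_const[OF labs], use sx in blast)
      (rule LIMSEQ_le_const2[OF labs], use sx in blast)
  define D where "D = (\<lambda>s. P z * Q (s, 0) - P (s, 0) * Q z)"
  have "D l = 0"
  proof (rule ccontr)
    assume "D l \<noteq> 0"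
    define g where "g = \<bar>D l\<bar> / 2"
    have g: "g > 0" using \<open>D l \<noteq> 0\<close> by (simp add: g_def)
    have cD: "continuous_on {-r..r} D"
      unfolding D_def
      by (intro continuous_intros continuous_on_compose2[OF continuous_PQ(1)]
        continuous_on_compose2[OF continuous_PQ(2)]) (use r in \<open>auto simp: supnorm_def\<close>)
    have "\<bar>l\<bar> \<le> r" using l x z(2) by linarith
    then have lr: "l \<in> {-r..r}" by (auto simp: abs_le_iff)
    have sr: "s (f n) \<in> {-r..r}" for n
    proof -
      have "\<bar>s (f n)\<bar> \<le> r" using sx(2)[of "f n"] x z(2) by linarith
      then show ?thesis by (auto simp: abs_le_iff)
    qed
    have "(\<lambda>n. s (f n)) \<longlonglongrightarrow> l" using f(2) by (simp only: o_def)
    from continuous_on_tendsto_compose[OF cD this lr always_eventually]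
    have "(\<lambda>n. D (s (f n))) \<longlonglongrightarrow> D l" using sr by blast
    then have "(\<lambda>n. \<bar>D (s (f n))\<bar>) \<longlonglongrightarrow> \<bar>D l\<bar>" by (rule tendsto_rabs)
    then have "eventually (\<lambda>n. \<bar>D (s (f n))\<bar> > g) sequentially"
      using g by (intro order_tendstoD) (auto simp: g_def)
    then obtain n0 where n0: "\<And>n. n \<ge> n0 \<Longrightarrow> \<bar>D (s (f n))\<bar> > g"
      by (auto simp: eventually_sequentially)
    define h where "h = (\<lambda>n. f (n + n0))"
    have h: "\<bar>D (s (h n))\<bar> > g" for n using n0 by (simp add: h_def)
    define \<zeta> where "\<zeta> = (\<lambda>n. (G ^^ h n) z)"
    obtain B where B: "B > 0" "\<And>z. supnorm z \<le> r \<Longrightarrow> \<bar>P z\<bar> \<le> B" "\<And>z. supnorm z \<le> r \<Longrightarrow> \<bar>Q z\<bar> \<le> B"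
      by (rule bounded_PQ) blast
    have \<zeta>w: "\<zeta> n \<in> wedge" "\<theta> ^ h n * x \<le> supnorm (\<zeta> n)" for n
      using wedge_iterate[OF z(1), of "h n"] by (auto simp: \<zeta>_def supnorm_wedge \<theta>_def x_def)
    have close: "\<bar>P (\<zeta> n)\<bar> \<le> B * (2 * B * M * (2 * r)) / g * (\<Prod>k<h n. \<kappa> ^ k)"
        "\<bar>Q (\<zeta> n)\<bar> \<le> B * (2 * B * M * (2 * r)) / g * (\<Prod>k<h n. \<kappa> ^ k)" for n
    proof -
      define m where "m = h n"
      define v where "v = (s m, 0::real)"
      define w where "w = (G ^^ m) v"
      have v: "v \<in> wedge" "supnorm v \<le> r" using sw by (auto simp: v_def)
      have eq: "fst ((G ^^ m) z) = fst ((G ^^ m) v)" using s by (simp add: v_def)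
      have "supnorm (\<zeta> n - w) \<le> (\<Prod>j<m. K * max (supnorm ((G ^^ j) z)) (supnorm ((G ^^ j) v))) * supnorm (z - v)"
        using vertical_contraction[OF eq, of m] by (simp add: \<zeta>_def w_def m_def)
      also have "\<dots> \<le> (\<Prod>j<m. \<kappa> ^ j) * (2 * r)"
      proof (intro mult_mono prod_mono conjI)
        fix j
        have "K * max (supnorm ((G ^^ j) z)) (supnorm ((G ^^ j) v)) \<le> K * (\<kappa> ^ j * r)"
          using K orbit[OF z(1) zr] orbit[OF v] by (intro mult_left_mono) auto
        also have "\<dots> = K * r * \<kappa> ^ j" by simp
        also have "\<dots> \<le> 1 * \<kappa> ^ j" using Kr \<kappa> by (intro mult_right_mono) auto
        finally show "K * max (supnorm ((G ^^ j) z)) (supnorm ((G ^^ j) v)) \<le> \<kappa> ^ j" by simp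
        show "0 \<le> K * max (supnorm ((G ^^ j) z)) (supnorm ((G ^^ j) v))" using K by (simp add: le_max_iff_disj)
      next
        show "supnorm (z - v) \<le> 2 * r" using supnorm_diff_le[of z v] v zr by linarith
      qed (use \<kappa> in \<open>auto intro: prod_nonneg\<close>)
      finally have dist: "supnorm (\<zeta> n - w) \<le> (\<Prod>j<m. \<kappa> ^ j) * (2 * r)" .
      have rs: "supnorm (\<zeta> n) \<le> r" "supnorm w \<le> r"
        using orbit(2)[OF z(1) zr] orbit(2)[OF v] by (auto simp: \<zeta>_def w_def)
      have wv: "P w * Q v = P v * Q w"
        unfolding w_def by (rule orbit_invariant[OF v(1)]) (rule orbit(2)[OF v])
      have \<zeta>z: "P (\<zeta> n) * Q z = P z * Q (\<zeta> n)"
        unfolding \<zeta>_def by (rule orbit_invariant[OF z(1)]) (rule orbit(2)[OF z(1) zr])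
      define E where "E = Q v * P (\<zeta> n) - P v * Q (\<zeta> n)"
      have "E = Q v * (P (\<zeta> n) - P w) - P v * (Q (\<zeta> n) - Q w)"
        using wv by (simp add: E_def algebra_simps)
      then have "\<bar>E\<bar> \<le> \<bar>Q v\<bar> * \<bar>P (\<zeta> n) - P w\<bar> + \<bar>P v\<bar> * \<bar>Q (\<zeta> n) - Q w\<bar>"
        by (metis abs_triangle_ineq4 abs_mult)
      also have "\<dots> \<le> B * (M * supnorm (\<zeta> n - w)) + B * (M * supnorm (\<zeta> n - w))"
        using B v rs lipP lipQ by (intro add_mono mult_mono) auto
      also have "\<dots> = 2 * B * M * supnorm (\<zeta> n - w)" by simp
      also have "\<dots> \<le> 2 * B * M * ((\<Prod>j<m. \<kappa> ^ j) * (2 * r))"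
        using dist B M by (intro mult_left_mono) auto
      finally have E: "\<bar>E\<bar> \<le> 2 * B * M * ((\<Prod>j<m. \<kappa> ^ j) * (2 * r))" .
      have Dv: "\<bar>D (s m)\<bar> > g" using h by (simp add: m_def)
      have "P (\<zeta> n) * D (s m) = P z * E" "Q (\<zeta> n) * D (s m) = Q z * E"
        using \<zeta>z unfolding D_def E_def v_def by algebra+
      then have "\<bar>P (\<zeta> n)\<bar> * \<bar>D (s m)\<bar> = \<bar>P z\<bar> * \<bar>E\<bar>" "\<bar>Q (\<zeta> n)\<bar> * \<bar>D (s m)\<bar> = \<bar>Q z\<bar> * \<bar>E\<bar>"
        by (metis abs_mult)+
      moreover have "\<bar>P z\<bar> * \<bar>E\<bar> \<le> B * (2 * B * M * ((\<Prod>j<m. \<kappa> ^ j) * (2 * r)))"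
          "\<bar>Q z\<bar> * \<bar>E\<bar> \<le> B * (2 * B * M * ((\<Prod>j<m. \<kappa> ^ j) * (2 * r)))"
        using mult_mono[OF B(2)[OF zr] E] mult_mono[OF B(3)[OF zr] E] B(1) by simp_all
      moreover have "\<bar>P (\<zeta> n)\<bar> * g \<le> \<bar>P (\<zeta> n)\<bar> * \<bar>D (s m)\<bar>" "\<bar>Q (\<zeta> n)\<bar> * g \<le> \<bar>Q (\<zeta> n)\<bar> * \<bar>D (s m)\<bar>"
        using Dv by (auto intro!: mult_left_mono)
      ultimately show "\<bar>P (\<zeta> n)\<bar> \<le> B * (2 * B * M * (2 * r)) / g * (\<Prod>k<h n. \<kappa> ^ k)"
        "\<bar>Q (\<zeta> n)\<bar> \<le> B * (2 * B * M * (2 * r)) / g * (\<Prod>k<h n. \<kappa> ^ k)"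
        using g by (auto simp: m_def field_simps)
    qed
    define A where "A = B * (2 * B * M * (2 * r)) / g"
    have A: "A \<ge> 0" using B M r g by (simp add: A_def)
    have flat: "\<exists>C. \<forall>n. A * (\<Prod>k<h n. \<kappa> ^ k) \<le> C * supnorm (\<zeta> n) ^ N" for N
    proof -
      obtain C where C: "C > 0" "\<And>n. (\<Prod>k<n. \<kappa> ^ k) \<le> C * (\<theta> ^ N) ^ n"
        using prod_powers_flat[of \<kappa> "\<theta> ^ N"] \<kappa> \<theta> by auto
      have "A * (\<Prod>k<h n. \<kappa> ^ k) \<le> A * C / x ^ N * supnorm (\<zeta> n) ^ N" for n
      proof -
        have "(\<theta> ^ h n * x) ^ N \<le> supnorm (\<zeta> n) ^ N"
          using \<zeta>w(2)[of n] \<theta> x by (intro power_mono) auto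
        then have "(\<theta> ^ N) ^ h n \<le> supnorm (\<zeta> n) ^ N / x ^ N"
          using x by (simp add: power_mult_distrib field_simps flip: power_mult)
        then have "C * (\<theta> ^ N) ^ h n \<le> C * (supnorm (\<zeta> n) ^ N / x ^ N)"
          using C by (intro mult_left_mono) auto
        then have "(\<Prod>k<h n. \<kappa> ^ k) \<le> C * (supnorm (\<zeta> n) ^ N / x ^ N)"
          using C(2)[of "h n"] by linarith
        then have "A * (\<Prod>k<h n. \<kappa> ^ k) \<le> A * (C * (supnorm (\<zeta> n) ^ N / x ^ N))"
          using A by (intro mult_left_mono) auto
        then show ?thesis by simp
      qed
      then show ?thesis by blast
    qed
    have ab: "Q z \<noteq> 0 \<or> - P z \<noteq> 0" using nz[of z] zr x by (metis less_irrefl neg_equal_0_iff_equal supnorm_0)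
    have "(\<lambda>n. \<kappa> ^ h n * r) \<longlonglongrightarrow> 0"
    proof -
      have "strict_mono h" using f(1) by (auto simp: h_def strict_mono_def)
      then have "(\<lambda>n. \<kappa> ^ h n) \<longlonglongrightarrow> 0"
        using LIMSEQ_subseq_LIMSEQ[OF LIMSEQ_realpow_zero[of \<kappa>]] \<kappa> by (simp add: o_def)
      then show ?thesis by (rule tendsto_mult_left_zero)
    qed
    then have "(\<lambda>n. 2 * (\<kappa> ^ h n * r)) \<longlonglongrightarrow> 0" by (rule tendsto_mult_right_zero)
    then have lim: "\<zeta> \<longlonglongrightarrow> 0"
    proof (rule Lim_null_comparison[rotated])
      show "\<forall>\<^sub>F n in sequentially. norm (\<zeta> n) \<le> 2 * (\<kappa> ^ h n * r)"
      proof (rule always_eventually, rule allI)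
        fix n show "norm (\<zeta> n) \<le> 2 * (\<kappa> ^ h n * r)"
          using norm_le_supnorm[of "\<zeta> n"] orbit(1)[OF z(1) zr, of "h n"] by (simp add: \<zeta>_def)
      qed
    qed
    have ne: "\<zeta> n \<noteq> 0" for n using \<zeta>w(1)[of n] by (auto simp: wedge_def)
    have van: "Q z * P (\<zeta> n) + - P z * Q (\<zeta> n) = 0" for n
      using orbit_invariant[OF z(1) orbit(2)[OF z(1) zr], of "h n"] by (simp add: \<zeta>_def mult.commute)
    have "\<exists>C. \<forall>n. \<bar>P (\<zeta> n)\<bar> \<le> C * supnorm (\<zeta> n) ^ N \<and> \<bar>Q (\<zeta> n)\<bar> \<le> C * supnorm (\<zeta> n) ^ N" for N
      using flat[of N] close unfolding A_def by (meson order_trans)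
    then show False
      using noflat ab lim ne van unfolding no_flat_zero_sequence_def by blast
  qed
  then show ?thesis
    using l x by (intro that[of l]) (auto simp: D_def)
qed

text \<open>The iterates of \<open>z\<close> tend to the origin and all have the value of \<open>z\<close>. By the preceding lemma this value
  is therefore taken at points of the axis that accumulate at the origin, hence on the whole
  axis. So all points of the wedge have the same value.\<close>

lemma contracting_case:
  assumes contr: "\<bar>lam\<bar> + \<epsilon> < 1"
    and noflat: no_flat_zero_sequence
  shows "\<exists>a b. (a \<noteq> 0 \<or> b \<noteq> 0) \<and> (\<forall>z\<in>wedge. supnorm z \<le> r / 2 \<longrightarrow> a * P z + b * Q z = 0)"
proof (rule exI[of _ "Q (r / 2, 0)"], rule exI[of _ "- P (r / 2, 0)"], intro conjI ballI impI)
  have "(r / 2, 0::real) \<noteq> 0" using r by (simp add: zero_prod_def)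
  then show "Q (r / 2, 0) \<noteq> 0 \<or> - P (r / 2, 0) \<noteq> 0"
    using nz[of "(r / 2, 0)"] r by (auto simp: supnorm_def)
  fix z assume z: "z \<in> wedge" "supnorm z \<le> r / 2"
  define \<kappa> where "\<kappa> = \<bar>lam\<bar> + \<epsilon>"
  have \<kappa>: "0 < \<kappa>" "\<kappa> < 1" using contr eps lam unfolding \<kappa>_def by linarith+
  have orbit: "supnorm ((G ^^ n) z) \<le> \<kappa> ^ n * r" "supnorm ((G ^^ n) z) \<le> r / 2" for n
  proof -
    have 1: "supnorm ((G ^^ n) z) \<le> \<kappa> ^ n * supnorm z"
      using wedge_iterate[OF z(1), of n] by (simp add: supnorm_wedge z \<kappa>_def)
    also have "\<dots> \<le> \<kappa> ^ n * r" using z r \<kappa> by (intro mult_left_mono) auto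
    finally show "supnorm ((G ^^ n) z) \<le> \<kappa> ^ n * r" .
    have "\<kappa> ^ n * supnorm z \<le> 1 * supnorm z" using \<kappa> by (intro mult_right_mono power_le_one) auto
    then show "supnorm ((G ^^ n) z) \<le> r / 2" using 1 z by linarith
  qed
  have "\<exists>s. s \<noteq> 0 \<and> \<bar>s\<bar> \<le> 2 * supnorm ((G ^^ n) z) \<and>
    P ((G ^^ n) z) * Q (s, 0) = P (s, 0) * Q ((G ^^ n) z)" for n
    using contracting_axis_point[OF contr noflat wedge_iterate(1)[OF z(1), of n] orbit(2)[of n]] by metis
  then obtain s where s: "\<And>n. s n \<noteq> 0" "\<And>n. \<bar>s n\<bar> \<le> 2 * supnorm ((G ^^ n) z)"
    "\<And>n. P ((G ^^ n) z) * Q (s n, 0) = P (s n, 0) * Q ((G ^^ n) z)" by metis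
  have zs: "P z * Q (s n, 0) = P (s n, 0) * Q z" for n
  proof (rule proportional_trans)
    have le: "supnorm ((G ^^ k) z) \<le> r" for k using orbit(2)[of k] r by linarith
    show "P z * Q ((G ^^ n) z) = P ((G ^^ n) z) * Q z"
      using orbit_invariant[OF z(1) le, of n] by simp
    have "(G ^^ n) z \<noteq> 0" using wedge_iterate(1)[OF z(1), of n] by (auto simp: wedge_def)
    then show "P ((G ^^ n) z) \<noteq> 0 \<or> Q ((G ^^ n) z) \<noteq> 0" using nz le by blast
  qed (use s in auto)
  define a where "a = (\<lambda>n. P z * q n - p n * Q z)"
  define f where "f = (\<lambda>s. P z * Q (s, 0) - P (s, 0) * Q z)"
  have sums: "(\<lambda>n. a n * t ^ n) sums f t" if "\<bar>t\<bar> \<le> r" for t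
  proof -
    have "(\<lambda>n. P z * (q n * t ^ n) - p n * t ^ n * Q z) sums (P z * Q (t, 0) - P (t, 0) * Q z)"
      by (intro sums_diff sums_mult sums_mult2 axisP axisQ that)
    then show ?thesis by (simp add: a_def f_def algebra_simps)
  qed
  have "a m = 0" for m
  proof (rule powser_flat_imp_zero[OF r, of a f s])
    have "(\<lambda>n. \<kappa> ^ n) \<longlonglongrightarrow> 0" using \<kappa> by (intro LIMSEQ_realpow_zero) auto
    then have "(\<lambda>n. 2 * (\<kappa> ^ n * r)) \<longlonglongrightarrow> 0"
      by (intro tendsto_mult_right_zero tendsto_mult_left_zero)
    then show "s \<longlonglongrightarrow> 0"
    proof (rule Lim_null_comparison[rotated])
      show "\<forall>\<^sub>F n in sequentially. norm (s n) \<le> 2 * (\<kappa> ^ n * r)"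
      proof (rule always_eventually, rule allI)
        fix n show "norm (s n) \<le> 2 * (\<kappa> ^ n * r)"
          using s(2)[of n] orbit(1)[of n] by simp
      qed
    qed
    show "\<exists>C. \<forall>\<^sub>F k in sequentially. norm (f (s k)) \<le> C * norm (s k) ^ N" for N
      using zs by (intro exI[of _ 0]) (simp add: f_def)
  qed (use sums s in auto)
  then have "(\<lambda>n. 0) sums f (r / 2)" using sums[of "r / 2"] r by simp
  then have "f (r / 2) = 0" using sums_unique2[OF sums_zero] by metis
  then show "Q (r / 2, 0) * P z + - P (r / 2, 0) * Q z = 0" by (simp add: f_def mult.commute)
qed

subsection \<open>The expanding case\<close>

text \<open>Let \<open>c\<close> be the limit of \<open>P / Q\<close> along the axis, and \<open>A\<close> the combination of \<open>P\<close> and \<open>Q\<close> that vanishes at \<open>c\<close>.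
  The orbit of a point \<open>z\<close> near the origin leaves the box after about \<open>log (1 / |z|)\<close> steps. At that time it is
  extremely close to iterates of points of the axis that started much closer to the origin and where
  \<open>P / Q\<close> is almost \<open>c\<close>. So \<open>A\<close> is extremely small at the exit point, and by invariance it is
  flat at the origin.\<close>

lemma expanding_case:
  assumes expand: "1 < \<bar>lam\<bar> - \<epsilon>"
  shows "\<exists>a b. (a \<noteq> 0 \<or> b \<noteq> 0) \<and>
    (\<forall>N. \<exists>C. \<forall>z\<in>wedge. supnorm z \<le> r \<longrightarrow> \<bar>a * P z + b * Q z\<bar> \<le> C * supnorm z ^ N)"
proof -
  define \<kappa> where "\<kappa> = \<bar>lam\<bar> - \<epsilon>"
  define \<Lambda> where "\<Lambda> = \<bar>lam\<bar> + \<epsilon>"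
  have \<kappa>: "1 < \<kappa>" and \<Lambda>: "\<kappa> \<le> \<Lambda>" using expand eps by (auto simp: \<kappa>_def \<Lambda>_def)
  have "\<exists>n. p n \<noteq> 0 \<or> q n \<noteq> 0"
  proof (rule ccontr)
    assume "\<nexists>n. p n \<noteq> 0 \<or> q n \<noteq> 0"
    then have "(\<lambda>n. 0) sums P (r, 0)" "(\<lambda>n. 0) sums Q (r, 0)"
      using axisP[of r] axisQ[of r] r by simp_all
    then have "P (r, 0) = 0" "Q (r, 0) = 0" using sums_unique2[OF sums_zero] by metis+
    moreover have "(r, 0::real) \<noteq> 0" using r by (simp add: zero_prod_def)
    ultimately show False using nz[of "(r, 0)"] r by (auto simp: supnorm_def)
  qed
  define N where "N = (LEAST n. p n \<noteq> 0 \<or> q n \<noteq> 0)"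
  have N: "p N \<noteq> 0 \<or> q N \<noteq> 0" unfolding N_def using \<open>\<exists>n. p n \<noteq> 0 \<or> q n \<noteq> 0\<close> by (rule LeastI_ex)
  have low: "p n = 0 \<and> q n = 0" if "n < N" for n using that not_less_Least unfolding N_def by blast
  define W where "W = (p N)\<^sup>2 + (q N)\<^sup>2"
  have W: "W > 0" using N by (auto simp: W_def sum_power2_gt_zero_iff)
  define A where "A = (\<lambda>z. q N * P z + - p N * Q z)"
  define B where "B = (\<lambda>z. p N * P z + q N * Q z)"
  have AB: "(A z)\<^sup>2 + (B z)\<^sup>2 = W * ((P z)\<^sup>2 + (Q z)\<^sup>2)" for z
    unfolding A_def B_def W_def by algebra
  have limP: "((\<lambda>s. P (s, 0) / s ^ N) \<longlongrightarrow> p N) (at 0)"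
    by (rule powser_leading_limit[OF r]) (use axisP low in auto)
  have limQ: "((\<lambda>s. Q (s, 0) / s ^ N) \<longlongrightarrow> q N) (at 0)"
    by (rule powser_leading_limit[OF r]) (use axisQ low in auto)
  have "((\<lambda>s. (q N * (P (s, 0) / s ^ N) + - p N * (Q (s, 0) / s ^ N)) /
      (p N * (P (s, 0) / s ^ N) + q N * (Q (s, 0) / s ^ N))) \<longlongrightarrow>
      (q N * p N + - p N * q N) / (p N * p N + q N * q N)) (at 0)"
    using N by (intro tendsto_intros limP limQ) (simp add: add_nonneg_eq_0_iff)
  moreover have "eventually (\<lambda>s. (q N * (P (s, 0) / s ^ N) + - p N * (Q (s, 0) / s ^ N)) /
      (p N * (P (s, 0) / s ^ N) + q N * (Q (s, 0) / s ^ N)) = A (s, 0) / B (s, 0)) (at 0)"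
    unfolding eventually_at_filter
  proof (rule always_eventually, intro allI impI)
    fix s :: real assume "s \<noteq> 0"
    have "q N * (P (s, 0) / s ^ N) + - p N * (Q (s, 0) / s ^ N) = A (s, 0) / s ^ N"
      "p N * (P (s, 0) / s ^ N) + q N * (Q (s, 0) / s ^ N) = B (s, 0) / s ^ N"
      by (simp_all add: A_def B_def add_divide_distrib diff_divide_distrib)
    then show "(q N * (P (s, 0) / s ^ N) + - p N * (Q (s, 0) / s ^ N)) /
      (p N * (P (s, 0) / s ^ N) + q N * (Q (s, 0) / s ^ N)) = A (s, 0) / B (s, 0)"
      using \<open>s \<noteq> 0\<close> by simp
  qed
  ultimately have limAB: "((\<lambda>s. A (s, 0) / B (s, 0)) \<longlongrightarrow> 0) (at 0)"
    using Lim_transform_eventually by fastforce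
  have "((\<lambda>s. p N * (P (s, 0) / s ^ N) + q N * (Q (s, 0) / s ^ N)) \<longlongrightarrow> p N * p N + q N * q N) (at 0)"
    by (intro tendsto_intros limP limQ)
  then have "eventually (\<lambda>s. 0 < p N * (P (s, 0) / s ^ N) + q N * (Q (s, 0) / s ^ N)) (at 0)"
    using W by (intro order_tendstoD) (auto simp: W_def power2_eq_square)
  then have evB: "eventually (\<lambda>s. B (s, 0) \<noteq> 0) (at 0)"
  proof eventually_elim
    case (elim s)
    have "p N * (P (s, 0) / s ^ N) + q N * (Q (s, 0) / s ^ N) = B (s, 0) / s ^ N"
      by (simp add: B_def add_divide_distrib)
    then show ?case using elim by auto
  qed
  obtain b where b: "b > 0" "\<And>z. supnorm z \<le> r \<Longrightarrow> \<bar>P z\<bar> \<le> b" "\<And>z. supnorm z \<le> r \<Longrightarrow> \<bar>Q z\<bar> \<le> b"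
    by (rule bounded_PQ) blast
  define m where "m = \<bar>p N\<bar> + \<bar>q N\<bar>"
  have m: "m \<ge> 0" by (simp add: m_def)
  have Bb: "\<bar>B z\<bar> \<le> m * b" if "supnorm z \<le> r" for z
  proof -
    have "\<bar>B z\<bar> \<le> \<bar>p N\<bar> * \<bar>P z\<bar> + \<bar>q N\<bar> * \<bar>Q z\<bar>"
      unfolding B_def by (metis abs_mult abs_triangle_ineq)
    also have "\<dots> \<le> \<bar>p N\<bar> * b + \<bar>q N\<bar> * b" using b that by (intro add_mono mult_left_mono) auto
    finally show ?thesis by (simp add: m_def algebra_simps)
  qed
  have lipA: "\<bar>A z - A w\<bar> \<le> m * M * supnorm (z - w)" if "supnorm z \<le> r" "supnorm w \<le> r" for z w
  proof -
    have "A z - A w = q N * (P z - P w) - p N * (Q z - Q w)" by (simp add: A_def algebra_simps)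
    then have "\<bar>A z - A w\<bar> \<le> \<bar>q N\<bar> * \<bar>P z - P w\<bar> + \<bar>p N\<bar> * \<bar>Q z - Q w\<bar>"
      by (metis abs_mult abs_triangle_ineq4)
    also have "\<dots> \<le> \<bar>q N\<bar> * (M * supnorm (z - w)) + \<bar>p N\<bar> * (M * supnorm (z - w))"
      using lipP lipQ that by (intro add_mono mult_left_mono) auto
    finally show ?thesis by (simp add: m_def algebra_simps)
  qed
  \<comment> \<open>Every orbit in the wedge visits the annulus \<open>S\<close> before it leaves the box. There \<open>A\<close> and \<open>B\<close> cannot
    be small together, since \<open>P\<close> and \<open>Q\<close> have no common zero in it.\<close>
  define S where "S = {z. r / \<Lambda> \<le> supnorm z \<and> supnorm z \<le> r}"
  have csup: "continuous_on UNIV supnorm"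
    unfolding supnorm_def by (intro continuous_intros)
  have "closed S"
    unfolding S_def by (intro closed_Collect_conj closed_Collect_le continuous_intros csup)
  moreover have "bounded S"
    unfolding bounded_iff
  proof (intro exI[of _ "2 * r"] ballI)
    fix z assume "z \<in> S"
    then show "norm z \<le> 2 * r" using norm_le_supnorm[of z] by (simp add: S_def)
  qed
  ultimately have "compact S" by (simp add: compact_eq_bounded_closed)
  have "(r, 0) \<in> S" using r \<kappa> \<Lambda> by (auto simp: S_def supnorm_def field_simps)
  have cS: "continuous_on S (\<lambda>z. (P z)\<^sup>2 + (Q z)\<^sup>2)"
    by (intro continuous_intros continuous_on_subset[OF continuous_PQ(1)]
      continuous_on_subset[OF continuous_PQ(2)]) (auto simp: S_def)
  obtain z0 where z0: "z0 \<in> S" "\<And>z. z \<in> S \<Longrightarrow> (P z0)\<^sup>2 + (Q z0)\<^sup>2 \<le> (P z)\<^sup>2 + (Q z)\<^sup>2"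
    using continuous_attains_inf[OF \<open>compact S\<close> _ cS] \<open>(r, 0) \<in> S\<close> by blast
  define \<mu> where "\<mu> = (P z0)\<^sup>2 + (Q z0)\<^sup>2"
  have "0 < r / \<Lambda>" using r \<kappa> \<Lambda> by simp
  then have "supnorm z0 > 0" using z0(1) by (simp add: S_def)
  then have "z0 \<noteq> 0" by auto
  then have \<mu>: "\<mu> > 0" using nz[of z0] z0(1) by (auto simp: \<mu>_def S_def sum_power2_gt_zero_iff)

  define pr where "pr = (\<lambda>n. \<Prod>k<n. (1 / \<kappa>) ^ k)"
  have pr0: "0 \<le> pr n" for n unfolding pr_def using \<kappa> by (intro prod_nonneg) auto
  have backward: "supnorm ((G ^^ k) w) \<le> r * (1 / \<kappa>) ^ (n - k)" 
    if w: "w \<in> wedge" "supnorm ((G ^^ n) w) \<le> r" "k \<le> n" for w n k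
  proof -
    have "\<kappa> ^ (n - k) * supnorm ((G ^^ k) w) \<le> supnorm ((G ^^ (n - k)) ((G ^^ k) w))"
      using wedge_iterate(1,2)[OF wedge_iterate(1)[OF w(1), of k], of "n - k"] wedge_iterate(1)[OF w(1), of k]
      by (simp add: supnorm_wedge \<kappa>_def)
    also have "(G ^^ (n - k)) ((G ^^ k) w) = (G ^^ n) w"
      using fun_cong[OF funpow_add[of "n - k" k G], of w] w(3) by simp
    finally show ?thesis using w(2) \<kappa> by (simp add: field_simps power_divide)
  qed
  have within: "supnorm ((G ^^ k) w) \<le> r"
    if w: "w \<in> wedge" "supnorm ((G ^^ n) w) \<le> r" "k \<le> n" for w n k
  proof -
    have "r * (1 / \<kappa>) ^ (n - k) \<le> r * 1"
      using \<kappa> r by (intro mult_left_mono power_le_one) auto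
    then show ?thesis using backward[OF w] by linarith
  qed
  \<comment> \<open>An orbit that ends in the box is shadowed by orbits that start on the axis ever closer
    to the origin, on which \<open>A / B\<close> tends to zero.\<close>
  have small: "\<bar>A ((G ^^ n) z)\<bar> \<le> m * M * (2 * r) * pr n"
    if z: "z \<in> wedge" "supnorm ((G ^^ n) z) \<le> r" for z n
  proof -
    define X where "X = fst ((G ^^ n) z)"
    have X: "X \<noteq> 0" "\<bar>X\<bar> \<le> r"
      using wedge_iterate(1)[OF z(1), of n] z(2) supnorm_fst[of "(G ^^ n) z"] by (auto simp: X_def wedge_def)
    define s where "s = (\<lambda>j. SOME s. fst ((G ^^ (j + n)) (s, 0)) = X)"
    have s: "fst ((G ^^ (j + n)) (s j, 0)) = X" for j
      unfolding s_def by (rule someI_ex[OF shooting])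
    have s0: "s j \<noteq> 0" for j
    proof
      assume "s j = 0"
      moreover have "(G ^^ k) (0, 0) = 0" for k by (induction k) (auto simp: zero_prod_def[symmetric])
      ultimately show False using s[of j] X by simp
    qed
    then have sw: "(s j, 0) \<in> wedge" for j by (simp add: wedge_def)
    have end_in: "supnorm ((G ^^ (j + n)) (s j, 0)) \<le> r" for j
      using supnorm_wedge[OF wedge_iterate(1)[OF sw, of "j + n" j]] s[of j] X by simp
    have "\<bar>s j\<bar> \<le> r * (1 / \<kappa>) ^ j" for j
    proof -
      have "\<bar>s j\<bar> \<le> r * (1 / \<kappa>) ^ (j + n)"
        using backward[OF sw end_in, of 0 j] by (simp add: supnorm_def)
      also have "\<dots> \<le> r * (1 / \<kappa>) ^ j"
        using r \<kappa> by (intro mult_left_mono power_decreasing) auto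
      finally show ?thesis .
    qed
    moreover have "(\<lambda>j. r * (1 / \<kappa>) ^ j) \<longlonglongrightarrow> 0"
      using \<kappa> by (intro tendsto_mult_right_zero LIMSEQ_realpow_zero) auto
    ultimately have "s \<longlonglongrightarrow> 0"
      by (intro Lim_null_comparison[of s "\<lambda>j. r * (1 / \<kappa>) ^ j"]) (auto intro: always_eventually)
    then have sfl: "filterlim s (at 0) sequentially" using s0 by (auto simp: filterlim_at)
    have lim0: "(\<lambda>j. \<bar>A (s j, 0) / B (s j, 0)\<bar> * (m * b)) \<longlonglongrightarrow> 0"
      using filterlim_compose[OF limAB sfl] by (intro tendsto_mult_left_zero tendsto_rabs_zero)
    have bound: "\<bar>A ((G ^^ n) z)\<bar> \<le> \<bar>A (s j, 0) / B (s j, 0)\<bar> * (m * b) + m * M * (2 * r) * pr n"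
      if Bj: "B (s j, 0) \<noteq> 0" for j
    proof -
      define v where "v = (s j, 0::real)"
      define u where "u = (G ^^ j) v"
      define w where "w = (G ^^ (j + n)) v"
      have wu: "w = (G ^^ n) u" unfolding w_def u_def by (simp add: funpow_add add.commute[of j])
      have v: "v \<in> wedge" and u: "u \<in> wedge" using sw wedge_iterate(1) by (auto simp: v_def u_def)
      have wr: "supnorm w \<le> r" using end_in by (simp add: w_def v_def)
      have fw: "fst ((G ^^ n) z) = fst ((G ^^ n) u)" using s[of j] by (simp add: X_def wu[symmetric] w_def v_def)
      have "supnorm ((G ^^ n) z - w) \<le> (\<Prod>k<n. K * max (supnorm ((G ^^ k) z)) (supnorm ((G ^^ k) u))) * supnorm (z - u)"
        unfolding wu by (rule vertical_contraction[OF fw]) simp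
      also have "\<dots> \<le> (\<Prod>k<n. (1 / \<kappa>) ^ (n - Suc k)) * (2 * r)"
      proof (intro mult_mono prod_mono conjI)
        fix k assume k: "k \<in> {..<n}"
        have "K * max (supnorm ((G ^^ k) z)) (supnorm ((G ^^ k) u)) \<le> K * (r * (1 / \<kappa>) ^ (n - k))"
          using K k backward[OF z, of k] backward[OF u wr[unfolded wu], of k] by (intro mult_left_mono) auto
        also have "\<dots> = K * r * (1 / \<kappa>) ^ (n - k)" by simp
        also have "\<dots> \<le> 1 * (1 / \<kappa>) ^ (n - Suc k)"
          using Kr \<kappa> K r by (intro mult_mono power_decreasing) auto
        finally show "K * max (supnorm ((G ^^ k) z)) (supnorm ((G ^^ k) u)) \<le> (1 / \<kappa>) ^ (n - Suc k)" by simp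
        show "0 \<le> K * max (supnorm ((G ^^ k) z)) (supnorm ((G ^^ k) u))" using K by (simp add: le_max_iff_disj)
      next
        show "supnorm (z - u) \<le> 2 * r"
          using supnorm_diff_le[of z u] within[OF z, of 0] within[OF u wr[unfolded wu], of 0] by simp
      qed (use \<kappa> in \<open>auto intro: prod_nonneg\<close>)
      also have "(\<Prod>k<n. (1 / \<kappa>) ^ (n - Suc k)) = pr n"
        unfolding pr_def by (rule prod.nat_diff_reindex)
      finally have "supnorm ((G ^^ n) z - w) \<le> pr n * (2 * r)" .
      then have "m * M * supnorm ((G ^^ n) z - w) \<le> m * M * (pr n * (2 * r))"
        using m M by (intro mult_left_mono) auto
      then have d: "\<bar>A ((G ^^ n) z) - A w\<bar> \<le> m * M * (2 * r) * pr n"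
        using lipA[OF z(2) wr] by (simp add: mult_ac)
      have "P w * Q v = P v * Q w"
        unfolding w_def using within[OF v wr[unfolded w_def]] by (intro orbit_invariant[OF v])
      then have "A w * B v = A v * B w" unfolding A_def B_def by algebra
      then have "A w = A v / B v * B w" using Bj by (simp add: v_def field_simps)
      then have "\<bar>A w\<bar> = \<bar>A v / B v\<bar> * \<bar>B w\<bar>" by (metis abs_mult)
      also have "\<dots> \<le> \<bar>A v / B v\<bar> * (m * b)" using Bb[OF wr] by (intro mult_left_mono) auto
      finally show ?thesis using d unfolding v_def by linarith
    qed
    have "eventually (\<lambda>j. B (s j, 0) \<noteq> 0) sequentially"
      by (rule eventually_compose_filterlim[OF evB sfl])
    then have ev: "eventually (\<lambda>j. \<bar>A ((G ^^ n) z)\<bar> \<le> \<bar>A (s j, 0) / B (s j, 0)\<bar> * (m * b) + m * M * (2 * r) * pr n) sequentially"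
      by eventually_elim (rule bound)
    have lim: "(\<lambda>j. \<bar>A (s j, 0) / B (s j, 0)\<bar> * (m * b) + m * M * (2 * r) * pr n) \<longlonglongrightarrow> 0 + m * M * (2 * r) * pr n"
      by (intro tendsto_intros lim0)
    show ?thesis using tendsto_lowerbound[OF lim ev] by simp
  qed
  have exit_time: "\<exists>n. supnorm ((G ^^ n) z) \<le> r \<and> r / \<Lambda> \<le> supnorm ((G ^^ n) z)"
    if z: "z \<in> wedge" "supnorm z \<le> r" for z
  proof -
    obtain k where k: "\<kappa> ^ k > r / supnorm z" using real_arch_pow[OF \<kappa>] by blast
    have zw: "supnorm z > 0" using z(1) by (auto simp: supnorm_wedge wedge_def)
    have "supnorm ((G ^^ k) z) \<ge> \<kappa> ^ k * supnorm z"
      using wedge_iterate(1,2)[OF z(1), of k] z by (simp add: supnorm_wedge \<kappa>_def)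
    then have ex: "\<exists>k. supnorm ((G ^^ k) z) > r" using k zw by (intro exI[of _ k]) (simp add: field_simps)
    define l where "l = (LEAST k. supnorm ((G ^^ k) z) > r)"
    have l: "supnorm ((G ^^ l) z) > r" unfolding l_def using ex by (rule LeastI_ex)
    then obtain n where n: "l = Suc n" using z(2) by (cases l) auto
    then have "supnorm ((G ^^ n) z) \<le> r"
      using not_less_Least[of n "\<lambda>k. supnorm ((G ^^ k) z) > r"] by (auto simp: l_def[symmetric])
    moreover have "supnorm ((G ^^ l) z) \<le> \<Lambda> * supnorm ((G ^^ n) z)"
      using wedge_step(1,3)[OF wedge_iterate(1)[OF z(1), of n]] wedge_iterate(1)[OF z(1), of n]
      by (simp add: n supnorm_wedge \<Lambda>_def)
    then have "r / \<Lambda> \<le> supnorm ((G ^^ n) z)" using l \<kappa> \<Lambda> by (simp add: field_simps)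
    ultimately show ?thesis by blast
  qed
  define c where "c = sqrt (W * (2 * b\<^sup>2) / (W * \<mu>)) * (m * M * (2 * r))"
  have c0: "c \<ge> 0" unfolding c_def using W \<mu> m M r by simp
  have main: "\<bar>A z\<bar> \<le> c * pr n"
    if z: "z \<in> wedge" "supnorm z \<le> r" and n: "supnorm ((G ^^ n) z) \<le> r" "r / \<Lambda> \<le> supnorm ((G ^^ n) z)" for z n
  proof -
    let ?w = "(G ^^ n) z"
    have "P ?w * Q z = P z * Q ?w"
      using within[OF z(1) n(1)] by (intro orbit_invariant[OF z(1)])
    then have "A z * B ?w = A ?w * B z" unfolding A_def B_def by algebra
    then have eq: "(A z)\<^sup>2 * ((A ?w)\<^sup>2 + (B ?w)\<^sup>2) = (A ?w)\<^sup>2 * ((A z)\<^sup>2 + (B z)\<^sup>2)" by algebra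
    have up: "(P z)\<^sup>2 + (Q z)\<^sup>2 \<le> 2 * b\<^sup>2"
      using b(2,3)[OF z(2)] b(1) abs_le_square_iff[of "P z" b] abs_le_square_iff[of "Q z" b] by auto
    have lo: "\<mu> \<le> (P ?w)\<^sup>2 + (Q ?w)\<^sup>2" unfolding \<mu>_def using n by (intro z0(2)) (auto simp: S_def)
    have "(A z)\<^sup>2 * (W * \<mu>) \<le> (A z)\<^sup>2 * (W * ((P ?w)\<^sup>2 + (Q ?w)\<^sup>2))"
      using lo W by (intro mult_left_mono) auto
    also have "\<dots> = (A ?w)\<^sup>2 * (W * ((P z)\<^sup>2 + (Q z)\<^sup>2))" using eq unfolding AB .
    also have "\<dots> \<le> (A ?w)\<^sup>2 * (W * (2 * b\<^sup>2))"
      using up W by (intro mult_left_mono) auto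
    finally have "(A z)\<^sup>2 \<le> W * (2 * b\<^sup>2) / (W * \<mu>) * (A ?w)\<^sup>2"
      using W \<mu> by (simp add: field_simps)
    then have "sqrt ((A z)\<^sup>2) \<le> sqrt (W * (2 * b\<^sup>2) / (W * \<mu>) * (A ?w)\<^sup>2)" by (rule real_sqrt_le_mono)
    then have "\<bar>A z\<bar> \<le> sqrt (W * (2 * b\<^sup>2) / (W * \<mu>)) * \<bar>A ?w\<bar>" by (simp add: real_sqrt_mult)
    also have "\<dots> \<le> sqrt (W * (2 * b\<^sup>2) / (W * \<mu>)) * (m * M * (2 * r) * pr n)"
      using small[OF z(1) n(1)] W \<mu> by (intro mult_left_mono) auto
    finally show ?thesis by (simp add: c_def mult.assoc)
  qed
  have "\<exists>C. \<forall>z\<in>wedge. supnorm z \<le> r \<longrightarrow> \<bar>A z\<bar> \<le> C * supnorm z ^ k" for k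
  proof -
    obtain C where C: "C > 0" "\<And>n. (\<Prod>j<n. (1 / \<kappa>) ^ j) \<le> C * ((1 / \<Lambda>) ^ k) ^ n"
      using prod_powers_flat[of "1 / \<kappa>" "(1 / \<Lambda>) ^ k"] \<kappa> \<Lambda> by auto
    have "\<bar>A z\<bar> \<le> c * C * (\<Lambda> / r) ^ k * supnorm z ^ k" if z: "z \<in> wedge" "supnorm z \<le> r" for z
    proof -
      obtain n where n: "supnorm ((G ^^ n) z) \<le> r" "r / \<Lambda> \<le> supnorm ((G ^^ n) z)"
        using exit_time[OF z] by blast
      have "supnorm ((G ^^ n) z) \<le> \<Lambda> ^ n * supnorm z"
        using wedge_iterate(1,3)[OF z(1), of n] z by (simp add: supnorm_wedge \<Lambda>_def)
      then have "r / \<Lambda> \<le> \<Lambda> ^ n * supnorm z" using n by linarith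
      then have "(1 / \<Lambda>) ^ n \<le> \<Lambda> / r * supnorm z"
        using \<kappa> \<Lambda> r by (simp add: field_simps power_divide)
      then have "((1 / \<Lambda>) ^ n) ^ k \<le> (\<Lambda> / r * supnorm z) ^ k"
        using \<kappa> \<Lambda> by (intro power_mono) auto
      then have "((1 / \<Lambda>) ^ k) ^ n \<le> (\<Lambda> / r) ^ k * supnorm z ^ k"
        by (metis mult.commute power_mult power_mult_distrib)
      then have "C * ((1 / \<Lambda>) ^ k) ^ n \<le> C * ((\<Lambda> / r) ^ k * supnorm z ^ k)"
        using C by (intro mult_left_mono) auto
      then have "pr n \<le> C * ((\<Lambda> / r) ^ k * supnorm z ^ k)" using C(2)[of n] unfolding pr_def by linarith
      then have "c * pr n \<le> c * (C * ((\<Lambda> / r) ^ k * supnorm z ^ k))" using c0 by (rule mult_left_mono)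
      then show ?thesis using main[OF z n] by (simp add: mult.assoc)
    qed
    then show ?thesis by blast
  qed
  then have "(q N \<noteq> 0 \<or> - p N \<noteq> 0) \<and>
    (\<forall>k. \<exists>C. \<forall>z\<in>wedge. supnorm z \<le> r \<longrightarrow> \<bar>q N * P z + - p N * Q z\<bar> \<le> C * supnorm z ^ k)"
    using N unfolding A_def by auto
  then show ?thesis by (intro exI)
qed

end

section \<open>Expansion of an analytic function by homogeneous forms\<close>

lemma real2_norm_le: "norm (z :: real^2) \<le> \<bar>z $ 1\<bar> + \<bar>z $ 2\<bar>"
  using norm_le_l1_cart[of z] by (simp add: sum_2)

text \<open>A convergent double series has bounded terms at a point of the diagonal, which gives the
  geometric bound; absolute convergence allows summing it by forms.\<close>

lemma real_analytic2_expansion: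
  assumes "real_analytic2_on f U" "0 \<in> U"
  obtains c S r where "geo_bounded c S r"
    "\<And>z::real^2. \<bar>z $ 1\<bar> < r \<Longrightarrow> \<bar>z $ 2\<bar> < r \<Longrightarrow> f z = dseries c (z $ 1) (z $ 2)"
proof -
  have "\<exists>c \<rho>. \<rho> > 0 \<and> (\<forall>z\<in>ball 0 \<rho>.
      ((\<lambda>(i, j). c i j * (z $ 1) ^ i * (z $ 2) ^ j) has_sum f z) UNIV)"
    using bspec[OF assms(1)[unfolded real_analytic2_on_def] assms(2)] by simp
  then obtain c \<rho> where \<rho>: "\<rho> > 0" and hs: "\<And>z::real^2. z \<in> ball 0 \<rho> \<Longrightarrow>
      ((\<lambda>(i, j). c i j * (z $ 1) ^ i * (z $ 2) ^ j) has_sum f z) UNIV"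
    by blast
  define r where "r = \<rho> / 3"
  have r: "r > 0" using \<rho> by (simp add: r_def)
  have inball: "z \<in> ball 0 \<rho>" if "\<bar>z $ 1\<bar> \<le> r" "\<bar>z $ 2\<bar> \<le> r" for z :: "real^2"
    using real2_norm_le[of z] that \<rho> by (simp add: r_def)
  define w :: "real^2" where "w = (\<chi> i. r)"
  define g where "g = (\<lambda>(i, j). c i j * r ^ i * r ^ j)"
  have "(g has_sum f w) UNIV" using hs[OF inball, of w] r by (simp add: w_def g_def)
  then have sm: "(\<lambda>x. norm (g x)) summable_on UNIV"
    using has_sum_imp_summable summable_on_iff_abs_summable_on_real by blast
  define S where "S = (\<Sum>\<^sub>\<infinity>x. norm (g x))"
  have c: "geo_bounded c S r"
    unfolding geo_bounded_def
  proof (intro conjI allI)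
    fix i j
    have "sum (\<lambda>x. norm (g x)) {(i, j)} \<le> S"
      unfolding S_def by (rule finite_sum_le_infsum[OF sm]) auto
    then show "norm (c i j) * r ^ (i + j) \<le> S"
      using r by (simp add: g_def power_add abs_mult)
  qed (rule r)
  show ?thesis
  proof (rule that[OF c])
    fix z :: "real^2" assume z: "\<bar>z $ 1\<bar> < r" "\<bar>z $ 2\<bar> < r"
    define h where "h = (\<lambda>(i, j). c i j * (z $ 1) ^ i * (z $ 2) ^ j)"
    define \<phi> where "\<phi> = (\<lambda>(n, i). (i, n - i) :: nat \<times> nat)"
    have "bij_betw \<phi> (SIGMA n:UNIV. {..n}) UNIV"
      by (rule bij_betw_byWitness[where f' = "\<lambda>(i, j). (i + j, i)"]) (auto simp: \<phi>_def)
    moreover have "(h has_sum f z) UNIV" using hs[OF inball, of z] z by (simp add: h_def)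
    ultimately have "((\<lambda>x. h (\<phi> x)) has_sum f z) (SIGMA n:UNIV. {..n})"
      by (simp add: has_sum_reindex_bij_betw)
    then have "((\<lambda>n. hform c n (z $ 1) (z $ 2)) has_sum f z) UNIV"
    proof (rule has_sum_SigmaD)
      fix n :: nat
      show "((\<lambda>i. h (\<phi> (n, i))) has_sum hform c n (z $ 1) (z $ 2)) {..n}"
        unfolding hform_def h_def \<phi>_def by (rule has_sum_finiteI) auto
    qed
    then have "(\<lambda>n. hform c n (z $ 1) (z $ 2)) sums f z" by (rule has_sum_imp_sums)
    then show "f z = dseries c (z $ 1) (z $ 2)" by (simp add: dseries_def sums_iff)
  qed
qed

lemma dseries_leading_bound:
  fixes c :: "nat \<Rightarrow> nat \<Rightarrow> real"
  assumes c: "geo_bounded c S r" and low: "\<And>n x y. n < N \<Longrightarrow> hform c n x y = 0"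
  obtains C where "\<And>x y m. \<bar>x\<bar> \<le> m \<Longrightarrow> \<bar>y\<bar> \<le> m \<Longrightarrow> m \<le> r / 2 \<Longrightarrow>
    \<bar>dseries c x y - hform c N x y\<bar> \<le> C * m ^ Suc N"
proof -
  have r: "r > 0" using c by (simp add: geo_bounded_def)
  have S: "S \<ge> 0" using c by (rule geo_bounded_nonneg)
  define a where "a = (\<lambda>k. S / r ^ Suc N * (real (k + Suc N + 1) * (1 / 2) ^ k))"
  have "summable (\<lambda>n. S * (real (n + 1) * (1 / 2) ^ n))" by (rule summable_geo) auto
  then have "summable (\<lambda>k. S * (real (k + Suc N + 1) * (1 / 2) ^ (k + Suc N)))"
    by (rule summable_ignore_initial_segment)
  then have sb: "summable (\<lambda>k. 2 ^ Suc N / r ^ Suc N * (S * (real (k + Suc N + 1) * (1 / 2) ^ (k + Suc N))))"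
    by (rule summable_mult)
  have eq: "2 ^ Suc N / r ^ Suc N * (S * (real (k + Suc N + 1) * (1 / 2) ^ (k + Suc N))) = a k" for k
  proof -
    have "2 ^ Suc N * (1 / 2 :: real) ^ (k + Suc N) = (1 / 2) ^ k * (2 * (1 / 2)) ^ Suc N"
      by (simp only: power_add power_mult_distrib mult_ac)
    then have h: "2 ^ Suc N * (1 / 2 :: real) ^ (k + Suc N) = (1 / 2) ^ k" by simp
    have "2 ^ Suc N / r ^ Suc N * (S * (real (k + Suc N + 1) * (1 / 2) ^ (k + Suc N)))
      = S / r ^ Suc N * (real (k + Suc N + 1) * (2 ^ Suc N * (1 / 2) ^ (k + Suc N)))" by simp
    then show ?thesis unfolding h a_def .
  qed
  have sa: "summable a" using sb by (simp only: eq)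
  show ?thesis
  proof (rule that[of "suminf a"])
    fix x y m :: real assume m: "\<bar>x\<bar> \<le> m" "\<bar>y\<bar> \<le> m" "m \<le> r / 2"
    have m0: "m \<ge> 0" using m(1) by linarith
    have xr: "norm x < r" "norm y < r" using m r by auto
    have "(\<lambda>k. hform c (k + Suc N) x y) sums (dseries c x y - (\<Sum>n<Suc N. hform c n x y))"
      using hform_sums_dseries[OF c xr] by (subst sums_iff_shift) simp
    moreover have "(\<Sum>n<Suc N. hform c n x y) = hform c N x y" using low by simp
    ultimately have sums: "(\<lambda>k. hform c (k + Suc N) x y) sums (dseries c x y - hform c N x y)" by simp
    have term_le: "norm (hform c (k + Suc N) x y) \<le> m ^ Suc N * a k" for k
    proof -
      have "norm (hform c (k + Suc N) x y) \<le> S * (real (k + Suc N + 1) * (m / r) ^ (k + Suc N))"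
        by (rule norm_hform_le[OF c]) (use m in auto)
      also have "(m / r) ^ (k + Suc N) = (m / r) ^ k * (m ^ Suc N / r ^ Suc N)"
        by (simp only: power_add power_divide times_divide_times_eq)
      also have "\<dots> \<le> (1 / 2) ^ k * (m ^ Suc N / r ^ Suc N)"
        using m m0 r by (intro mult_right_mono power_mono) (auto simp: field_simps)
      then have "S * (real (k + Suc N + 1) * ((m / r) ^ k * (m ^ Suc N / r ^ Suc N)))
        \<le> S * (real (k + Suc N + 1) * ((1 / 2) ^ k * (m ^ Suc N / r ^ Suc N)))"
        using S by (intro mult_left_mono) auto
      also have "\<dots> = m ^ Suc N * a k" by (simp add: a_def)
      finally show ?thesis .
    qed
    have "norm (suminf (\<lambda>k. hform c (k + Suc N) x y)) \<le> (\<Sum>k. m ^ Suc N * a k)"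
      by (rule norm_suminf_le[OF term_le]) (intro summable_mult sa)
    then show "\<bar>dseries c x y - hform c N x y\<bar> \<le> suminf a * m ^ Suc N"
      unfolding suminf_mult[OF sa] sums_unique[OF sums, symmetric] real_norm_def
      by (simp only: mult.commute)
  qed
qed

text \<open>Only the values \<open>x\<close> and \<open>y\<close> of the derivative of the curve \<open>(X t, Y t)\<close> at zero enter, so that the curve
  may be the image of a ray under a map that is merely differentiable.\<close>

lemma leading_form_limit:
  fixes c :: "nat \<Rightarrow> nat \<Rightarrow> real" and X Y :: "real \<Rightarrow> real"
  assumes c: "geo_bounded c S r" and low: "\<And>n x y. n < N \<Longrightarrow> hform c n x y = 0"
    and X: "((\<lambda>t. X t / t) \<longlongrightarrow> x) (at 0)" and Y: "((\<lambda>t. Y t / t) \<longlongrightarrow> y) (at 0)"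
  shows "((\<lambda>t. dseries c (X t) (Y t) / t ^ N) \<longlongrightarrow> hform c N x y) (at 0)"
proof -
  have r: "r > 0" using c by (simp add: geo_bounded_def)
  obtain C where C: "\<And>x y m. \<bar>x\<bar> \<le> m \<Longrightarrow> \<bar>y\<bar> \<le> m \<Longrightarrow> m \<le> r / 2 \<Longrightarrow>
    \<bar>dseries c x y - hform c N x y\<bar> \<le> C * m ^ Suc N"
    using dseries_leading_bound[OF c low] by blast
  define R where "R = \<bar>x\<bar> + \<bar>y\<bar> + 1"
  have ev: "eventually (\<lambda>t. \<bar>X t / t\<bar> < R) (at 0)" "eventually (\<lambda>t. \<bar>Y t / t\<bar> < R) (at 0)"
    by (rule order_tendstoD(2)[OF tendsto_rabs[OF X]], simp add: R_def)
      (rule order_tendstoD(2)[OF tendsto_rabs[OF Y]], simp add: R_def)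
  have R: "R > 0" by (simp add: R_def add_nonneg_pos)
  have "((\<lambda>t::real. R * \<bar>t\<bar>) \<longlongrightarrow> R * \<bar>0\<bar>) (at 0)" by (intro tendsto_intros)
  then have small: "eventually (\<lambda>t. R * \<bar>t\<bar> < r / 2) (at 0)"
    using r by (intro order_tendstoD) auto
  have nz: "eventually (\<lambda>t. t \<noteq> 0) (at (0::real))" by (simp add: eventually_at_filter)
  have est: "eventually (\<lambda>t. norm (dseries c (X t) (Y t) / t ^ N - hform c N (X t / t) (Y t / t))
      \<le> C * R ^ Suc N * \<bar>t\<bar>) (at 0)"
    using ev small nz
  proof eventually_elim
    case (elim t)
    have XY: "\<bar>X t\<bar> \<le> R * \<bar>t\<bar>" "\<bar>Y t\<bar> \<le> R * \<bar>t\<bar>" using elim by (auto simp: field_simps)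
    have "hform c N (X t) (Y t) = t ^ N * hform c N (X t / t) (Y t / t)"
      using hform_scale[of c N t "X t / t" "Y t / t"] elim(4) by simp
    then have "dseries c (X t) (Y t) / t ^ N - hform c N (X t / t) (Y t / t)
        = (dseries c (X t) (Y t) - hform c N (X t) (Y t)) / t ^ N"
      using elim(4) by (simp add: field_simps)
    then have "norm (dseries c (X t) (Y t) / t ^ N - hform c N (X t / t) (Y t / t))
        = \<bar>dseries c (X t) (Y t) - hform c N (X t) (Y t)\<bar> / \<bar>t\<bar> ^ N"
      by (simp add: power_abs)
    also have "\<dots> \<le> C * (R * \<bar>t\<bar>) ^ Suc N / \<bar>t\<bar> ^ N"
      using C[OF XY] elim by (intro divide_right_mono) auto
    also have "\<dots> = C * R ^ Suc N * \<bar>t\<bar>" using elim(4) by (simp add: power_mult_distrib)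
    finally show ?case .
  qed
  have "((\<lambda>t::real. C * R ^ Suc N * \<bar>t\<bar>) \<longlongrightarrow> C * R ^ Suc N * \<bar>0\<bar>) (at 0)" by (intro tendsto_intros)
  then have "((\<lambda>t::real. C * R ^ Suc N * \<bar>t\<bar>) \<longlongrightarrow> 0) (at 0)" by simp
  from Lim_null_comparison[OF est this]
  have "((\<lambda>t. (dseries c (X t) (Y t) / t ^ N - hform c N (X t / t) (Y t / t)) + hform c N (X t / t) (Y t / t))
      \<longlongrightarrow> 0 + hform c N x y) (at 0)"
    unfolding hform_def by (intro tendsto_add tendsto_intros X Y)
  then show ?thesis by simp
qed

section \<open>Homogeneous forms in the basis of two vectors\<close>

text \<open>The restriction of a binary form to the affine line through \<open>(v1, v2)\<close> in the direction
  \<open>(u1, u2)\<close>.\<close>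

definition hpoly :: "(nat \<Rightarrow> nat \<Rightarrow> 'a::field_char_0) \<Rightarrow> nat \<Rightarrow> 'a \<Rightarrow> 'a \<Rightarrow> 'a \<Rightarrow> 'a \<Rightarrow> 'a poly" where
  "hpoly c n u1 u2 v1 v2 = (\<Sum>i\<le>n. smult (c i (n - i)) ([:v1, u1:] ^ i * [:v2, u2:] ^ (n - i)))"

lemma poly_hpoly: "poly (hpoly c n u1 u2 v1 v2) s = hform c n (v1 + s * u1) (v2 + s * u2)"
  unfolding hpoly_def hform_def by (simp add: poly_sum poly_power mult.assoc)

text \<open>A form vanishing at infinitely many points of an affine line not through the origin vanishes on that
  line, by homogeneity on almost all lines through the origin, and hence everywhere.\<close>

lemma hform_coeffs_zero:
  fixes c :: "nat \<Rightarrow> nat \<Rightarrow> 'a::field_char_0"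
  assumes det: "u1 * v2 - u2 * v1 \<noteq> 0" and inf: "infinite {s. hform c n (v1 + s * u1) (v2 + s * u2) = 0}"
    and i: "i \<le> n"
  shows "c i (n - i) = 0"
proof -
  have "hpoly c n u1 u2 v1 v2 = 0"
    using inf poly_roots_finite[of "hpoly c n u1 u2 v1 v2"] by (auto simp: poly_hpoly)
  then have zero: "hform c n (v1 + s * u1) (v2 + s * u2) = 0" for s
    using poly_hpoly[of c n u1 u2 v1 v2 s] by simp
  define \<Delta> where "\<Delta> = u1 * v2 - u2 * v1"
  have \<Delta>: "\<Delta> \<noteq> 0" using det by (simp add: \<Delta>_def)
  define R where "R = (\<Sum>i\<le>n. monom (c i (n - i)) (n - i))"
  have R: "poly R t = hform c n 1 t" for t
    unfolding R_def hform_def by (simp add: poly_sum poly_monom)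
  have root: "poly R t = 0" if "u1 * t - u2 \<noteq> 0" for t
  proof -
    \<comment> \<open>Cramer's rule for the coordinates of \<open>(1, t)\<close> in the basis.\<close>
    define \<alpha> \<beta> where "\<alpha> = (v2 - v1 * t) / \<Delta>" and "\<beta> = (u1 * t - u2) / \<Delta>"
    have \<beta>: "\<beta> \<noteq> 0" using that \<Delta> by (simp add: \<beta>_def)
    have "\<beta> * v1 + \<alpha> * u1 = 1" "\<beta> * v2 + \<alpha> * u2 = t"
      using \<Delta> unfolding \<alpha>_def \<beta>_def by (simp_all add: field_simps) (simp_all add: \<Delta>_def algebra_simps)
    then have "1 = \<beta> * (v1 + \<alpha> / \<beta> * u1)" "t = \<beta> * (v2 + \<alpha> / \<beta> * u2)" using \<beta> by (simp_all add: distrib_left)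
    then show ?thesis unfolding R using hform_scale[of c n \<beta>] zero[of "\<alpha> / \<beta>"] by (metis mult_zero_right)
  qed
  have "infinite {t. poly R t = 0}"
  proof
    assume "finite {t. poly R t = 0}"
    moreover have "UNIV \<subseteq> {t. poly R t = 0} \<union> {u2 / u1}"
    proof
      fix t show "t \<in> {t. poly R t = 0} \<union> {u2 / u1}"
      proof (cases "u1 * t - u2 = 0")
        case True
        then have "u1 \<noteq> 0" using det by auto
        then show ?thesis using True by (simp add: field_simps)
      qed (use root in auto)
    qed
    ultimately have "finite (UNIV :: 'a set)" by (meson finite.emptyI finite.insertI finite_Un finite_subset)
    then show False by (simp add: infinite_UNIV_char_0)
  qed
  then have "R = 0" using poly_roots_finite by blast
  then have "coeff R (n - i) = 0" by simp
  moreover have "coeff R (n - i) = (\<Sum>j\<in>{i}. c j (n - j))"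
    unfolding R_def coeff_sum coeff_monom using i
    by (intro sum.mono_neutral_cong_right) (auto split: if_splits)
  ultimately show ?thesis by simp
qed

section \<open>Resonance from the leading forms\<close>

lemma entire_zero_on_reals:
  assumes "f holomorphic_on UNIV" "\<And>x :: real. f (of_real x) = 0"
  shows "f z = 0"
proof (rule analytic_continuation[OF assms(1), of "\<real>" 0])
  show "(0::complex) islimpt \<real>"
    unfolding islimpt_approachable
  proof (intro allI impI)
    fix e :: real assume "e > 0"
    then show "\<exists>x\<in>\<real>. x \<noteq> (0::complex) \<and> dist x 0 < e"
      by (intro bexI[of _ "complex_of_real (e / 2)"]) auto
  qed
qed (use assms in \<open>auto elim!: Reals_cases\<close>)

lemma poly_split_zero:
  fixes p :: "complex poly"
  assumes "p \<noteq> 0"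
  obtains i p' where "\<And>s. poly p s = s ^ i * poly p' s" "poly p' 0 \<noteq> 0"
proof -
  obtain p' where p': "p = [:- 0, 1:] ^ order 0 p * p'" "\<not> [:- 0, 1:] dvd p'"
    using order_decomp[OF assms, of 0] by blast
  show ?thesis
  proof (rule that)
    show "poly p s = s ^ order 0 p * poly p' s" for s
      by (subst p'(1)) (simp add: poly_power)
    show "poly p' 0 \<noteq> 0" using p'(2) by (simp add: poly_eq_0_iff_dvd)
  qed
qed

text \<open>Compare the lowest coefficients of both sides.\<close>

lemma order_relation:
  fixes p q p' q' :: "complex poly"
  assumes p: "\<And>s. poly p s = s ^ i * poly p' s" "poly p' 0 \<noteq> 0"
    and q: "\<And>s. poly q s = s ^ j * poly q' s" "poly q' 0 \<noteq> 0"
    and id: "\<And>s. m ^ a * poly p (\<rho> * s) * poly q s = m ^ b * poly p s * poly q (\<rho> * s)"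
  shows "m ^ a * \<rho> ^ i = m ^ b * \<rho> ^ j"
proof -
  define A where "A = smult (m ^ a * \<rho> ^ i) (pcompose p' [:0, \<rho>:] * q') - smult (m ^ b * \<rho> ^ j) (p' * pcompose q' [:0, \<rho>:])"
  have A: "poly A s = m ^ a * \<rho> ^ i * poly p' (\<rho> * s) * poly q' s - m ^ b * \<rho> ^ j * poly p' s * poly q' (\<rho> * s)" for s
    by (simp add: A_def poly_pcompose mult_ac)
  have "poly A s = 0" if "s \<noteq> 0" for s
  proof -
    have "s ^ (i + j) * poly A s = m ^ a * poly p (\<rho> * s) * poly q s - m ^ b * poly p s * poly q (\<rho> * s)"
      unfolding A p q by (simp add: power_add power_mult_distrib algebra_simps)
    then show ?thesis using id[of s] that by simp
  qed
  then have "UNIV - {0} \<subseteq> {s. poly A s = 0}" by auto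
  moreover have "infinite (UNIV - {0 :: complex})" by (simp add: infinite_UNIV_char_0)
  ultimately have "infinite {s. poly A s = 0}" using finite_subset by blast
  then have "A = 0" using poly_roots_finite by blast
  then show ?thesis using A[of 0] p(2) q(2) by simp
qed

text \<open>Scaling the argument by \<open>l / m\<close> multiplies the lowest term by a power of \<open>l / m\<close>, so the identity relates powers
  of \<open>l\<close> and \<open>m\<close>. The relation is trivial only if the degrees and the orders of vanishing agree. Then a
  combination of \<open>p\<close> and \<open>q\<close> has another order and satisfies the same identity.\<close>

lemma resonance_of_polys:
  fixes p q :: "complex poly" and l m :: complex
  assumes pq: "p \<noteq> 0" "q \<noteq> 0" and lm: "l \<noteq> 0" "m \<noteq> 0"
    and id: "\<And>s. m ^ a * poly p (l / m * s) * poly q s = m ^ b * poly p s * poly q (l / m * s)"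
    and ind: "a \<noteq> b \<or> (\<forall>k. p \<noteq> smult k q)"
  shows "\<exists>p q :: int. (p, q) \<noteq> (0, 0) \<and> l powi p * m powi q = 1"
proof -
  have final: "\<exists>p q :: int. (p, q) \<noteq> (0, 0) \<and> l powi p * m powi q = 1"
    if eq: "m ^ a * (l / m) ^ i = m ^ b * (l / m) ^ j" and ne: "a \<noteq> b \<or> i \<noteq> j" for i j
  proof (intro exI conjI)
    show "(int i - int j, int a - int i - (int b - int j)) \<noteq> (0, 0)" using ne by auto
    have "l powi (int i - int j) * m powi (int a - int i - (int b - int j))
        = (l ^ i / l ^ j) * ((m ^ a / m ^ i) / (m ^ b / m ^ j))"
      using lm by (simp add: power_int_diff)
    also have "\<dots> = (m ^ a * (l / m) ^ i) / (m ^ b * (l / m) ^ j)"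
      using lm by (simp add: power_divide field_simps)
    also have "\<dots> = 1" unfolding eq using lm by simp
    finally show "l powi (int i - int j) * m powi (int a - int i - (int b - int j)) = 1" .
  qed
  obtain i p' where p: "\<And>s. poly p s = s ^ i * poly p' s" "poly p' 0 \<noteq> 0"
    using poly_split_zero[OF pq(1)] by blast
  obtain j q' where q: "\<And>s. poly q s = s ^ j * poly q' s" "poly q' 0 \<noteq> 0"
    using poly_split_zero[OF pq(2)] by blast
  show ?thesis
  proof (cases "a \<noteq> b \<or> i \<noteq> j")
    case True
    from final[OF order_relation[OF p q id] this] show ?thesis .
  next
    case False
    \<comment> \<open>Cancelling the lowest coefficient raises the order of \<open>p\<close>.\<close>
    define k where "k = poly p' 0 / poly q' 0"
    define p2 where "p2 = p - smult k q"
    have "p2 \<noteq> 0" using ind False by (auto simp: p2_def)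
    then obtain i2 p2' where p2: "\<And>s. poly p2 s = s ^ i2 * poly p2' s" "poly p2' 0 \<noteq> 0"
      using poly_split_zero by blast
    have id2: "m ^ a * poly p2 (l / m * s) * poly q s = m ^ b * poly p2 s * poly q (l / m * s)" for s
      using id[of s] False unfolding p2_def by (simp add: algebra_simps)
    have "i2 \<noteq> j"
    proof
      assume "i2 = j"
      define A where "A = p2' - (p' - smult k q')"
      have "poly A s = 0" if "s \<noteq> 0" for s
      proof -
        have "s ^ j * poly A s = 0"
          using p2(1)[of s] p(1)[of s] q(1)[of s] False \<open>i2 = j\<close> unfolding A_def p2_def
          by (simp add: algebra_simps)
        then show ?thesis using that by simp
      qed
      then have "UNIV - {0} \<subseteq> {s. poly A s = 0}" by auto
      moreover have "infinite (UNIV - {0 :: complex})" by (simp add: infinite_UNIV_char_0)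
      ultimately have "infinite {s. poly A s = 0}" using finite_subset by blast
      then have "A = 0" using poly_roots_finite by blast
      then have "poly p2' 0 = poly p' 0 - k * poly q' 0" using arg_cong[of A 0 "\<lambda>f. poly f 0"] by (simp add: A_def)
      then show False using p2(2) q(2) by (simp add: k_def)
    qed
    then have "a \<noteq> b \<or> i2 \<noteq> j" by simp
    from final[OF order_relation[OF p2 q id2] this] show ?thesis .
  qed
qed

definition leading_degree :: "(nat \<Rightarrow> nat \<Rightarrow> 'a::comm_ring_1) \<Rightarrow> nat \<Rightarrow> bool" where
  "leading_degree c N \<longleftrightarrow> (\<forall>n<N. \<forall>i\<le>n. c i (n - i) = 0) \<and> (\<exists>i\<le>N. c i (N - i) \<noteq> 0)"

lemma leading_degree_exists:
  assumes "c i j \<noteq> 0"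
  obtains N where "leading_degree c N"
proof -
  let ?P = "\<lambda>n. \<exists>i\<le>n. c i (n - i) \<noteq> 0"
  have "?P (i + j)" using assms by (intro exI[of _ i]) simp
  then have "?P (LEAST n. ?P n)" by (rule LeastI)
  moreover have "\<forall>n<(LEAST n. ?P n). \<forall>i\<le>n. c i (n - i) = 0" using not_less_Least by blast
  ultimately show ?thesis by (intro that[of "LEAST n. ?P n"]) (auto simp: leading_degree_def)
qed

lemma leading_degree_low: "leading_degree c N \<Longrightarrow> n < N \<Longrightarrow> hform c n x y = 0"
  unfolding leading_degree_def hform_def by (intro sum.neutral) auto

text \<open>If the leading forms are proportional, subtracting a multiple of the denominator from the numerator
  raises the degree of the leading form of the numerator. The invariance relation is not affected.\<close>

lemma leading_pair:
  fixes c d :: "nat \<Rightarrow> nat \<Rightarrow> real"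
  assumes "\<And>a b. a \<noteq> 0 \<or> b \<noteq> 0 \<Longrightarrow> \<exists>i j. a * c i j + b * d i j \<noteq> 0"
  obtains k a b where "leading_degree (\<lambda>i j. 1 * c i j + k * d i j) a" "leading_degree d b"
    "a \<noteq> b \<or> (\<forall>k'. \<exists>i\<le>a. 1 * c i (a - i) + k * d i (a - i) \<noteq> k' * d i (a - i))"
proof -
  have ex: "\<exists>N. leading_degree (\<lambda>i j. s * c i j + t * d i j) N" if "s \<noteq> 0 \<or> t \<noteq> 0" for s t
  proof -
    obtain i j where "s * c i j + t * d i j \<noteq> 0" using assms \<open>s \<noteq> 0 \<or> t \<noteq> 0\<close> by blast
    then show ?thesis by (rule leading_degree_exists[where c = "\<lambda>i j. s * c i j + t * d i j"]) blast
  qed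
  obtain b where b: "leading_degree d b" using ex[of 0 1] by auto
  obtain a where a: "leading_degree (\<lambda>i j. 1 * c i j + 0 * d i j) a" using ex[of 1 0, OF disjI1[OF one_neq_zero]] by blast
  show ?thesis
  proof (cases "a \<noteq> b \<or> (\<forall>k'. \<exists>i\<le>a. 1 * c i (a - i) + 0 * d i (a - i) \<noteq> k' * d i (a - i))")
    case True
    then show ?thesis using that[OF a b] by blast
  next
    case False
    then obtain k' where k': "a = b" "\<And>i. i \<le> a \<Longrightarrow> c i (a - i) = k' * d i (a - i)" by auto
    let ?e = "\<lambda>i j. 1 * c i j + (- k') * d i j"
    obtain a' where a': "leading_degree ?e a'"
      using ex[of 1 "- k'", OF disjI1[OF one_neq_zero]] by blast
    have "?e i (n - i) = 0" if "n \<le> a" "i \<le> n" for n i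
    proof (cases "n = a")
      case True
      then show ?thesis using k'(2) that by simp
    next
      case ne: False
      then have "c i (n - i) = 0" "d i (n - i) = 0" using a b k'(1) that by (auto simp: leading_degree_def)
      then show ?thesis by simp
    qed
    then have "\<not> a' \<le> a" using a' by (auto simp: leading_degree_def)
    then show ?thesis using that[OF a' b] k'(1) by auto
  qed
qed

text \<open>The leading forms inherit the invariance relation under the linear part \<open>J\<close>. As a polynomial identity it
  extends to complex arguments. On the line \<open>v + s u\<close> in an eigenbasis the map \<open>J\<close> acts, up to the factor
  \<open>m\<close>, as \<open>s \<mapsto> (l / m) s\<close>.\<close>

lemma linear_resonance:
  fixes c d :: "nat \<Rightarrow> nat \<Rightarrow> real" and F1 F2 :: "real \<Rightarrow> real \<Rightarrow> real" and l m :: complex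
  assumes c: "geo_bounded c S r" and d: "geo_bounded d T r"
    and nontriv: "\<And>a b. a \<noteq> 0 \<or> b \<noteq> 0 \<Longrightarrow> \<exists>i j. a * c i j + b * d i j \<noteq> 0"
    and F1: "\<And>x y. ((\<lambda>t. F1 (t * x) (t * y) / t) \<longlongrightarrow> J11 * x + J12 * y) (at 0)"
    and F2: "\<And>x y. ((\<lambda>t. F2 (t * x) (t * y) / t) \<longlongrightarrow> J21 * x + J22 * y) (at 0)"
    and inv: "\<And>x y. eventually (\<lambda>t.
      dseries c (F1 (t * x) (t * y)) (F2 (t * x) (t * y)) * dseries d (t * x) (t * y) =
      dseries c (t * x) (t * y) * dseries d (F1 (t * x) (t * y)) (F2 (t * x) (t * y))) (at 0)"
    and e1: "of_real J11 * u1 + of_real J12 * u2 = l * u1" "of_real J21 * u1 + of_real J22 * u2 = l * u2"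
    and e2: "of_real J11 * v1 + of_real J12 * v2 = m * v1" "of_real J21 * v1 + of_real J22 * v2 = m * v2"
    and det: "u1 * v2 - u2 * v1 \<noteq> 0" and lm: "l \<noteq> 0" "m \<noteq> 0"
  shows "\<exists>p q :: int. (p, q) \<noteq> (0, 0) \<and> l powi p * m powi q = 1"
proof -
  have r: "r > 0" using c by (simp add: geo_bounded_def)
  obtain k a b where lead: "leading_degree (\<lambda>i j. 1 * c i j + k * d i j) a" "leading_degree d b"
    and ind: "a \<noteq> b \<or> (\<forall>k'. \<exists>i\<le>a. 1 * c i (a - i) + k * d i (a - i) \<noteq> k' * d i (a - i))"
    using leading_pair[OF nontriv] by blast
  define e where "e = (\<lambda>i j. 1 * c i j + k * d i j)"
  have e: "geo_bounded e (norm (1::real) * S + norm k * T) r" unfolding e_def by (rule geo_bounded_lincomb[OF c d])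
  note lead_e = leading_degree_low[OF lead(1), folded e_def] and lead_d = leading_degree_low[OF lead(2)]
  have real_id: "hform e a (J11 * x + J12 * y) (J21 * x + J22 * y) * hform d b x y
    = hform e a x y * hform d b (J11 * x + J12 * y) (J21 * x + J22 * y)" for x y
  proof -
    let ?X = "\<lambda>t. F1 (t * x) (t * y)" and ?Y = "\<lambda>t. F2 (t * x) (t * y)"
    have nz: "eventually (\<lambda>t. t \<noteq> 0) (at (0::real))" by (simp add: eventually_at_filter)
    have lin: "((\<lambda>t. t * w / t) \<longlongrightarrow> w) (at 0)" for w :: real
      by (rule Lim_transform_eventually[OF tendsto_const]) (use nz in eventually_elim, simp)
    have to0: "((\<lambda>t. f t) \<longlongrightarrow> 0) (at 0)" if "((\<lambda>t. f t / t) \<longlongrightarrow> w) (at 0)" for f :: "real \<Rightarrow> real" and w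
    proof -
      have "((\<lambda>t. f t / t * t) \<longlongrightarrow> w * 0) (at 0)" by (intro tendsto_mult that tendsto_ident_at)
      then have "((\<lambda>t. f t / t * t) \<longlongrightarrow> 0) (at 0)" by simp
      then show ?thesis by (rule Lim_transform_eventually) (use nz in eventually_elim, simp)
    qed
    have smallf: "eventually (\<lambda>t. \<bar>f t\<bar> < r) (at 0)" if "((\<lambda>t. f t / t) \<longlongrightarrow> w) (at 0)" for f :: "real \<Rightarrow> real" and w
      using to0[OF that] r by (intro order_tendstoD(2)[OF tendsto_rabs_zero]) auto
    have L1: "((\<lambda>t. dseries e (?X t) (?Y t) / t ^ a * (dseries d (t * x) (t * y) / t ^ b)) \<longlongrightarrow>
        hform e a (J11 * x + J12 * y) (J21 * x + J22 * y) * hform d b x y) (at 0)"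
      by (intro tendsto_mult leading_form_limit[OF e lead_e] leading_form_limit[OF d lead_d] F1 F2 lin)
    have L2: "((\<lambda>t. dseries e (t * x) (t * y) / t ^ a * (dseries d (?X t) (?Y t) / t ^ b)) \<longlongrightarrow>
        hform e a x y * hform d b (J11 * x + J12 * y) (J21 * x + J22 * y)) (at 0)"
      by (intro tendsto_mult leading_form_limit[OF e lead_e] leading_form_limit[OF d lead_d] F1 F2 lin)
    have ev: "eventually (\<lambda>t. dseries e (?X t) (?Y t) / t ^ a * (dseries d (t * x) (t * y) / t ^ b) =
        dseries e (t * x) (t * y) / t ^ a * (dseries d (?X t) (?Y t) / t ^ b)) (at 0)"
      using inv[of x y] smallf[OF F1[of x y]] smallf[OF F2[of x y]] smallf[OF lin[of x]] smallf[OF lin[of y]]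
    proof eventually_elim
      case (elim t)
      have "dseries e (?X t) (?Y t) = 1 * dseries c (?X t) (?Y t) + k * dseries d (?X t) (?Y t)"
        "dseries e (t * x) (t * y) = 1 * dseries c (t * x) (t * y) + k * dseries d (t * x) (t * y)"
        unfolding e_def by (rule dseries_lincomb[OF c d]; use elim in simp)+
      then have "dseries e (?X t) (?Y t) * dseries d (t * x) (t * y) = dseries e (t * x) (t * y) * dseries d (?X t) (?Y t)"
        using elim(1) by (simp add: algebra_simps)
      then show ?case by simp
    qed
    show ?thesis
      by (rule tendsto_unique[OF _ Lim_transform_eventually[OF L1 ev] L2]) simp
  qed
  define ec dc where "ec = (\<lambda>i j. complex_of_real (e i j))" and "dc = (\<lambda>i j. complex_of_real (d i j))"
  define I where "I = (\<lambda>x y. hform ec a (of_real J11 * x + of_real J12 * y) (of_real J21 * x + of_real J22 * y) * hform dc b x y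
    - hform ec a x y * hform dc b (of_real J11 * x + of_real J12 * y) (of_real J21 * x + of_real J22 * y))"
  have I0: "I (of_real x) (of_real y) = 0" for x y
  proof -
    have arg: "complex_of_real J11 * of_real x + of_real J12 * of_real y = of_real (J11 * x + J12 * y)"
      "complex_of_real J21 * of_real x + of_real J22 * of_real y = of_real (J21 * x + J22 * y)" by simp_all
    show ?thesis unfolding I_def arg ec_def dc_def hform_of_real
      using real_id[of x y] by (simp flip: of_real_mult)
  qed
  have "(\<lambda>x. I x y) holomorphic_on UNIV" "(\<lambda>y. I x y) holomorphic_on UNIV" for x y
    unfolding I_def hform_def by (intro holomorphic_intros)+
  note hol = this
  have Ireal: "I x (of_real y) = 0" for x y
    by (rule entire_zero_on_reals[OF hol(1) I0])
  have I: "I x y = 0" for x y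
    by (rule entire_zero_on_reals[OF hol(2) Ireal])
  define p where "p = hpoly ec a u1 u2 v1 v2"
  define q where "q = hpoly dc b u1 u2 v1 v2"
  have nonzero: "hpoly f n u1 u2 v1 v2 \<noteq> 0" if "i \<le> n" "f i (n - i) \<noteq> 0" for f :: "nat \<Rightarrow> nat \<Rightarrow> complex" and n i
  proof
    assume "hpoly f n u1 u2 v1 v2 = 0"
    then have "{s. hform f n (v1 + s * u1) (v2 + s * u2) = 0} = UNIV" by (auto simp flip: poly_hpoly)
    then have "infinite {s. hform f n (v1 + s * u1) (v2 + s * u2) = 0}" by (simp add: infinite_UNIV_char_0)
    from hform_coeffs_zero[OF det this that(1)] show False using that(2) by simp
  qed
  have image: "of_real J11 * (v1 + s * u1) + of_real J12 * (v2 + s * u2) = m * (v1 + l / m * s * u1)"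
    "of_real J21 * (v1 + s * u1) + of_real J22 * (v2 + s * u2) = m * (v2 + l / m * s * u2)" for s
  proof -
    have "of_real J11 * (v1 + s * u1) + of_real J12 * (v2 + s * u2)
      = (of_real J11 * v1 + of_real J12 * v2) + s * (of_real J11 * u1 + of_real J12 * u2)"
      "of_real J21 * (v1 + s * u1) + of_real J22 * (v2 + s * u2)
      = (of_real J21 * v1 + of_real J22 * v2) + s * (of_real J21 * u1 + of_real J22 * u2)"
      by (simp_all add: algebra_simps)
    then show "of_real J11 * (v1 + s * u1) + of_real J12 * (v2 + s * u2) = m * (v1 + l / m * s * u1)"
      "of_real J21 * (v1 + s * u1) + of_real J22 * (v2 + s * u2) = m * (v2 + l / m * s * u2)"
      unfolding e1 e2 using lm by (simp_all add: field_simps)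
  qed
  show ?thesis
  proof (rule resonance_of_polys[of p q l m a b])
    obtain i where "i \<le> a" "e i (a - i) \<noteq> 0" using lead(1) unfolding leading_degree_def e_def by blast
    then show "p \<noteq> 0" using nonzero[of i a ec] by (simp add: p_def ec_def)
    obtain i where "i \<le> b" "d i (b - i) \<noteq> 0" using lead(2) unfolding leading_degree_def by blast
    then show "q \<noteq> 0" using nonzero[of i b dc] by (simp add: q_def dc_def)
    show "m ^ a * poly p (l / m * s) * poly q s = m ^ b * poly p s * poly q (l / m * s)" for s
      using I[of "v1 + s * u1" "v2 + s * u2"]
      unfolding I_def image hform_scale p_def q_def poly_hpoly by (simp add: algebra_simps)
    show "a \<noteq> b \<or> (\<forall>k. p \<noteq> smult k q)"
    proof (rule disjCI)
      assume "\<not> (\<forall>k. p \<noteq> smult k q)"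
      then obtain \<kappa> where \<kappa>: "p = smult \<kappa> q" by blast
      show "a \<noteq> b"
      proof
        assume ab: "a = b"
        have "ec i (a - i) + (- \<kappa>) * dc i (a - i) = 0" if "i \<le> a" for i
        proof -
          have "hform (\<lambda>i j. 1 * ec i j + (- \<kappa>) * dc i j) a (v1 + s * u1) (v2 + s * u2) = 0" for s
            unfolding hform_lincomb using arg_cong[OF \<kappa>, of "\<lambda>f. poly f s"]
            by (simp add: p_def q_def poly_hpoly ab)
          then have "infinite {s. hform (\<lambda>i j. 1 * ec i j + (- \<kappa>) * dc i j) a (v1 + s * u1) (v2 + s * u2) = 0}"
            by (simp add: infinite_UNIV_char_0)
          from hform_coeffs_zero[OF det this that] show ?thesis by simp
        qed
        then have "complex_of_real (e i (a - i)) = \<kappa> * of_real (d i (a - i))" if "i \<le> a" for i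
          using that unfolding ec_def dc_def by (metis add_eq_0_iff minus_mult_minus minus_minus mult_minus_left)
        then have "e i (a - i) = Re \<kappa> * d i (a - i)" if "i \<le> a" for i
          using that arg_cong[of "complex_of_real (e i (a - i))" _ Re] by fastforce
        then show False using ind ab unfolding e_def by blast
      qed
    qed
  qed (use lm in auto)
qed

section \<open>Eigenvalues and eigenvectors of a two by two matrix\<close>

lemma eigenvalues2_trace_det:
  assumes "eigenvalues2 A l m"
  shows "l + m = A $ 1 $ 1 + A $ 2 $ 2" "l * m = A $ 1 $ 1 * A $ 2 $ 2 - A $ 1 $ 2 * A $ 2 $ 1"
proof -
  have "charpoly A = [:A $ 1 $ 1 * A $ 2 $ 2 - A $ 1 $ 2 * A $ 2 $ 1, - (A $ 1 $ 1 + A $ 2 $ 2), 1:]"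
    unfolding charpoly_def det_2 by simp
  moreover have "charpoly A = [:l * m, - (l + m), 1:]"
    using assms unfolding eigenvalues2_def by simp
  ultimately have "[:l * m, - (l + m), 1:] = [:A $ 1 $ 1 * A $ 2 $ 2 - A $ 1 $ 2 * A $ 2 $ 1, - (A $ 1 $ 1 + A $ 2 $ 2), 1:]"
    by simp
  then have "l * m = A $ 1 $ 1 * A $ 2 $ 2 - A $ 1 $ 2 * A $ 2 $ 1" "- (l + m) = - (A $ 1 $ 1 + A $ 2 $ 2)"
    by (simp_all only: pCons_eq_iff)
  then show "l + m = A $ 1 $ 1 + A $ 2 $ 2" "l * m = A $ 1 $ 1 * A $ 2 $ 2 - A $ 1 $ 2 * A $ 2 $ 1"
    by (simp_all only: neg_equal_iff_equal)
qed

lemma diagonalizable_eigenbasis: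
  fixes A :: "'a::field ^ 2 ^ 2"
  assumes "diagonalizable A" "eigenvalues2 A l m"
  obtains u1 u2 v1 v2 where
    "A $ 1 $ 1 * u1 + A $ 1 $ 2 * u2 = l * u1" "A $ 2 $ 1 * u1 + A $ 2 $ 2 * u2 = l * u2"
    "A $ 1 $ 1 * v1 + A $ 1 $ 2 * v2 = m * v1" "A $ 2 $ 1 * v1 + A $ 2 $ 2 * v2 = m * v2"
    "u1 * v2 - u2 * v1 \<noteq> 0"
proof -
  obtain S D :: "'a ^ 2 ^ 2" where S: "invertible S" and D: "\<forall>i j. i \<noteq> j \<longrightarrow> D $ i $ j = 0"
    and A: "A = S ** D ** matrix_inv S"
    using assms(1) unfolding diagonalizable_def by blast
  have inv: "matrix_inv S ** S = mat 1" 
    using someI_ex[OF S[unfolded invertible_def]] unfolding matrix_inv_def by blast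
  have AS: "A ** S = S ** D" unfolding A by (simp add: matrix_mul_assoc[symmetric] inv)
  have D0: "D $ 1 $ 2 = 0" "D $ 2 $ 1 = 0" using D by auto
  have det: "S $ 1 $ 1 * S $ 2 $ 2 - S $ 1 $ 2 * S $ 2 $ 1 \<noteq> 0"
    using S by (simp add: invertible_det_nz det_2)
  have eq: "(A ** S) $ i $ j = (S ** D) $ i $ j" for i j using AS by simp
  have col: "A $ i $ 1 * S $ 1 $ j + A $ i $ 2 * S $ 2 $ j = D $ j $ j * S $ i $ j" for i j
    using eq[of i j] exhaust_2[of j] D0 by (auto simp: matrix_matrix_mult_def sum_2 mult.commute)
  have "trace A = trace (matrix_inv S ** (S ** D))" unfolding A by (rule trace_mul_sym)
  then have "trace A = trace D" by (simp add: matrix_mul_assoc inv)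
  then have tr: "l + m = D $ 1 $ 1 + D $ 2 $ 2"
    using eigenvalues2_trace_det(1)[OF assms(2)] by (simp add: trace_def sum_2)
  have "det A * det S = det S * det D" using AS by (metis det_mul)
  then have "det A = det D" using det by (simp add: det_2)
  then have "l * m = D $ 1 $ 1 * D $ 2 $ 2"
    using eigenvalues2_trace_det(2)[OF assms(2)] D0 by (simp add: det_2)
  then have "(D $ 1 $ 1 - l) * (D $ 1 $ 1 - m) = 0" using tr by algebra
  then have "D $ 1 $ 1 = l \<and> D $ 2 $ 2 = m \<or> D $ 1 $ 1 = m \<and> D $ 2 $ 2 = l" using tr by auto
  then show ?thesis
  proof
    assume *: "D $ 1 $ 1 = l \<and> D $ 2 $ 2 = m"
    show ?thesis
      by (rule that[of "S $ 1 $ 1" "S $ 2 $ 1" "S $ 1 $ 2" "S $ 2 $ 2"])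
        (use col[of 1 1] col[of 1 2] col[of 2 1] col[of 2 2] * det in \<open>simp_all add: mult.commute\<close>)
  next
    assume *: "D $ 1 $ 1 = m \<and> D $ 2 $ 2 = l"
    show ?thesis
      by (rule that[of "S $ 1 $ 2" "S $ 2 $ 2" "S $ 1 $ 1" "S $ 2 $ 1"])
        (use col[of 1 1] col[of 1 2] col[of 2 1] col[of 2 2] * det in \<open>simp_all add: mult.commute\<close>)
  qed
qed

text \<open>The real or the imaginary part of a complex eigenvector is a real one.\<close>

lemma real_eigenvector:
  fixes a11 a12 a21 a22 k :: real and u1 u2 :: complex
  assumes "of_real a11 * u1 + of_real a12 * u2 = of_real k * u1"
    "of_real a21 * u1 + of_real a22 * u2 = of_real k * u2" "u1 \<noteq> 0 \<or> u2 \<noteq> 0"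
  obtains x1 x2 where "a11 * x1 + a12 * x2 = k * x1" "a21 * x1 + a22 * x2 = k * x2" "x1 \<noteq> 0 \<or> x2 \<noteq> 0"
proof (cases "Re u1 \<noteq> 0 \<or> Re u2 \<noteq> 0")
  case True
  then show ?thesis
    using arg_cong[OF assms(1), of Re] arg_cong[OF assms(2), of Re] by (intro that[of "Re u1" "Re u2"]) auto
next
  case False
  then have "Im u1 \<noteq> 0 \<or> Im u2 \<noteq> 0" using assms(3) by (auto simp: complex_eq_iff)
  then show ?thesis
    using arg_cong[OF assms(1), of Im] arg_cong[OF assms(2), of Im] by (intro that[of "Im u1" "Im u2"]) auto
qed

section \<open>First integrals near the origin\<close>

text \<open>Since the quotient is not constant near the origin, no nontrivial combination of the two
  expansions vanishes; in particular both are nonzero.\<close>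

lemma first_integral_expansions:
  assumes H: "meromorphic_first_integral U F P Q" and U: "open U" "0 \<in> U"
  obtains c d S T r where "geo_bounded c S r" "geo_bounded d T r"
    "\<And>z::real^2. \<bar>z $ 1\<bar> < r \<Longrightarrow> \<bar>z $ 2\<bar> < r \<Longrightarrow> z \<in> U \<and> P z = dseries c (z $ 1) (z $ 2) \<and> Q z = dseries d (z $ 1) (z $ 2)"
    "\<And>a b. a \<noteq> 0 \<or> b \<noteq> 0 \<Longrightarrow> \<exists>i j. a * c i j + b * d i j \<noteq> 0"
proof -
  have PQ: "real_analytic2_on P U" "real_analytic2_on Q U"
    and nc: "\<And>V. open V \<Longrightarrow> 0 \<in> V \<Longrightarrow> V \<subseteq> U \<Longrightarrow> \<not> (\<lambda>z. P z / Q z) constant_on {z\<in>V. Q z \<noteq> 0}"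
    using H unfolding meromorphic_first_integral_def meromorphic2_on_def by blast+
  obtain c S r1 where c: "geo_bounded c S r1"
    "\<And>z::real^2. \<bar>z $ 1\<bar> < r1 \<Longrightarrow> \<bar>z $ 2\<bar> < r1 \<Longrightarrow> P z = dseries c (z $ 1) (z $ 2)"
    using real_analytic2_expansion[OF PQ(1) U(2)] by blast
  obtain d T r2 where d: "geo_bounded d T r2"
    "\<And>z::real^2. \<bar>z $ 1\<bar> < r2 \<Longrightarrow> \<bar>z $ 2\<bar> < r2 \<Longrightarrow> Q z = dseries d (z $ 1) (z $ 2)"
    using real_analytic2_expansion[OF PQ(2) U(2)] by blast
  obtain \<rho> where \<rho>: "\<rho> > 0" "ball 0 \<rho> \<subseteq> U" using U by (meson open_contains_ball)
  define r where "r = min (\<rho> / 2) (min r1 r2)"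
  have r: "r > 0" using \<rho> c(1) d(1) by (auto simp: r_def geo_bounded_def)
  note cr = geo_bounded_smaller[OF c(1) r] and dr = geo_bounded_smaller[OF d(1) r]
  have exp: "z \<in> U \<and> P z = dseries c (z $ 1) (z $ 2) \<and> Q z = dseries d (z $ 1) (z $ 2)"
    if z: "\<bar>z $ 1\<bar> < r" "\<bar>z $ 2\<bar> < r" for z :: "real^2"
  proof -
    have "norm z < \<rho>" using real2_norm_le[of z] z unfolding r_def by linarith
    then show ?thesis using \<rho>(2) c(2)[of z] d(2)[of z] z by (auto simp: r_def)
  qed
  have cr': "geo_bounded c S r" and dr': "geo_bounded d T r" using cr dr by (auto simp: r_def)
  show ?thesis
  proof (rule that[OF cr' dr' exp])
    fix a b :: real assume ab: "a \<noteq> 0 \<or> b \<noteq> 0"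
    show "\<exists>i j. a * c i j + b * d i j \<noteq> 0"
    proof (rule ccontr)
      assume "\<nexists>i j. a * c i j + b * d i j \<noteq> 0"
      then have zero: "(\<lambda>i j. a * c i j + b * d i j) = (\<lambda>i j. 0)" by simp
      define V where "V = {z :: real^2. \<bar>z $ 1\<bar> < r \<and> \<bar>z $ 2\<bar> < r}"
      have V: "open V" "0 \<in> V" "V \<subseteq> U" using r exp
        by (auto simp: V_def intro!: open_Collect_conj open_Collect_less continuous_intros)
      have comb: "a * P z + b * Q z = 0" if "z \<in> V" for z
      proof -
        have z: "norm (z $ 1) < r" "norm (z $ 2) < r" using that by (auto simp: V_def)
        have "a * P z + b * Q z = dseries (\<lambda>i j. a * c i j + b * d i j) (z $ 1) (z $ 2)"
          using exp[of z] that dseries_lincomb[OF cr' dr' z] by (auto simp: V_def)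
        then show ?thesis unfolding zero by (simp add: dseries_def hform_def)
      qed
      have "P z / Q z = - b / a" if "z \<in> {z\<in>V. Q z \<noteq> 0}" for z
      proof -
        have *: "a * P z + b * Q z = 0" "Q z \<noteq> 0" using comb that by auto
        then have "a \<noteq> 0" using ab by auto
        have "a * P z = - b * Q z" using *(1) by linarith
        then show ?thesis using * \<open>a \<noteq> 0\<close> by (simp add: field_simps)
      qed
      then have "(\<lambda>z. P z / Q z) constant_on {z\<in>V. Q z \<noteq> 0}" unfolding constant_on_def by blast
      then show False using nc[OF V] by blast
    qed
  qed
qed

lemma C2_on_derivative_jacobian:
  fixes F :: "real^2 \<Rightarrow> real^2"
  assumes "C2_on F U" "0 \<in> U"
  shows "(F has_derivative (\<lambda>h. jacobian F (at 0) *v h)) (at 0)"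
proof -
  have "F differentiable (at 0)" using assms unfolding C2_on_def differentiable_def by blast
  then show ?thesis by (rule iffD1[OF jacobian_works])
qed

lemma directional_limit:
  fixes F :: "real^2 \<Rightarrow> real^2"
  assumes "(F has_derivative (\<lambda>h. A *v h)) (at 0)" "F 0 = 0"
  shows "((\<lambda>t. F (vector [t * x, t * y]) $ i / t) \<longlongrightarrow> A $ i $ 1 * x + A $ i $ 2 * y) (at 0)"
proof -
  define w :: "real^2" where "w = vector [x, y]"
  have tw: "t *\<^sub>R w = vector [t * x, t * y]" for t
    by (simp add: vec_eq_iff forall_2 w_def)
  have "((\<lambda>t. t *\<^sub>R w) has_derivative (\<lambda>t. t *\<^sub>R w)) (at 0)"
    by (auto intro!: derivative_eq_intros)
  then have "((\<lambda>t. F (t *\<^sub>R w)) has_derivative (\<lambda>t. A *v (t *\<^sub>R w))) (at 0)"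
    using has_derivative_compose[of "\<lambda>t. t *\<^sub>R w" _ 0 UNIV F] assms(1) by simp
  then have "((\<lambda>t. F (t *\<^sub>R w) $ i) has_derivative (\<lambda>t. (A *v (t *\<^sub>R w)) $ i)) (at 0)"
    by (rule has_derivative_compose) (rule bounded_linear_imp_has_derivative[OF bounded_linear_vec_nth])
  moreover have "(\<lambda>t. (A *v (t *\<^sub>R w)) $ i) = (*) (A $ i $ 1 * x + A $ i $ 2 * y)"
    by (auto simp: fun_eq_iff matrix_vector_mult_def sum_2 w_def algebra_simps)
  ultimately have "((\<lambda>t. F (t *\<^sub>R w) $ i) has_field_derivative (A $ i $ 1 * x + A $ i $ 2 * y)) (at 0)"
    by (simp add: has_field_derivative_def)
  then show ?thesis using assms(2) by (simp add: DERIV_def tw[symmetric])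
qed

lemma invertible_derivative_resonance:
  fixes F :: "real^2 \<Rightarrow> real^2" and A :: "real^2^2" and l m :: complex
  assumes H: "meromorphic_first_integral U F P Q" and U: "open U" "0 \<in> U"
    and F: "(F has_derivative (\<lambda>h. A *v h)) (at 0)" "F 0 = 0"
    and A: "diagonalizable (complex_matrix A)" "eigenvalues2 (complex_matrix A) l m"
    and lm: "l \<noteq> 0" "m \<noteq> 0"
  shows "\<exists>p q :: int. (p, q) \<noteq> (0, 0) \<and> l powi p * m powi q = 1"
proof -
  obtain c d S T r where c: "geo_bounded c S r" and d: "geo_bounded d T r"
    and exp: "\<And>z::real^2. \<bar>z $ 1\<bar> < r \<Longrightarrow> \<bar>z $ 2\<bar> < r \<Longrightarrow> z \<in> U \<and> P z = dseries c (z $ 1) (z $ 2) \<and> Q z = dseries d (z $ 1) (z $ 2)"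
    and nontriv: "\<And>a b. a \<noteq> 0 \<or> b \<noteq> 0 \<Longrightarrow> \<exists>i j. a * c i j + b * d i j \<noteq> 0"
    by (rule first_integral_expansions[OF H U]) blast
  have r: "r > 0" using c by (simp add: geo_bounded_def)
  obtain u1 u2 v1 v2 where uv:
    "complex_matrix A $ 1 $ 1 * u1 + complex_matrix A $ 1 $ 2 * u2 = l * u1"
    "complex_matrix A $ 2 $ 1 * u1 + complex_matrix A $ 2 $ 2 * u2 = l * u2"
    "complex_matrix A $ 1 $ 1 * v1 + complex_matrix A $ 1 $ 2 * v2 = m * v1"
    "complex_matrix A $ 2 $ 1 * v1 + complex_matrix A $ 2 $ 2 * v2 = m * v2"
    "u1 * v2 - u2 * v1 \<noteq> 0"
    using diagonalizable_eigenbasis[OF A] by blast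
  have inv: "\<And>z. z \<in> U \<Longrightarrow> F z \<in> U \<Longrightarrow> P (F z) * Q z = P z * Q (F z)"
    using H unfolding meromorphic_first_integral_def by blast
  show ?thesis
  proof (rule linear_resonance[OF c d nontriv, where ?F1.0 = "\<lambda>x y. F (vector [x, y]) $ 1" and ?F2.0 = "\<lambda>x y. F (vector [x, y]) $ 2"])
    fix x y :: real
    show l1: "((\<lambda>t. F (vector [t * x, t * y]) $ 1 / t) \<longlongrightarrow> A $ 1 $ 1 * x + A $ 1 $ 2 * y) (at 0)"
      and l2: "((\<lambda>t. F (vector [t * x, t * y]) $ 2 / t) \<longlongrightarrow> A $ 2 $ 1 * x + A $ 2 $ 2 * y) (at 0)"
      by (rule directional_limit[OF F])+
    have small: "eventually (\<lambda>t. \<bar>f t\<bar> < r) (at 0)" if "((\<lambda>t. f t / t) \<longlongrightarrow> w) (at 0)" for f :: "real \<Rightarrow> real" and w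
    proof -
      have "((\<lambda>t. f t / t * t) \<longlongrightarrow> w * 0) (at 0)" by (intro tendsto_mult that tendsto_ident_at)
      then have "((\<lambda>t. f t / t * t) \<longlongrightarrow> 0) (at 0)" by simp
      then have "(f \<longlongrightarrow> 0) (at 0)"
        by (rule Lim_transform_eventually) (simp add: eventually_at_filter)
      then show ?thesis using r by (intro order_tendstoD(2)[OF tendsto_rabs_zero]) auto
    qed
    have lin: "((\<lambda>t. t * w) \<longlongrightarrow> 0) (at 0)" for w :: real
      by (rule tendsto_mult_left_zero) (rule tendsto_ident_at)
    have small': "eventually (\<lambda>t. \<bar>t * w\<bar> < r) (at 0)" for w :: real
      using r by (intro order_tendstoD(2)[OF tendsto_rabs_zero[OF lin]]) auto
    show "eventually (\<lambda>t.
      dseries c (F (vector [t * x, t * y]) $ 1) (F (vector [t * x, t * y]) $ 2) * dseries d (t * x) (t * y) =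
      dseries c (t * x) (t * y) * dseries d (F (vector [t * x, t * y]) $ 1) (F (vector [t * x, t * y]) $ 2)) (at 0)"
      using small[OF l1] small[OF l2] small'[of x] small'[of y]
    proof eventually_elim
      case (elim t)
      let ?z = "vector [t * x, t * y] :: real^2"
      have z: "?z \<in> U" "P ?z = dseries c (t * x) (t * y)" "Q ?z = dseries d (t * x) (t * y)"
        using exp[of ?z] elim by auto
      then show ?case using inv[of ?z] exp[of "F ?z"] elim by auto
    qed
  qed (use uv lm in \<open>auto simp: complex_matrix_def\<close>)
qed

section \<open>A zero eigenvalue\<close>

lemma dseries_lipschitz:
  fixes c :: "nat \<Rightarrow> nat \<Rightarrow> real"
  assumes c: "geo_bounded c S r" and m: "0 \<le> m" "m < r"
  obtains M where "M \<ge> 0" "\<And>x y x' y'. \<bar>x\<bar> \<le> m \<Longrightarrow> \<bar>y\<bar> \<le> m \<Longrightarrow> \<bar>x'\<bar> \<le> m \<Longrightarrow> \<bar>y'\<bar> \<le> m \<Longrightarrow>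
    \<bar>dseries c x y - dseries c x' y'\<bar> \<le> M * (\<bar>x - x'\<bar> + \<bar>y - y'\<bar>)"
proof -
  have one: "\<exists>M\<ge>0. \<forall>x x' y. \<bar>x\<bar> \<le> m \<longrightarrow> \<bar>x'\<bar> \<le> m \<longrightarrow> \<bar>y\<bar> \<le> m \<longrightarrow>
      \<bar>dseries c x y - dseries c x' y\<bar> \<le> M * \<bar>x - x'\<bar>"
    if c: "geo_bounded c S r" for c :: "nat \<Rightarrow> nat \<Rightarrow> real"
  proof -
    obtain r' where r': "m < r'" "r' < r" using m dense by blast
    obtain S' where S': "geo_bounded (dcoeff c) S' r'"
      using geo_bounded_dcoeff[OF c] r' m by (meson le_less_trans)
    have "compact ((\<lambda>z. dseries (dcoeff c) (fst z) (snd z)) ` (cball 0 m \<times> cball 0 m))"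
      by (intro compact_continuous_image continuous_on_dseries_cball[OF S' m(1) r'(1)] compact_Times) auto
    then have "bounded ((\<lambda>z. dseries (dcoeff c) (fst z) (snd z)) ` (cball 0 m \<times> cball 0 m))"
      by (rule compact_imp_bounded)
    then obtain B where B: "\<And>z. z \<in> cball 0 m \<times> cball 0 m \<Longrightarrow> norm (dseries (dcoeff c) (fst z) (snd z)) \<le> B"
      unfolding bounded_iff by (auto simp only: ball_simps)
    have "norm (dseries (dcoeff c) 0 0) \<le> B" using B[of "(0, 0)"] m by simp
    then have B0: "B \<ge> 0" using norm_ge_zero order_trans by blast
    have "\<bar>dseries c x y - dseries c x' y\<bar> \<le> B * \<bar>x - x'\<bar>" if "\<bar>x\<bar> \<le> m" "\<bar>x'\<bar> \<le> m" "\<bar>y\<bar> \<le> m" for x x' y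
    proof -
      have "norm (dseries c x y - dseries c x' y) \<le> B * norm (x - x')"
      proof (rule field_differentiable_bound[of "cball 0 m" "\<lambda>x. dseries c x y" "\<lambda>x. dseries (dcoeff c) x y"])
        fix z :: real assume "z \<in> cball 0 m"
        then have zy: "norm z < r" "norm y < r" using m that by auto
        show "((\<lambda>x. dseries c x y) has_field_derivative dseries (dcoeff c) z y) (at z within cball 0 m)"
          by (rule has_field_derivative_at_within[OF dseries_has_field_derivative[OF c zy]])
        show "norm (dseries (dcoeff c) z y) \<le> B" using B[of "(z, y)"] \<open>z \<in> cball 0 m\<close> that by auto
      qed (use that in auto)
      then show ?thesis by simp
    qed
    then show ?thesis using B0 by blast
  qed
  obtain M1 where M1: "M1 \<ge> 0" "\<And>x x' y. \<bar>x\<bar> \<le> m \<Longrightarrow> \<bar>x'\<bar> \<le> m \<Longrightarrow> \<bar>y\<bar> \<le> m \<Longrightarrow>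
      \<bar>dseries c x y - dseries c x' y\<bar> \<le> M1 * \<bar>x - x'\<bar>"
    using one[OF c] by blast
  obtain M2 where M2: "M2 \<ge> 0" "\<And>x x' y. \<bar>x\<bar> \<le> m \<Longrightarrow> \<bar>x'\<bar> \<le> m \<Longrightarrow> \<bar>y\<bar> \<le> m \<Longrightarrow>
      \<bar>dseries (\<lambda>i j. c j i) x y - dseries (\<lambda>i j. c j i) x' y\<bar> \<le> M2 * \<bar>x - x'\<bar>"
    using one[OF geo_bounded_swap[OF c]] by blast
  show ?thesis
  proof (rule that[of "M1 + M2"])
    fix x y x' y' :: real assume *: "\<bar>x\<bar> \<le> m" "\<bar>y\<bar> \<le> m" "\<bar>x'\<bar> \<le> m" "\<bar>y'\<bar> \<le> m"
    have "\<bar>dseries c x y - dseries c x' y\<bar> \<le> M1 * \<bar>x - x'\<bar>" using M1(2) * by simp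
    moreover have "\<bar>dseries c x' y - dseries c x' y'\<bar> \<le> M2 * \<bar>y - y'\<bar>"
      using M2(2)[of y y' x'] * unfolding dseries_swap[of c] by simp
    moreover have "M1 * \<bar>x - x'\<bar> + M2 * \<bar>y - y'\<bar> \<le> (M1 + M2) * (\<bar>x - x'\<bar> + \<bar>y - y'\<bar>)"
      using M1(1) M2(1) by (simp add: algebra_simps)
    ultimately show "\<bar>dseries c x y - dseries c x' y'\<bar> \<le> (M1 + M2) * (\<bar>x - x'\<bar> + \<bar>y - y'\<bar>)" by linarith
  qed (use M1 M2 in auto)
qed

text \<open>The derivative of the remainder at \<open>z\<close> is \<open>O(|z|)\<close>, because the derivative of \<open>F\<close> is differentiable at
  the origin; then apply the mean value inequality on a ball.\<close>

lemma C2_remainder_lipschitz: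
  fixes F :: "'a::real_normed_vector \<Rightarrow> 'b::real_normed_vector"
  assumes "C2_on F U" "open U" "0 \<in> U" and J: "(F has_derivative J) (at 0)"
  obtains K \<delta> where "K \<ge> 0" "\<delta> > 0" "ball 0 \<delta> \<subseteq> U"
    "\<And>a b. norm a < \<delta> \<Longrightarrow> norm b < \<delta> \<Longrightarrow>
      norm ((F a - J a) - (F b - J b)) \<le> K * max (norm a) (norm b) * norm (a - b)"
proof -
  obtain F' :: "'a \<Rightarrow> 'a \<Rightarrow>\<^sub>L 'b" and F'' :: "'a \<Rightarrow> 'a \<Rightarrow>\<^sub>L ('a \<Rightarrow>\<^sub>L 'b)"
    where F': "\<And>z. z \<in> U \<Longrightarrow> (F has_derivative blinfun_apply (F' z)) (at z)"
      and F'': "\<And>z. z \<in> U \<Longrightarrow> (F' has_derivative blinfun_apply (F'' z)) (at z)"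
    using assms(1) unfolding C2_on_def by blast
  have J0: "J = blinfun_apply (F' 0)" using has_derivative_unique[OF J F'[OF assms(3)]] .
  obtain \<rho> where \<rho>: "\<rho> > 0" "ball 0 \<rho> \<subseteq> U" using assms(2,3) by (meson open_contains_ball)
  obtain d where d: "d > 0" "\<And>y. norm (y - 0) < d \<Longrightarrow> norm (F' y - F' 0 - F'' 0 (y - 0)) \<le> 1 * norm (y - 0)"
    using F''[OF assms(3)] unfolding has_derivative_at_alt by (metis zero_less_one)
  define K where "K = norm (F'' 0) + 1"
  define \<delta> where "\<delta> = min \<rho> d"
  have der: "norm (F' y - F' 0) \<le> K * norm y" if "norm y < \<delta>" for y
  proof -
    have "norm (F' y - F' 0) \<le> norm (F' y - F' 0 - F'' 0 y) + norm (F'' 0 y)"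
      by (metis diff_add_cancel norm_triangle_ineq)
    also have "\<dots> \<le> 1 * norm y + norm (F'' 0) * norm y"
      using d(2)[of y] that by (intro add_mono norm_blinfun) (auto simp: \<delta>_def)
    finally show ?thesis by (simp add: K_def algebra_simps)
  qed
  show ?thesis
  proof (rule that[of K \<delta>])
    fix a b :: 'a assume ab: "norm a < \<delta>" "norm b < \<delta>"
    define m where "m = max (norm a) (norm b)"
    show "norm ((F a - J a) - (F b - J b)) \<le> K * max (norm a) (norm b) * norm (a - b)"
      unfolding m_def[symmetric]
    proof (rule differentiable_bound[of "cball 0 m" "\<lambda>z. F z - J z" "\<lambda>z. blinfun_apply (F' z - F' 0)"])
      fix z :: 'a assume z: "z \<in> cball 0 m"
      then have z': "norm z \<le> m" "norm z < \<delta>" using ab by (auto simp: m_def)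
      then have "z \<in> U" using \<rho> by (auto simp: \<delta>_def)
      then show "((\<lambda>z. F z - J z) has_derivative blinfun_apply (F' z - F' 0)) (at z within cball 0 m)"
        unfolding J0 minus_blinfun.rep_eq
        by (intro has_derivative_diff has_derivative_at_withinI[OF F'] bounded_linear_imp_has_derivative blinfun.bounded_linear_right)
      have "K * norm z \<le> K * m" using z' by (intro mult_left_mono) (auto simp: K_def)
      then show "onorm (blinfun_apply (F' z - F' 0)) \<le> K * m"
        using der[OF z'(2)] by (simp add: norm_blinfun.rep_eq)
    qed (auto simp: m_def)
  qed (use \<rho> d in \<open>auto simp: K_def \<delta>_def\<close>)
qed

definition clamp_box :: "real \<Rightarrow> real \<times> real \<Rightarrow> real \<times> real" where
  "clamp_box r z = (max (- r) (min r (fst z)), max (- r) (min r (snd z)))"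

lemma clamp_box_id: "supnorm z \<le> r \<Longrightarrow> clamp_box r z = z"
  by (auto simp: clamp_box_def supnorm_def prod_eq_iff abs_le_iff)

lemma supnorm_clamp_box:
  assumes "r \<ge> 0"
  shows "supnorm (clamp_box r z) \<le> min r (supnorm z)"
proof -
  have "\<bar>max (- r) (min r a)\<bar> \<le> r" "\<bar>max (- r) (min r a)\<bar> \<le> \<bar>a\<bar>" for a :: real using assms by linarith+
  then show ?thesis unfolding clamp_box_def supnorm_def by (simp add: max.coboundedI1 max.coboundedI2)
qed

lemma supnorm_clamp_box_diff: "supnorm (clamp_box r z - clamp_box r w) \<le> supnorm (z - w)"
proof -
  have "\<bar>max (- r) (min r a) - max (- r) (min r b)\<bar> \<le> \<bar>a - b\<bar>" for a b :: real by linarith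
  then show ?thesis unfolding clamp_box_def supnorm_def by (simp add: max.coboundedI1 max.coboundedI2)
qed

text \<open>If the origin is no common zero itself, continuity keeps common zeros away.\<close>

lemma first_integral_isolated_zeros:
  assumes H: "meromorphic_first_integral U F P Q" and U: "open U" "0 \<in> U"
    and cont: "isCont P 0" "isCont Q 0"
  obtains \<eta> where "\<eta> > 0" "\<And>w. w \<noteq> 0 \<Longrightarrow> norm w < \<eta> \<Longrightarrow> P w \<noteq> 0 \<or> Q w \<noteq> 0"
proof -
  obtain \<rho> where \<rho>: "\<rho> > 0" "ball 0 \<rho> \<subseteq> U" using U by (meson open_contains_ball)
  define Z where "Z = {z\<in>U. P z = 0 \<and> Q z = 0}"
  have Z: "discrete Z"
    using H unfolding meromorphic_first_integral_def meromorphic2_on_def coprime_on_def Z_def by blast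
  have "eventually (\<lambda>w. P w \<noteq> 0 \<or> Q w \<noteq> 0) (at 0)"
  proof (cases "0 \<in> Z")
    case True
    then have "0 isolated_in Z" using Z by (rule discreteD[rotated])
    then have "\<not> 0 islimpt Z" by (simp add: isolated_in_islimpt_iff)
    then have "eventually (\<lambda>w. w \<notin> Z) (at 0)" by (simp add: islimpt_iff_eventually)
    moreover have "eventually (\<lambda>w. w \<in> U) (at 0)" using U by (rule eventually_at_in_open')
    ultimately show ?thesis by eventually_elim (auto simp: Z_def)
  next
    case False
    then consider "P 0 \<noteq> 0" | "Q 0 \<noteq> 0" using U by (auto simp: Z_def)
    then show ?thesis
    proof cases
      case 1
      then have "eventually (\<lambda>w. P w \<noteq> 0) (at 0)"
        using cont(1) by (intro tendsto_imp_eventually_ne) (auto simp: isCont_def)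
      then show ?thesis by eventually_elim simp
    next
      case 2
      then have "eventually (\<lambda>w. Q w \<noteq> 0) (at 0)"
        using cont(2) by (intro tendsto_imp_eventually_ne) (auto simp: isCont_def)
      then show ?thesis by eventually_elim simp
    qed
  qed
  then show ?thesis using that unfolding eventually_at by (auto simp: dist_norm)
qed

text \<open>In the eigenbasis the map is a perturbation of \<open>(x, y) \<mapsto> (k x, 0)\<close>, after the nonlinear part has been
  extended from a small box to the plane by composition with the projection onto the box. The
  theorems on such maps yield a combination of \<open>P\<close> and \<open>Q\<close> that is flat on a wedge, so that its
  expansion is zero.\<close>

lemma zero_eigenvalue_no_first_integral:
  fixes F :: "real^2 \<Rightarrow> real^2" and A :: "real^2^2" and k :: real
  assumes H: "meromorphic_first_integral U F P Q" and U: "open U" "0 \<in> U"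
    and C2: "C2_on F U" and F: "(F has_derivative (\<lambda>h. A *v h)) (at 0)" "F 0 = 0"
    and u: "A $ 1 $ 1 * u1 + A $ 1 $ 2 * u2 = k * u1" "A $ 2 $ 1 * u1 + A $ 2 $ 2 * u2 = k * u2"
    and v: "A $ 1 $ 1 * v1 + A $ 1 $ 2 * v2 = 0" "A $ 2 $ 1 * v1 + A $ 2 $ 2 * v2 = 0"
    and det: "u1 * v2 - u2 * v1 \<noteq> 0" and k: "k \<noteq> 0" "\<bar>k\<bar> \<noteq> 1"
  shows False
proof -
  obtain c d S T0 \<rho> where c: "geo_bounded c S \<rho>" and d: "geo_bounded d T0 \<rho>"
    and exp: "\<And>z::real^2. \<bar>z $ 1\<bar> < \<rho> \<Longrightarrow> \<bar>z $ 2\<bar> < \<rho> \<Longrightarrow> z \<in> U \<and> P z = dseries c (z $ 1) (z $ 2) \<and> Q z = dseries d (z $ 1) (z $ 2)"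
    and nontriv: "\<And>a b. a \<noteq> 0 \<or> b \<noteq> 0 \<Longrightarrow> \<exists>i j. a * c i j + b * d i j \<noteq> 0"
    by (rule first_integral_expansions[OF H U]) blast
  have \<rho>: "\<rho> > 0" using c by (simp add: geo_bounded_def)
  have inv: "\<And>z. z \<in> U \<Longrightarrow> F z \<in> U \<Longrightarrow> P (F z) * Q z = P z * Q (F z)"
    using H unfolding meromorphic_first_integral_def by blast

  obtain M1 where M1: "M1 \<ge> 0" "\<And>x y x' y'. \<bar>x\<bar> \<le> \<rho> / 2 \<Longrightarrow> \<bar>y\<bar> \<le> \<rho> / 2 \<Longrightarrow> \<bar>x'\<bar> \<le> \<rho> / 2 \<Longrightarrow> \<bar>y'\<bar> \<le> \<rho> / 2 \<Longrightarrow>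
    \<bar>dseries c x y - dseries c x' y'\<bar> \<le> M1 * (\<bar>x - x'\<bar> + \<bar>y - y'\<bar>)"
    using dseries_lipschitz[OF c, of "\<rho> / 2"] \<rho> by auto
  obtain M2 where M2: "M2 \<ge> 0" "\<And>x y x' y'. \<bar>x\<bar> \<le> \<rho> / 2 \<Longrightarrow> \<bar>y\<bar> \<le> \<rho> / 2 \<Longrightarrow> \<bar>x'\<bar> \<le> \<rho> / 2 \<Longrightarrow> \<bar>y'\<bar> \<le> \<rho> / 2 \<Longrightarrow>
    \<bar>dseries d x y - dseries d x' y'\<bar> \<le> M2 * (\<bar>x - x'\<bar> + \<bar>y - y'\<bar>)"
    using dseries_lipschitz[OF d, of "\<rho> / 2"] \<rho> by auto
  have cont: "isCont f 0"
    if e: "geo_bounded e E \<rho>" and f: "\<And>z::real^2. \<bar>z $ 1\<bar> < \<rho> \<Longrightarrow> \<bar>z $ 2\<bar> < \<rho> \<Longrightarrow> f z = dseries e (z $ 1) (z $ 2)"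
    for e E and f :: "real^2 \<Rightarrow> real"
  proof -
    have "continuous_on (ball 0 (\<rho> / 2)) (\<lambda>z::real^2. dseries e (z $ 1) (z $ 2))"
    proof (rule continuous_on_dseries[OF e, where m = "\<rho> / 2"])
      fix z :: "real^2" assume "z \<in> ball 0 (\<rho> / 2)"
      then show "norm (z $ 1) \<le> \<rho> / 2" "norm (z $ 2) \<le> \<rho> / 2"
        using component_le_norm_cart[of z 1] component_le_norm_cart[of z 2] by auto
    qed (use \<rho> in \<open>auto intro!: continuous_intros\<close>)
    then have "isCont (\<lambda>z::real^2. dseries e (z $ 1) (z $ 2)) 0"
      using \<rho> by (subst (asm) continuous_on_eq_continuous_at) auto
    moreover have "eventually (\<lambda>z::real^2. dseries e (z $ 1) (z $ 2) = f z) (nhds 0)"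
      unfolding eventually_nhds_metric
    proof (intro exI[of _ \<rho>] conjI allI impI)
      fix z :: "real^2" assume "dist z 0 < \<rho>"
      then show "dseries e (z $ 1) (z $ 2) = f z"
        using component_le_norm_cart[of z 1] component_le_norm_cart[of z 2] f[of z] by auto
    qed (rule \<rho>)
    ultimately show ?thesis by (simp add: isCont_cong)
  qed
  have contPQ: "isCont P 0" "isCont Q 0"
    by (rule cont[OF c], use exp in blast) (rule cont[OF d], use exp in blast)
  obtain \<eta> where \<eta>: "\<eta> > 0" "\<And>w. w \<noteq> 0 \<Longrightarrow> norm w < \<eta> \<Longrightarrow> P w \<noteq> 0 \<or> Q w \<noteq> 0"
    by (rule first_integral_isolated_zeros[OF H U contPQ]) blast
  obtain K0 \<delta> where K0: "K0 \<ge> 0" "\<delta> > 0"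
    "\<And>a b. norm a < \<delta> \<Longrightarrow> norm b < \<delta> \<Longrightarrow> norm ((F a - A *v a) - (F b - A *v b)) \<le> K0 * max (norm a) (norm b) * norm (a - b)"
    by (rule C2_remainder_lipschitz[OF C2 U F(1)]) blast

  define \<Delta> where "\<Delta> = u1 * v2 - u2 * v1"
  have \<Delta>: "\<Delta> \<noteq> 0" using det by (simp add: \<Delta>_def)
  define T :: "real \<times> real \<Rightarrow> real^2" where "T = (\<lambda>z. vector [fst z * u1 + snd z * v1, fst z * u2 + snd z * v2])"
  define Ti :: "real^2 \<Rightarrow> real \<times> real" where "Ti = (\<lambda>w. ((w $ 1 * v2 - w $ 2 * v1) / \<Delta>, (u1 * w $ 2 - u2 * w $ 1) / \<Delta>))"
  have T12: "T z $ 1 = fst z * u1 + snd z * v1" "T z $ 2 = fst z * u2 + snd z * v2" for z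
    by (simp_all add: T_def)
  have TiT: "Ti (T z) = z" for z
    using \<Delta> by (simp add: Ti_def T12 prod_eq_iff field_simps) (simp add: \<Delta>_def algebra_simps)
  have TTi: "T (Ti w) = w" for w
    using \<Delta> by (simp add: vec_eq_iff forall_2 Ti_def T12 field_simps) (simp add: \<Delta>_def algebra_simps)
  have Tdiff: "T (z - w) = T z - T w" for z w by (simp add: vec_eq_iff forall_2 T12 algebra_simps)
  have Tidiff: "Ti (z - w) = Ti z - Ti w" for z w by (simp add: Ti_def diff_divide_distrib algebra_simps)
  have AT: "Ti (A *v T z) = (k * fst z, 0)" for z
  proof -
    have "A *v T z = T (k * fst z, 0)"
    proof -
      have "(A *v T z) $ i = fst z * (A $ i $ 1 * u1 + A $ i $ 2 * u2) + snd z * (A $ i $ 1 * v1 + A $ i $ 2 * v2)" for i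
        by (simp add: matrix_vector_mult_def sum_2 T12 algebra_simps)
      from this[of 1] this[of 2] have "(A *v T z) $ 1 = fst z * (k * u1)" "(A *v T z) $ 2 = fst z * (k * u2)"
        unfolding u v by simp_all
      then show ?thesis by (simp add: vec_eq_iff forall_2 T12)
    qed
    then show ?thesis by (simp add: TiT)
  qed
  define CT where "CT = \<bar>u1\<bar> + \<bar>u2\<bar> + \<bar>v1\<bar> + \<bar>v2\<bar>"
  define CI where "CI = CT / \<bar>\<Delta>\<bar>"
  have CT0: "CT > 0"
  proof (rule ccontr)
    assume "\<not> CT > 0"
    then have "u1 = 0" "u2 = 0" unfolding CT_def by linarith+
    then show False using det by simp
  qed
  have CI0: "CI > 0" using CT0 \<Delta> by (simp add: CI_def)
  have Tcomp: "\<bar>T z $ 1\<bar> + \<bar>T z $ 2\<bar> \<le> CT * supnorm z" for z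
  proof -
    have "\<bar>T z $ 1\<bar> \<le> \<bar>u1\<bar> * \<bar>fst z\<bar> + \<bar>v1\<bar> * \<bar>snd z\<bar>" "\<bar>T z $ 2\<bar> \<le> \<bar>u2\<bar> * \<bar>fst z\<bar> + \<bar>v2\<bar> * \<bar>snd z\<bar>"
      unfolding T12 by (metis abs_mult abs_triangle_ineq mult.commute)+
    moreover have "\<bar>u1\<bar> * \<bar>fst z\<bar> \<le> \<bar>u1\<bar> * supnorm z" "\<bar>v1\<bar> * \<bar>snd z\<bar> \<le> \<bar>v1\<bar> * supnorm z"
      "\<bar>u2\<bar> * \<bar>fst z\<bar> \<le> \<bar>u2\<bar> * supnorm z" "\<bar>v2\<bar> * \<bar>snd z\<bar> \<le> \<bar>v2\<bar> * supnorm z"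
      by (intro mult_left_mono supnorm_fst supnorm_snd abs_ge_zero)+
    ultimately show ?thesis unfolding CT_def distrib_right by linarith
  qed
  have Tnorm: "norm (T z) \<le> CT * supnorm z" for z using Tcomp[of z] real2_norm_le[of "T z"] by linarith
  have Tilin: "supnorm (Ti w) \<le> CI * max \<bar>w $ 1\<bar> \<bar>w $ 2\<bar>" for w
  proof -
    let ?m = "max \<bar>w $ 1\<bar> \<bar>w $ 2\<bar>"
    have le: "\<bar>a * w $ i - b * w $ j\<bar> \<le> CT * ?m" if "\<bar>a\<bar> + \<bar>b\<bar> \<le> CT" for a b i j
    proof -
      have w: "\<bar>w $ i\<bar> \<le> ?m" for i using exhaust_2[of i] by auto
      have "\<bar>a * w $ i - b * w $ j\<bar> \<le> \<bar>a\<bar> * \<bar>w $ i\<bar> + \<bar>b\<bar> * \<bar>w $ j\<bar>"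
        by (metis abs_mult abs_triangle_ineq4)
      also have "\<dots> \<le> \<bar>a\<bar> * ?m + \<bar>b\<bar> * ?m" using w by (intro add_mono mult_left_mono) auto
      also have "\<dots> \<le> CT * ?m" unfolding distrib_right[symmetric] using that by (intro mult_right_mono) auto
      finally show ?thesis .
    qed
    have "\<bar>fst (Ti w)\<bar> \<le> CT * ?m / \<bar>\<Delta>\<bar>" "\<bar>snd (Ti w)\<bar> \<le> CT * ?m / \<bar>\<Delta>\<bar>"
    proof -
      have "\<bar>v2 * w $ 1 - v1 * w $ 2\<bar> \<le> CT * ?m" "\<bar>u1 * w $ 2 - u2 * w $ 1\<bar> \<le> CT * ?m"
        by (rule le, simp add: CT_def)+
      then show "\<bar>fst (Ti w)\<bar> \<le> CT * ?m / \<bar>\<Delta>\<bar>" "\<bar>snd (Ti w)\<bar> \<le> CT * ?m / \<bar>\<Delta>\<bar>"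
        unfolding Ti_def fst_conv snd_conv abs_divide by (intro divide_right_mono; simp add: mult.commute)+
    qed
    then show ?thesis by (simp add: supnorm_def CI_def)
  qed
  have Tinorm: "supnorm (Ti w) \<le> CI * norm w" for w
  proof -
    have "CI * max \<bar>w $ 1\<bar> \<bar>w $ 2\<bar> \<le> CI * norm w"
      using CI0 component_le_norm_cart[of w] by (intro mult_left_mono) auto
    then show ?thesis using Tilin[of w] by linarith
  qed

  define R where "R = (\<lambda>z. Ti (F (T z) - A *v T z))"
  define K where "K = CI * K0 * CT * CT"
  have K: "K \<ge> 0" using CI0 CT0 K0 by (simp add: K_def)
  have Rlip: "supnorm (R z - R w) \<le> K * max (supnorm z) (supnorm w) * supnorm (z - w)"
    if zw: "CT * supnorm z < \<delta>" "CT * supnorm w < \<delta>" for z w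
  proof -
    have "supnorm (R z - R w) \<le> CI * norm ((F (T z) - A *v T z) - (F (T w) - A *v T w))"
      unfolding R_def Tidiff[symmetric] by (rule Tinorm)
    also have "\<dots> \<le> CI * (K0 * max (norm (T z)) (norm (T w)) * norm (T z - T w))"
      using zw Tnorm[of z] Tnorm[of w] CI0 by (intro mult_left_mono K0(3)) auto
    also have "\<dots> \<le> CI * (K0 * (CT * max (supnorm z) (supnorm w)) * (CT * supnorm (z - w)))"
    proof -
      have "CT * supnorm z \<le> CT * max (supnorm z) (supnorm w)" "CT * supnorm w \<le> CT * max (supnorm z) (supnorm w)"
        using CT0 by (auto intro!: mult_left_mono)
      then have "max (norm (T z)) (norm (T w)) \<le> CT * max (supnorm z) (supnorm w)"
        using Tnorm[of z] Tnorm[of w] by auto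
      moreover have "norm (T z - T w) \<le> CT * supnorm (z - w)" using Tnorm[of "z - w"] by (simp add: Tdiff)
      ultimately show ?thesis
        using CI0 K0 CT0 by (intro mult_left_mono mult_mono) (auto simp: le_max_iff_disj)
    qed
    also have "\<dots> = K * max (supnorm z) (supnorm w) * supnorm (z - w)" by (simp add: K_def)
    finally show ?thesis .
  qed
  define gap where "gap = min \<bar>k\<bar> \<bar>\<bar>k\<bar> - 1\<bar>"
  have gap: "gap > 0" using k by (simp add: gap_def)
  define r where "r = min (min (\<delta> / (2 * CT)) (\<rho> / (2 * CT))) (min (\<eta> / (2 * CT)) (min 1 gap / (4 * (K + 1))))"
  have r: "r > 0" using K0 \<rho> \<eta> gap CT0 K by (auto simp: r_def)
  have CTr: "CT * r < \<delta>" "CT * r \<le> \<rho> / 2" "CT * r < \<eta>"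
  proof -
    have "r \<le> \<delta> / (2 * CT)" "r \<le> \<rho> / (2 * CT)" "r \<le> \<eta> / (2 * CT)"
      unfolding r_def by linarith+
    then have "CT * r \<le> CT * (\<delta> / (2 * CT))" "CT * r \<le> CT * (\<rho> / (2 * CT))" "CT * r \<le> CT * (\<eta> / (2 * CT))"
      using CT0 by (simp_all only: mult_le_cancel_left_pos)
    then show "CT * r < \<delta>" "CT * r \<le> \<rho> / 2" "CT * r < \<eta>" using CT0 K0(2) \<rho> \<eta>(1) by auto
  qed
  have Ksmall: "4 * (K * r) < min 1 gap"
  proof -
    have "r \<le> min 1 gap / (4 * (K + 1))" unfolding r_def by linarith
    then have "(K + 1) * r \<le> (K + 1) * (min 1 gap / (4 * (K + 1)))" using K by (intro mult_left_mono) auto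
    also have "\<dots> = min 1 gap / 4"
    proof -
      have "x * (y / (4 * x)) = y / 4" if "x > 0" for x y :: real using that by simp
      then show ?thesis by this (use K in linarith)
    qed
    finally have "4 * ((K + 1) * r) \<le> min 1 gap" by simp
    moreover have "K * r < (K + 1) * r" using r by simp
    ultimately show ?thesis by linarith
  qed
  have box: "CT * supnorm z \<le> CT * r" if "supnorm z \<le> r" for z using that CT0 by simp
  have Tsmall: "\<bar>T z $ 1\<bar> \<le> \<rho> / 2" "\<bar>T z $ 2\<bar> \<le> \<rho> / 2" "T z \<in> U"
    "P (T z) = dseries c (T z $ 1) (T z $ 2)" "Q (T z) = dseries d (T z $ 1) (T z $ 2)" if "supnorm z \<le> r" for z
  proof -
    show 1: "\<bar>T z $ 1\<bar> \<le> \<rho> / 2" "\<bar>T z $ 2\<bar> \<le> \<rho> / 2" using Tcomp[of z] box[OF that] CTr(2) by linarith+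
    then have "\<bar>T z $ 1\<bar> < \<rho>" "\<bar>T z $ 2\<bar> < \<rho>" using \<rho> by linarith+
    then show "T z \<in> U" "P (T z) = dseries c (T z $ 1) (T z $ 2)" "Q (T z) = dseries d (T z $ 1) (T z $ 2)"
      using exp by auto
  qed
  define al be where "al = (\<lambda>z. fst (R (clamp_box r z)))" and "be = (\<lambda>z. snd (R (clamp_box r z)))"
  have clip: "supnorm (R (clamp_box r z) - R (clamp_box r w)) \<le> K * min r (max (supnorm z) (supnorm w)) * supnorm (z - w)" for z w
  proof -
    have cz: "supnorm (clamp_box r z) \<le> min r (supnorm z)" "supnorm (clamp_box r w) \<le> min r (supnorm w)"
      using supnorm_clamp_box r by auto
    then have "CT * supnorm (clamp_box r z) < \<delta>" "CT * supnorm (clamp_box r w) < \<delta>"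
      using box[of "clamp_box r z"] box[of "clamp_box r w"] CTr(1) by auto
    from Rlip[OF this]
    have "supnorm (R (clamp_box r z) - R (clamp_box r w))
      \<le> K * max (supnorm (clamp_box r z)) (supnorm (clamp_box r w)) * supnorm (clamp_box r z - clamp_box r w)" .
    also have "\<dots> \<le> K * min r (max (supnorm z) (supnorm w)) * supnorm (z - w)"
      using cz K r supnorm_clamp_box_diff[of r z w] by (intro mult_mono mult_left_mono) (auto simp: le_max_iff_disj)
    finally show ?thesis .
  qed
  have T0: "T 0 = 0" by (simp add: vec_eq_iff forall_2 T12)
  have R0: "R 0 = 0" by (simp add: R_def T0 F(2)) (simp add: Ti_def zero_prod_def)
  interpret slow_fast_map k K r al be
  proof
    have "clamp_box r 0 = 0" using r by (intro clamp_box_id) simp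
    then show "al 0 = 0" "be 0 = 0" by (simp_all add: al_def be_def R0)
    show "4 * (K * r) \<le> \<bar>k\<bar>" "K * r \<le> 1" using Ksmall K r by (auto simp: gap_def)
    fix z w
    have "\<bar>al z - al w\<bar> \<le> supnorm (R (clamp_box r z) - R (clamp_box r w))"
      "\<bar>be z - be w\<bar> \<le> supnorm (R (clamp_box r z) - R (clamp_box r w))"
      using supnorm_fst[of "R (clamp_box r z) - R (clamp_box r w)"] supnorm_snd[of "R (clamp_box r z) - R (clamp_box r w)"]
      by (simp_all add: al_def be_def)
    then show "\<bar>al z - al w\<bar> \<le> K * min r (max (supnorm z) (supnorm w)) * supnorm (z - w)"
      "\<bar>be z - be w\<bar> \<le> K * min r (max (supnorm z) (supnorm w)) * supnorm (z - w)"
      using clip[of z w] by linarith+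
  qed (use k K r in auto)
  have GF: "T (G z) = F (T z)" if "supnorm z \<le> r" for z
  proof -
    have "al z = fst (R z)" "be z = snd (R z)" by (simp_all add: al_def be_def clamp_box_id[OF that])
    then have "G z = R z + (k * fst z, 0)" by (simp add: G_def prod_eq_iff)
    also have "R z = Ti (F (T z)) - (k * fst z, 0)" by (simp add: R_def Tidiff AT)
    finally show ?thesis by (simp add: TTi)
  qed
  define p q where "p = (\<lambda>n. hform c n u1 u2)" and "q = (\<lambda>n. hform d n u1 u2)"
  have ray: "(\<lambda>n. hform e n w1 w2 * s ^ n) sums dseries e (s * w1) (s * w2)"
    if "geo_bounded e E \<rho>" "\<bar>s * w1\<bar> < \<rho>" "\<bar>s * w2\<bar> < \<rho>" for e :: "nat \<Rightarrow> nat \<Rightarrow> real" and E s w1 w2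
    using hform_sums_dseries[OF that(1), of "s * w1" "s * w2"] that unfolding hform_scale by (simp add: mult.commute)
  interpret slow_fast_integral k K r al be "\<lambda>z. P (T z)" "\<lambda>z. Q (T z)" "(M1 + M2) * CT" p q
  proof
    fix z assume z: "supnorm z \<le> r"
    {
      assume "supnorm (G z) \<le> r"
      then show "P (T (G z)) * Q (T z) = P (T z) * Q (T (G z))"
        using inv[of "T z"] Tsmall(3)[OF z] Tsmall(3)[of "G z"] GF[OF z] by simp
    }
    {
      assume "z \<noteq> 0"
      moreover have "T 0 = 0" by (simp add: vec_eq_iff forall_2 T12)
      ultimately have "T z \<noteq> 0" using TiT by metis
      then show "P (T z) \<noteq> 0 \<or> Q (T z) \<noteq> 0"
        using \<eta>(2)[of "T z"] Tnorm[of z] box[OF z] CTr(3) by linarith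
    }
    fix w assume w: "supnorm w \<le> r"
    have Td: "\<bar>T z $ 1 - T w $ 1\<bar> + \<bar>T z $ 2 - T w $ 2\<bar> \<le> CT * supnorm (z - w)"
      using Tcomp[of "z - w"] by (simp add: Tdiff)
    have "\<bar>P (T z) - P (T w)\<bar> \<le> M1 * (\<bar>T z $ 1 - T w $ 1\<bar> + \<bar>T z $ 2 - T w $ 2\<bar>)"
      unfolding Tsmall(4)[OF z] Tsmall(4)[OF w] by (intro M1(2) Tsmall(1,2) z w)
    also have "\<dots> \<le> (M1 + M2) * (CT * supnorm (z - w))" using Td M1(1) M2(1) by (intro mult_mono) auto
    finally show "\<bar>P (T z) - P (T w)\<bar> \<le> (M1 + M2) * CT * supnorm (z - w)" by simp
    have "\<bar>Q (T z) - Q (T w)\<bar> \<le> M2 * (\<bar>T z $ 1 - T w $ 1\<bar> + \<bar>T z $ 2 - T w $ 2\<bar>)"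
      unfolding Tsmall(5)[OF z] Tsmall(5)[OF w] by (intro M2(2) Tsmall(1,2) z w)
    also have "\<dots> \<le> (M1 + M2) * (CT * supnorm (z - w))" using Td M1(1) M2(1) by (intro mult_mono) auto
    finally show "\<bar>Q (T z) - Q (T w)\<bar> \<le> (M1 + M2) * CT * supnorm (z - w)" by simp
  next
    fix s :: real assume "\<bar>s\<bar> \<le> r"
    then have s: "supnorm (s, 0) \<le> r" by (simp add: supnorm_def)
    note t = Tsmall(1,2)[OF s, unfolded T12, simplified]
    have "\<bar>s * u1\<bar> < \<rho>" "\<bar>s * u2\<bar> < \<rho>" using t \<rho> by linarith+
    then show "(\<lambda>n. p n * s ^ n) sums P (T (s, 0))" "(\<lambda>n. q n * s ^ n) sums Q (T (s, 0))"
      unfolding p_def q_def Tsmall(4,5)[OF s] T12 using ray[OF c, of s u1 u2] ray[OF d, of s u1 u2] by simp_all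
  qed

  \<comment> \<open>On the zero set of the combination \<open>e\<close> of \<open>P\<close> and \<open>Q\<close>, one of \<open>P\<close>, \<open>Q\<close> is nowhere zero, namely one with
    the coefficient of the other one in \<open>e\<close> nonzero. It cannot be flat.\<close>
  have noflat: no_flat_zero_sequence
    unfolding no_flat_zero_sequence_def
  proof (intro allI impI notI)
    fix a b :: real and \<zeta> :: "nat \<Rightarrow> real \<times> real"
    assume A: "(a \<noteq> 0 \<or> b \<noteq> 0) \<and> \<zeta> \<longlonglongrightarrow> 0 \<and> (\<forall>n. \<zeta> n \<noteq> 0) \<and> (\<forall>n. a * P (T (\<zeta> n)) + b * Q (T (\<zeta> n)) = 0)"
      and fl: "\<forall>N. \<exists>C. \<forall>n. \<bar>P (T (\<zeta> n))\<bar> \<le> C * supnorm (\<zeta> n) ^ N \<and> \<bar>Q (T (\<zeta> n))\<bar> \<le> C * supnorm (\<zeta> n) ^ N"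
    have "(\<lambda>n. norm (\<zeta> n)) \<longlonglongrightarrow> 0" using A tendsto_norm_zero by blast
    then have "eventually (\<lambda>n. norm (\<zeta> n) < r) sequentially" using r by (rule order_tendstoD)
    then obtain n0 where n0: "\<And>n. n \<ge> n0 \<Longrightarrow> norm (\<zeta> n) < r" by (auto simp: eventually_sequentially)
    define \<xi> where "\<xi> = (\<lambda>n. \<zeta> (n + n0))"
    have \<xi>r: "supnorm (\<xi> n) \<le> r" for n using n0[of "n + n0"] supnorm_le_norm[of "\<xi> n"] by (simp add: \<xi>_def)
    have \<xi>nz: "\<xi> n \<noteq> 0" for n using A by (simp add: \<xi>_def)
    define x y where "x = (\<lambda>n. T (\<xi> n) $ 1)" and "y = (\<lambda>n. T (\<xi> n) $ 2)"
    have "\<xi> \<longlonglongrightarrow> 0" unfolding \<xi>_def using A by (intro LIMSEQ_ignore_initial_segment) blast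
    then have lims: "(\<lambda>n. fst (\<xi> n)) \<longlonglongrightarrow> 0" "(\<lambda>n. snd (\<xi> n)) \<longlonglongrightarrow> 0"
      using tendsto_fst[of \<xi> 0] tendsto_snd[of \<xi> 0] by auto
    have xy: "x \<longlonglongrightarrow> 0" "y \<longlonglongrightarrow> 0"
      unfolding x_def y_def T12 using lims by (auto intro!: tendsto_add_zero tendsto_mult_left_zero)
    have xyr: "norm (x n) < \<rho>" "norm (y n) < \<rho>" for n
      using Tsmall(1,2)[OF \<xi>r[of n]] \<rho> unfolding x_def y_def by auto
    define e where "e = (\<lambda>i j. a * c i j + b * d i j)"
    have e: "geo_bounded e (norm a * S + norm b * T0) \<rho>" unfolding e_def by (rule geo_bounded_lincomb[OF c d])
    obtain i j where ij: "e i j \<noteq> 0" using nontriv[of a b] A unfolding e_def by blast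
    have xy0: "x n \<noteq> 0 \<or> y n \<noteq> 0" for n
    proof (rule ccontr)
      assume "\<not> ?thesis"
      then have "T (\<xi> n) = 0" by (simp add: x_def y_def vec_eq_iff forall_2)
      then have "\<xi> n = Ti 0" using TiT by metis
      then show False using \<xi>nz[of n] by (simp add: Ti_def zero_prod_def)
    qed
    have xP: "dseries c (x n) (y n) = P (T (\<xi> n))" "dseries d (x n) (y n) = Q (T (\<xi> n))" for n
      using Tsmall(4,5)[OF \<xi>r[of n]] by (simp_all add: x_def y_def)
    have rel: "a * P (T (\<xi> n)) + b * Q (T (\<xi> n)) = 0" for n using A by (simp add: \<xi>_def)
    have ez: "dseries e (x n) (y n) = 0" for n
      unfolding e_def dseries_lincomb[OF c d xyr] xP by (rule rel)
    have PQn: "P (T (\<xi> n)) \<noteq> 0 \<or> Q (T (\<xi> n)) \<noteq> 0" for n using nz[OF \<xi>nz \<xi>r] .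
    have flat: "\<exists>C. \<forall>n. \<bar>dseries c (x n) (y n)\<bar> \<le> C * max \<bar>x n\<bar> \<bar>y n\<bar> ^ N \<and>
        \<bar>dseries d (x n) (y n)\<bar> \<le> C * max \<bar>x n\<bar> \<bar>y n\<bar> ^ N" for N
    proof -
      obtain C where C: "\<And>n. \<bar>P (T (\<zeta> n))\<bar> \<le> C * supnorm (\<zeta> n) ^ N \<and> \<bar>Q (T (\<zeta> n))\<bar> \<le> C * supnorm (\<zeta> n) ^ N"
        using fl by blast
      have le: "C * supnorm (\<xi> n) ^ N \<le> \<bar>C\<bar> * CI ^ N * max \<bar>x n\<bar> \<bar>y n\<bar> ^ N" for n
      proof -
        have "supnorm (\<xi> n) \<le> CI * max \<bar>x n\<bar> \<bar>y n\<bar>"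
          using Tilin[of "T (\<xi> n)"] by (simp add: TiT x_def y_def)
        then have "supnorm (\<xi> n) ^ N \<le> (CI * max \<bar>x n\<bar> \<bar>y n\<bar>) ^ N" by (intro power_mono) auto
        then have "\<bar>C\<bar> * supnorm (\<xi> n) ^ N \<le> \<bar>C\<bar> * (CI * max \<bar>x n\<bar> \<bar>y n\<bar>) ^ N" by (intro mult_left_mono) auto
        moreover have "C * supnorm (\<xi> n) ^ N \<le> \<bar>C\<bar> * supnorm (\<xi> n) ^ N" by (intro mult_right_mono) auto
        ultimately show ?thesis by (simp add: power_mult_distrib mult.assoc)
      qed
      have "\<bar>P (T (\<xi> n))\<bar> \<le> C * supnorm (\<xi> n) ^ N" "\<bar>Q (T (\<xi> n))\<bar> \<le> C * supnorm (\<xi> n) ^ N" for n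
        using C by (simp_all add: \<xi>_def)
      from order_trans[OF this(1) le] order_trans[OF this(2) le]
      show ?thesis unfolding xP by blast
    qed
    show False
    proof (cases "b = 0")
      case True
      then have "dseries d (x n) (y n) \<noteq> 0" for n
        using PQn[of n] rel[of n] A unfolding xP by auto
      then show False
        using flat_on_zero_set[OF e d ij xy xy0 ez, simplified] flat by meson
    next
      case False
      then have "dseries c (x n) (y n) \<noteq> 0" for n
        using PQn[of n] rel[of n] unfolding xP by auto
      then show False
        using flat_on_zero_set[OF e c ij xy xy0 ez, simplified] flat by meson
    qed
  qed

  have "\<exists>a b. (a \<noteq> 0 \<or> b \<noteq> 0) \<and>
    (\<forall>N. \<exists>C. \<forall>z\<in>wedge. supnorm z \<le> r / 2 \<longrightarrow> \<bar>a * P (T z) + b * Q (T z)\<bar> \<le> C * supnorm z ^ N)"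
  proof -
    have Kgap: "4 * (K * r) < \<bar>\<bar>k\<bar> - 1\<bar>" using Ksmall unfolding gap_def by linarith
    have Kr0: "0 \<le> K * r" using K r by simp
    show ?thesis
  proof (cases "\<bar>k\<bar> < 1")
    case True
    then have "\<bar>k\<bar> + \<epsilon> < 1" using Kgap Kr0 unfolding \<epsilon>_def by linarith
    from contracting_case[OF this noflat] obtain a b where
      ab: "a \<noteq> 0 \<or> b \<noteq> 0" "\<forall>z\<in>wedge. supnorm z \<le> r / 2 \<longrightarrow> a * P (T z) + b * Q (T z) = 0" by blast
    then show ?thesis by (intro exI[of _ a] exI[of _ b]) (auto intro!: exI[of _ 0])
  next
    case False
    then have "1 < \<bar>k\<bar> - \<epsilon>" using Kgap Kr0 k(2) unfolding \<epsilon>_def by linarith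
    from expanding_case[OF this] obtain a b where
      ab: "a \<noteq> 0 \<or> b \<noteq> 0" "\<forall>N. \<exists>C. \<forall>z\<in>wedge. supnorm z \<le> r \<longrightarrow> \<bar>a * P (T z) + b * Q (T z)\<bar> \<le> C * supnorm z ^ N" by blast
    have "supnorm z \<le> r / 2 \<Longrightarrow> supnorm z \<le> r" for z using r by linarith
    then show ?thesis using ab by meson
  qed
  qed
  then obtain a b where ab: "a \<noteq> 0 \<or> b \<noteq> 0"
    and flat: "\<And>N. \<exists>C. \<forall>z\<in>wedge. supnorm z \<le> r / 2 \<longrightarrow> \<bar>a * P (T z) + b * Q (T z)\<bar> \<le> C * supnorm z ^ N" by blast
  define e where "e = (\<lambda>i j. a * c i j + b * d i j)"
  have e: "geo_bounded e (norm a * S + norm b * T0) \<rho>" unfolding e_def by (rule geo_bounded_lincomb[OF c d])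
  \<comment> \<open>On every ray in the wedge the combination is a flat power series, hence zero.\<close>
  have ray0: "hform e n (u1 + t * v1) (u2 + t * v2) = 0" if t: "\<bar>t\<bar> \<le> 1 / 2" for t n
  proof -
    define f where "f = (\<lambda>s. a * P (T (s, s * t)) + b * Q (T (s, s * t)))"
    have sn: "supnorm (s, s * t) = \<bar>s\<bar>" for s
    proof -
      have "\<bar>s\<bar> * \<bar>t\<bar> \<le> \<bar>s\<bar> * 1" using t by (intro mult_left_mono) auto
      then show ?thesis by (simp add: supnorm_def abs_mult)
    qed
    have Ts: "T (s, s * t) $ 1 = s * (u1 + t * v1)" "T (s, s * t) $ 2 = s * (u2 + t * v2)" for s
      by (simp_all add: T12 algebra_simps)
    have sums: "(\<lambda>n. hform e n (u1 + t * v1) (u2 + t * v2) * s ^ n) sums f s" if s: "norm s < r" for s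
    proof -
      have sr: "supnorm (s, s * t) \<le> r" using s by (simp add: sn)
      have lt: "\<bar>s * (u1 + t * v1)\<bar> < \<rho>" "\<bar>s * (u2 + t * v2)\<bar> < \<rho>"
        using Tsmall(1,2)[OF sr] \<rho> unfolding Ts by linarith+
      have "f s = dseries e (s * (u1 + t * v1)) (s * (u2 + t * v2))"
        unfolding f_def Tsmall(4,5)[OF sr] Ts e_def using lt by (subst dseries_lincomb[OF c d]) auto
      then show ?thesis using ray[OF e lt] by simp
    qed
    define \<sigma> where "\<sigma> = (\<lambda>j::nat. r / 2 * (1 / 2) ^ j)"
    have "(\<lambda>j. (1 / 2 :: real) ^ j) \<longlonglongrightarrow> 0" by (intro LIMSEQ_realpow_zero) auto
    then have \<sigma>0: "\<sigma> \<longlonglongrightarrow> 0" unfolding \<sigma>_def by (rule tendsto_mult_right_zero)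
    have \<sigma>: "0 < \<sigma> j" "\<sigma> j \<le> r / 2" for j
    proof -
      show "0 < \<sigma> j" using r by (simp add: \<sigma>_def)
      have "r / 2 * (1 / 2) ^ j \<le> r / 2 * 1" using r by (intro mult_left_mono power_le_one) auto
      then show "\<sigma> j \<le> r / 2" by (simp add: \<sigma>_def)
    qed
    show ?thesis
    proof (rule powser_flat_imp_zero[OF r sums \<sigma>0])
      show "\<sigma> j \<noteq> 0" for j using \<sigma>(1)[of j] by simp
      fix N
      obtain C where C: "\<forall>z\<in>wedge. supnorm z \<le> r / 2 \<longrightarrow> \<bar>a * P (T z) + b * Q (T z)\<bar> \<le> C * supnorm z ^ N"
        using flat by blast
      have "norm (f (\<sigma> j)) \<le> C * norm (\<sigma> j) ^ N" for j
      proof -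
        have "2 * (\<sigma> j * \<bar>t\<bar>) \<le> \<sigma> j * 1" using t \<sigma>(1)[of j] mult_left_mono[of "2 * \<bar>t\<bar>" 1 "\<sigma> j"] by simp
        then have "(\<sigma> j, \<sigma> j * t) \<in> wedge" using \<sigma>(1)[of j] by (simp add: wedge_def abs_mult)
        then show ?thesis using C \<sigma>[of j] sn[of "\<sigma> j"] by (auto simp: f_def)
      qed
      then show "\<exists>C. \<forall>\<^sub>F j in sequentially. norm (f (\<sigma> j)) \<le> C * norm (\<sigma> j) ^ N" by (auto intro!: exI[of _ C])
    qed auto
  qed
  have det': "v1 * u2 - v2 * u1 \<noteq> 0" using det by (simp add: algebra_simps)
  have "{-1/2..1/2} \<subseteq> {t. hform e n (u1 + t * v1) (u2 + t * v2) = 0}" for n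
    using ray0 by (auto simp: abs_le_iff)
  moreover have "infinite {-1/2..1/2::real}" by (rule infinite_Icc) simp
  ultimately have inf: "infinite {t. hform e n (u1 + t * v1) (u2 + t * v2) = 0}" for n
    using finite_subset by blast
  have "e i (n - i) = 0" if "i \<le> n" for i n by (rule hform_coeffs_zero[OF det' inf that])
  then have "e i j = 0" for i j by (metis add_diff_cancel_left' le_add1)
  then show False using nontriv[OF ab] by (simp add: e_def)
qed

section \<open>The resonance conditions\<close>

lemma powi_eq_1_imp_eq_1:
  fixes x :: real
  assumes "x > 0" "x powi n = 1" "n \<noteq> 0"
  shows "x = 1"
proof -
  have "x powr (real_of_int n) = 1" using assms by (simp add: powr_real_of_int')
  then have "real_of_int n * ln x = 0" using assms(1) by (metis ln_one ln_powr)
  then show ?thesis using assms by simp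
qed

text \<open>Taking absolute values gives \<open>|l|^(p + q) = 1\<close>. If \<open>p + q = 0\<close>, the absolute value cancels, and the
  argument of \<open>l\<close> satisfies the stated relation with \<open>n = |p|\<close>.\<close>

lemma conjugate_resonance:
  fixes l :: complex and p q :: int
  assumes "l \<noteq> 0" "(p, q) \<noteq> (0, 0)" "l powi p * cnj l powi q = 1"
  shows "cmod l = 1 \<or> (\<exists>t :: real. l = of_real (cmod l) * exp (\<i> * of_real t) \<and>
    (\<exists>n :: nat. n \<noteq> 0 \<and> exp (\<i> * of_real t) ^ (2 * n) = 1))"
proof (cases "p + q = 0")
  case False
  have "cmod l powi (p + q) = cmod (l powi p * cnj l powi q)"
    using assms(1) by (simp add: norm_mult norm_power_int power_int_add)
  then have "cmod l powi (p + q) = 1" using assms(3) by simp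
  then show ?thesis using powi_eq_1_imp_eq_1[of "cmod l" "p + q"] False assms(1) by simp
next
  case True
  then have q: "q = - p" and p: "p \<noteq> 0" using assms(2) by auto
  define t where "t = Arg l"
  define e where "e = exp (\<i> * of_real t)"
  have l: "l = of_real (cmod l) * e" unfolding e_def t_def using Arg_eq[OF assms(1)] .
  have e0: "e \<noteq> 0" by (simp add: e_def)
  have "cnj e = inverse e" by (simp add: e_def exp_cnj exp_minus[symmetric])
  then have cl: "cnj l = of_real (cmod l) * inverse e" by (metis l complex_cnj_complex_of_real complex_cnj_mult)
  have "l / cnj l = e ^ 2" unfolding cl using assms(1) e0 by (subst l) (simp add: power2_eq_square divide_inverse)
  moreover have "(l / cnj l) powi p = 1"
    unfolding power_int_divide_distrib using assms(3) unfolding q power_int_minus divide_inverse .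
  ultimately have "(e ^ 2) powi p = 1" by simp
  then have "(e ^ 2) ^ nat \<bar>p\<bar> = 1"
    by (cases "p \<ge> 0") (auto simp: power_int_def power_inverse)
  then have "e ^ (2 * nat \<bar>p\<bar>) = 1" by (simp add: power_mult)
  then show ?thesis using l p unfolding e_def by (intro disjI2 exI[of _ t] conjI exI[of _ "nat \<bar>p\<bar>"]) auto
qed

theorem corollary2:
  fixes U :: "(real^2) set" and F :: "real^2 \<Rightarrow> real^2" and l m :: complex
  assumes "open U" and "0 \<in> U"
    and "C2_on F U" and "F 0 = 0"
    and "diagonalizable (complex_matrix (jacobian F (at 0)))"
    and "eigenvalues2 (complex_matrix (jacobian F (at 0))) l m"
    and "\<exists>P Q. meromorphic_first_integral U F P Q"
  shows
    "(l \<in> \<real> \<and> m \<in> \<real> \<and> l * m \<noteq> 0 \<longrightarrow>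
        (\<exists>p q :: int. (p, q) \<noteq> (0, 0) \<and> l powi p * m powi q = 1)) \<and>
     (l \<noteq> 0 \<and> l \<notin> \<real> \<longrightarrow>
        m = cnj l \<and>
        (cmod l = 1 \<or>
         (\<exists>t :: real. l = of_real (cmod l) * exp (\<i> * of_real t) \<and>
           (\<exists>n :: nat. n \<noteq> 0 \<and> exp (\<i> * of_real t) ^ (2 * n) = 1)))) \<and>
     (l \<noteq> 0 \<and> m = 0 \<longrightarrow> (\<exists>n :: nat. n > 0 \<and> l ^ n = 1))"
proof -
  obtain P Q where H: "meromorphic_first_integral U F P Q" using assms(7) by blast
  define A where "A = jacobian F (at 0)"
  have F: "(F has_derivative (\<lambda>h. A *v h)) (at 0)"
    unfolding A_def by (rule C2_on_derivative_jacobian[OF assms(3,2)])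
  note diag = assms(5)[folded A_def] and eig = assms(6)[folded A_def]
  have res: "\<exists>p q :: int. (p, q) \<noteq> (0, 0) \<and> l powi p * m powi q = 1" if "l \<noteq> 0" "m \<noteq> 0"
    by (rule invertible_derivative_resonance[OF H assms(1,2) F assms(4) diag eig that])
  have tr: "l + m = of_real (A $ 1 $ 1 + A $ 2 $ 2)"
    and dt: "l * m = of_real (A $ 1 $ 1 * A $ 2 $ 2 - A $ 1 $ 2 * A $ 2 $ 1)"
    using eigenvalues2_trace_det[OF eig] by (simp_all add: complex_matrix_def)
  show ?thesis
  proof (intro conjI impI)
    assume "l \<in> \<real> \<and> m \<in> \<real> \<and> l * m \<noteq> 0"
    then show "\<exists>p q :: int. (p, q) \<noteq> (0, 0) \<and> l powi p * m powi q = 1" using res by auto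
  next
    assume l: "l \<noteq> 0 \<and> l \<notin> \<real>"
    then have Im: "Im l \<noteq> 0" by (simp add: complex_is_Real_iff)
    have "Im (l + m) = 0" "Im (l * m) = 0" unfolding tr dt by simp_all
    then have im: "Im m = - Im l" and "Re l * Im m + Im l * Re m = 0" by auto
    then have "Im l * (Re m - Re l) = 0" by (simp add: algebra_simps)
    then have "Re m = Re l" using Im by simp
    then show m: "m = cnj l" using im by (simp add: complex_eq_iff)
    then have "m \<noteq> 0" using l by simp
    then obtain p q :: int where "(p, q) \<noteq> (0, 0)" "l powi p * cnj l powi q = 1" using res l m by blast
    then show "cmod l = 1 \<or>
         (\<exists>t :: real. l = of_real (cmod l) * exp (\<i> * of_real t) \<and>
           (\<exists>n :: nat. n \<noteq> 0 \<and> exp (\<i> * of_real t) ^ (2 * n) = 1))"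
      using conjugate_resonance l by blast
  next
    assume lm: "l \<noteq> 0 \<and> m = 0"
    define k where "k = A $ 1 $ 1 + A $ 2 $ 2"
    have lk: "l = of_real k" using tr lm by (simp add: k_def)
    have k0: "k \<noteq> 0" using lk lm by auto
    obtain u1 u2 v1 v2 where uv:
      "complex_matrix A $ 1 $ 1 * u1 + complex_matrix A $ 1 $ 2 * u2 = l * u1"
      "complex_matrix A $ 2 $ 1 * u1 + complex_matrix A $ 2 $ 2 * u2 = l * u2"
      "complex_matrix A $ 1 $ 1 * v1 + complex_matrix A $ 1 $ 2 * v2 = m * v1"
      "complex_matrix A $ 2 $ 1 * v1 + complex_matrix A $ 2 $ 2 * v2 = m * v2"
      "u1 * v2 - u2 * v1 \<noteq> 0"
      by (rule diagonalizable_eigenbasis[OF diag eig]) blast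
    obtain x1 x2 where x: "A $ 1 $ 1 * x1 + A $ 1 $ 2 * x2 = k * x1" "A $ 2 $ 1 * x1 + A $ 2 $ 2 * x2 = k * x2"
      "x1 \<noteq> 0 \<or> x2 \<noteq> 0"
    proof (rule real_eigenvector)
      show "of_real (A $ 1 $ 1) * u1 + of_real (A $ 1 $ 2) * u2 = of_real k * u1"
        "of_real (A $ 2 $ 1) * u1 + of_real (A $ 2 $ 2) * u2 = of_real k * u2" "u1 \<noteq> 0 \<or> u2 \<noteq> 0"
        using uv by (auto simp: complex_matrix_def lk)
    qed
    obtain y1 y2 where y: "A $ 1 $ 1 * y1 + A $ 1 $ 2 * y2 = 0 * y1" "A $ 2 $ 1 * y1 + A $ 2 $ 2 * y2 = 0 * y2"
      "y1 \<noteq> 0 \<or> y2 \<noteq> 0"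
    proof (rule real_eigenvector)
      show "of_real (A $ 1 $ 1) * v1 + of_real (A $ 1 $ 2) * v2 = of_real 0 * v1"
        "of_real (A $ 2 $ 1) * v1 + of_real (A $ 2 $ 2) * v2 = of_real 0 * v2" "v1 \<noteq> 0 \<or> v2 \<noteq> 0"
        using uv lm by (auto simp: complex_matrix_def)
    qed
    have det: "x1 * y2 - x2 * y1 \<noteq> 0"
    proof
      assume d: "x1 * y2 - x2 * y1 = 0"
      have "k * (x1 * y1) = 0" "k * (x1 * y2) = 0" "k * (x2 * y1) = 0" "k * (x2 * y2) = 0"
        using x(1,2) y(1,2) d by algebra+
      then show False using k0 x(3) y(3) by auto
    qed
    have "\<bar>k\<bar> = 1"
    proof (rule ccontr)
      assume "\<bar>k\<bar> \<noteq> 1"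
      from zero_eigenvalue_no_first_integral[OF H assms(1,2,3) F assms(4) x(1,2) _ _ det k0 this] y(1,2)
      show False by simp
    qed
    then have "k ^ 2 = 1" by (simp add: abs_square_eq_1)
    then have "l ^ 2 = 1" unfolding lk by (simp flip: of_real_power)
    then show "\<exists>n :: nat. n > 0 \<and> l ^ n = 1" by (intro exI[of _ 2]) simp
  qed
qed

end
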